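(* Let $\{a_n\}_{n\ge0}$ be a sequence of non-negative real numbers, let $\{\xi_n\}_{n\ge0}$ be i.i.d. standard complex Gaussian random variables, and let $G(z)=\sum_{n=0}^\infty a_n\xi_nz^n$. If $G\in\mathrm{SL}$ almost surely, then $G\in\mathrm{VMOA}$ almost surely.
   Context: A standard complex Gaussian has density $\frac1\pi e^{-|z|^2}$ on $\mathbb{C}$. $H^1$ is the Hardy space of the unit disk, whose elements are identified with their boundary values on the unit circle; $e(\theta)=e^{2\pi i\theta}$. Sledd space: For $N\ge0$ let $K_N(z)=\sum_{k=-N}^N\big(1-\frac{|k|}{N+1}\big)z^k$ ($|z|=1$) be the Fejér kernel, and let $$T_0(z)=1+\tfrac12z+\tfrac12z^{-1},\qquad T_n=2K_{2^{n+2}-1}-K_{2^{n+1}-1}+K_{2^{n-1}-1}-2K_{2^n-1}\quad(n\ge1).$$ With $\star$ denoting convolution on the circle, $(T_n\star F)(x)=\sum_k\widehat{T_n}(k)\widehat F(k)x^k$, put $\|F\|_{S(T)}^2=\sup_{|x|=1}\sum_{n=0}^\infty|T_n\star F(x)|^2$ for $F\in H^1$, and $\mathrm{SL}=\{F\in H^1:\|F\|_{S(T)}<\infty\}$. VMOA: For an interval (arc) $I\subset\mathbb{R}/\mathbb{Z}$ and $F\in H^1$ put $M_I(F)=\frac1{|I|}\int_I\big|F(e(\theta))-\frac1{|I|}\int_I F(e(\phi))\,d\phi\big|\,d\theta$ and $\|F\|_*=\sup_I M_I(F)$. $\mathrm{BMOA}=\{F\in H^1:\|F\|_*<\infty\}$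 and $\mathrm{VMOA}$ is the closure of the polynomials in $\mathrm{BMOA}$ with respect to $\|\cdot\|_*$; equivalently, the set of $F\in H^1$ with $\lim_{\delta\to0}\sup_{|I|\le\delta}M_I(F)=0$. *)

theory Defs
  imports "HOL-Probability.Probability" "HOL-Complex_Analysis.Complex_Analysis"
    "HOL-Computational_Algebra.Polynomial"
begin

definition ee :: "real \<Rightarrow> complex" where
  "ee \<theta> = exp (2 * of_real pi * \<i> * of_real \<theta>)"

definition hardy1 :: "(complex \<Rightarrow> complex) set" where
  "hardy1 = {F. F holomorphic_on ball 0 1 \<and>
     bdd_above ((\<lambda>r. LINT \<theta>:{0..1}|lborel. cmod (F (of_real r * ee \<theta>))) ` {0..<1})}"

text \<open>Elements of the Hardy space are functions of the disk; only their values on the open unit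
  disk matter. Values on the circle always refer to the radial limit, which for elements of
  \<^term>\<open>hardy1\<close> exists almost everywhere (Fatou); elsewhere \<^const>\<open>Lim\<close> is a
  fixed unspecified value, which no integral sees.\<close>

definition boundary :: "(complex \<Rightarrow> complex) \<Rightarrow> complex \<Rightarrow> complex" where
  "boundary F x = Lim (at_left (1::real)) (\<lambda>r. F (of_real r * x))"

definition fourier_coeff :: "(complex \<Rightarrow> complex) \<Rightarrow> int \<Rightarrow> complex" where
  "fourier_coeff f k = (LINT \<theta>:{0..1}|lborel. f (ee \<theta>) * ee (- of_int k * \<theta>))"

text \<open>The sum below is only used with a trigonometric polynomial as first argument, so that only
  finitely many terms are nonzero.\<close>

definition circle_conv ::
  "(complex \<Rightarrow> complex) \<Rightarrow> (complex \<Rightarrow> complex) \<Rightarrow> complex \<Rightarrow> complex" where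
  "circle_conv f g x = (\<Sum>\<^sub>\<infinity>k\<in>(UNIV :: int set). fourier_coeff f k * fourier_coeff g k * x powi k)"

definition fejer :: "nat \<Rightarrow> complex \<Rightarrow> complex" where
  "fejer N z = (\<Sum>k\<in>{- int N..int N}. of_real (1 - \<bar>of_int k\<bar> / (real N + 1)) * z powi k)"

definition sledd_kernel :: "nat \<Rightarrow> complex \<Rightarrow> complex" where
  "sledd_kernel n z =
     (if n = 0 then 1 + 1 / 2 * z + 1 / 2 * inverse z
      else 2 * fejer (2 ^ (n + 2) - 1) z - fejer (2 ^ (n + 1) - 1) z
           + fejer (2 ^ (n - 1) - 1) z - 2 * fejer (2 ^ n - 1) z)"

definition sledd_norm_sq :: "(complex \<Rightarrow> complex) \<Rightarrow> ennreal" where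
  "sledd_norm_sq F =
     (SUP x\<in>sphere 0 1. \<Sum>n. ennreal ((cmod (circle_conv (sledd_kernel n) (boundary F) x))\<^sup>2))"

definition SL :: "(complex \<Rightarrow> complex) set" where
  "SL = {F \<in> hardy1. sledd_norm_sq F < \<infinity>}"

text \<open>Arcs of $\mathbb{R}/\mathbb{Z}$ are represented by real intervals \<^term>\<open>{s..t}\<close>
  with \<^term>\<open>s < t\<close> and \<^term>\<open>t \<le> s + 1\<close>; endpoints have measure zero.\<close>

definition arc_mean :: "(complex \<Rightarrow> complex) \<Rightarrow> real \<Rightarrow> real \<Rightarrow> complex" where
  "arc_mean F s t = (LINT \<phi>:{s..t}|lborel. boundary F (ee \<phi>)) / of_real (t - s)"

definition mean_osc :: "(complex \<Rightarrow> complex) \<Rightarrow> real \<Rightarrow> real \<Rightarrow> real" where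
  "mean_osc F s t =
     (LINT \<theta>:{s..t}|lborel. cmod (boundary F (ee \<theta>) - arc_mean F s t)) / (t - s)"

definition bmo_norm :: "(complex \<Rightarrow> complex) \<Rightarrow> ennreal" where
  "bmo_norm F = (SUP (s, t)\<in>{(s, t). s < t \<and> t \<le> s + 1}. ennreal (mean_osc F s t))"

definition BMOA :: "(complex \<Rightarrow> complex) set" where
  "BMOA = {F \<in> hardy1. bmo_norm F < \<infinity>}"

definition VMOA :: "(complex \<Rightarrow> complex) set" where
  "VMOA = {F \<in> BMOA. \<forall>\<epsilon>>0. \<exists>p :: complex poly. bmo_norm (\<lambda>z. F z - poly p z) < ennreal \<epsilon>}"

text \<open>A power series belongs to a space of functions on the disk if it converges in the whole disk
  and its sum is in the space. Convergence is required explicitly because \<^const>\<open>suminf\<close>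
  of a divergent series is an unspecified value.\<close>

definition power_series_in :: "(nat \<Rightarrow> complex) \<Rightarrow> (complex \<Rightarrow> complex) set \<Rightarrow> bool" where
  "power_series_in c X \<longleftrightarrow>
     (\<forall>z\<in>ball 0 1. summable (\<lambda>n. c n * z ^ n)) \<and> (\<lambda>z. \<Sum>n. c n * z ^ n) \<in> X"

definition std_complex_gaussian :: "'w measure \<Rightarrow> ('w \<Rightarrow> complex) \<Rightarrow> bool" where
  "std_complex_gaussian M X \<longleftrightarrow>
     distributed M lborel X (\<lambda>z. ennreal (1 / pi * exp (- (cmod z)\<^sup>2)))"

end

theory Submission
  imports Defs "HOL-Real_Asymp.Real_Asymp"
begin

text \<open>Almost sure membership in $H^1$ forces $\sum a_n^2 < \infty$, because otherwise $|G(rx)|$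
  would be large on most of the circle with high probability. Hence $G$ has square summable
  coefficients and its series converges almost everywhere on the circle, which identifies the radial
  limits and their Fourier coefficients. The tails $\sum_{n>m} |T_n \star G(x)|^2$ tend to $0$
  uniformly in $x$ almost surely: by the zero-one law and rotation invariance, a positive limit
  would be attained on every arc, and nested arcs would make the full sum unbounded. Finally
  $\sum_{n>m} T_n \star G$ is $2G$ up to a polynomial, and its mean oscillation over an arc of length
  $1/N$ is bounded by the square root of the tail sum: Bernstein's inequality controls the blocks with
  $2^n < N$, and orthogonality with respect to a Fejer kernel controls the others.\<close>

section \<open>The circle\<close>

text \<open>The factor 2 in $2G$ comes from telescoping: at frequencies k >= 0 the multipliers of
  T_1, ..., T_M add up to \<open>ramp M\<close> minus \<open>ramp 0\<close>, and
  \<open>ramp M\<close> equals 2 up to 2^M. The passage from square function to mean oscillation is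
  deterministic. Chance enters twice: to produce square summable coefficients together with
  convergence almost everywhere on the circle, and to make the tails small. Square summability comes
  first because the boundary values rest on it: Abel's theorem yields the radial limits, and L^2
  approximation by Taylor sections yields their Fourier coefficients, so that each T_n * G becomes
  an explicit polynomial in the random coefficients. The obstacle is uniformity. A bounded square
  function makes the tail tend to 0 at every single point, but the supremum over x of the tail need
  not tend to 0. Polynomial approximation in the mean oscillation norm needs exactly this
  supremum.\<close>

lemma ee_0 [simp]: "ee 0 = 1"
  by (simp add: ee_def)

lemma ee_eq_cis: "ee t = cis (2 * pi * t)"
  by (simp add: ee_def cis_conv_exp mult_ac)

lemma norm_ee [simp]: "norm (ee t) = 1"
  by (simp add: ee_eq_cis)

lemma ee_add: "ee (s + t) = ee s * ee t"
  by (simp add: ee_eq_cis cis_mult algebra_simps)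

lemma ee_minus: "ee (- t) = cnj (ee t)"
  by (simp add: ee_eq_cis cis_cnj)

lemma ee_diff: "ee (s - t) = ee s * cnj (ee t)"
  using ee_add[of s "- t"] by (simp add: ee_minus)

lemma ee_mult_cnj [simp]: "ee t * cnj (ee t) = 1"
  by (simp flip: ee_minus ee_add)

lemma ee_power: "ee t ^ n = ee (real n * t)"
  unfolding ee_eq_cis Complex.DeMoivre by (rule arg_cong[where f=cis]) simp

lemma ee_powi: "ee t powi k = ee (of_int k * t)"
  by (simp add: ee_eq_cis cis_power_int mult_ac)

lemma ee_of_int [simp]: "ee (of_int k) = 1"
  by (simp add: ee_eq_cis cis_multiple_2pi)

lemma ee_add_1 [simp]: "ee (t + 1) = ee t"
  using ee_of_int[of 1] by (simp add: ee_add)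

lemma continuous_on_ee [continuous_intros]:
  "continuous_on A f \<Longrightarrow> continuous_on A (\<lambda>x. ee (f x))"
  unfolding ee_def by (intro continuous_intros)

lemma borel_measurable_ee [measurable]: "ee \<in> borel_measurable borel"
  by (intro borel_measurable_continuous_onI continuous_intros)

lemma has_vector_derivative_ee [derivative_intros]:
  "((\<lambda>t. ee (c * t)) has_vector_derivative (2 * of_real pi * \<i> * of_real c) * ee (c * t)) (at t within A)"
proof -
  have "((\<lambda>z. exp (2 * of_real pi * \<i> * of_real c * z)) has_field_derivative
      (2 * of_real pi * \<i> * of_real c) * exp (2 * of_real pi * \<i> * of_real c * of_real t))
      (at (of_real t))"
    by (auto intro!: derivative_eq_intros)
  from has_vector_derivative_real_field[OF this] show ?thesis
    by (simp add: ee_def mult_ac)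
qed

lemma set_integral_continuous_integrable:
  fixes f :: "real \<Rightarrow> 'a :: {banach, second_countable_topology}"
  assumes "continuous_on UNIV f" shows "set_integrable lborel {s..t} f"
  using assms by (intro borel_integrable_atLeastAtMost' ) (auto intro: continuous_on_subset)

text \<open>The period starts at an arbitrary u because an arc \<open>{s..t}\<close> is later
  enlarged to the full period \<open>{s..s+1}\<close> that contains it.\<close>

lemma integral_ee:
  "(LINT t:{u..u+1}|lborel. ee (of_int k * t)) = (if k = 0 then 1 else 0)"
proof (cases "k = 0")
  case False
  have "(LINT t:{u..u+1}|lborel. ee (of_int k * t)) = integral {u..u+1} (\<lambda>t. ee (of_int k * t))"
    by (intro set_borel_integral_eq_integral set_integral_continuous_integrable continuous_intros)
  also have "((\<lambda>t. ee (of_int k * t)) has_integral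
      (ee (of_int k * (u+1)) / (2 * of_real pi * \<i> * of_int k) -
       ee (of_int k * u) / (2 * of_real pi * \<i> * of_int k))) {u..u+1}"
    using False
    by (intro fundamental_theorem_of_calculus)
       (auto intro!: derivative_eq_intros)
  hence "integral {u..u+1} (\<lambda>t. ee (of_int k * t)) = 0"
    by (simp add: has_integral_iff algebra_simps ee_add)
  finally show ?thesis using False by simp
qed (simp add: set_lebesgue_integral_def)

section \<open>Polynomials on the circle\<close>

lemma poly_ee:
  assumes "degree p \<le> N"
  shows "poly p (ee t) = (\<Sum>k\<le>N. coeff p k * ee (real k * t))"
proof -
  have "poly p (ee t) = (\<Sum>k\<le>degree p. coeff p k * ee (real k * t))"
    by (simp add: poly_altdef ee_power)
  also have "\<dots> = (\<Sum>k\<le>N. coeff p k * ee (real k * t))"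
    using assms by (intro sum.mono_neutral_left) (auto simp: coeff_eq_0)
  finally show ?thesis .
qed

lemma set_integrable_sum:
  fixes f :: "'i \<Rightarrow> 'a \<Rightarrow> 'b :: {banach, second_countable_topology}"
  assumes "\<And>i. i \<in> I \<Longrightarrow> set_integrable M A (f i)"
  shows "set_integrable M A (\<lambda>x. \<Sum>i\<in>I. f i x)"
    and "(LINT x:A|M. (\<Sum>i\<in>I. f i x)) = (\<Sum>i\<in>I. LINT x:A|M. f i x)"
  using assms unfolding set_integrable_def set_lebesgue_integral_def
  by (auto simp: scaleR_sum_right)

lemma integral_poly_mult_cnj:
  assumes "degree p \<le> N" "degree q \<le> N"
  shows "(LINT t:{u..u+1}|lborel. poly p (ee t) * cnj (poly q (ee t))) =
    (\<Sum>k\<le>N. coeff p k * cnj (coeff q k))"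
proof -
  have *: "poly p (ee t) * cnj (poly q (ee t)) =
      (\<Sum>i\<le>N. \<Sum>j\<le>N. (coeff p i * cnj (coeff q j)) * ee (of_int (int i - int j) * t))" for t
    unfolding poly_ee[OF assms(1)] poly_ee[OF assms(2)] cnj_sum sum_product
    by (intro sum.cong refl) (simp add: left_diff_distrib ee_diff)
  have "(LINT t:{u..u+1}|lborel. poly p (ee t) * cnj (poly q (ee t))) =
      (\<Sum>i\<le>N. \<Sum>j\<le>N. (coeff p i * cnj (coeff q j)) * (LINT t:{u..u+1}|lborel. ee (of_int (int i - int j) * t)))"
    unfolding *
    by (subst set_integrable_sum(2) set_integral_mult_right,
        (intro set_integral_continuous_integrable continuous_intros)?)+ simp
  also have "\<dots> = (\<Sum>i\<le>N. \<Sum>j\<le>N. if i = j then coeff p i * cnj (coeff q j) else 0)"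
    by (intro sum.cong refl) (simp add: integral_ee del: of_int_diff)
  also have "\<dots> = (\<Sum>k\<le>N. coeff p k * cnj (coeff q k))"
    by (simp add: sum.delta' if_distrib cong: if_cong)
  finally show ?thesis .
qed

lemma integral_cmod_poly_sq:
  assumes "degree p \<le> N"
  shows "(LINT t:{u..u+1}|lborel. (cmod (poly p (ee t)))\<^sup>2) = (\<Sum>k\<le>N. (cmod (coeff p k))\<^sup>2)"
proof -
  have "complex_of_real (LINT t:{u..u+1}|lborel. (cmod (poly p (ee t)))\<^sup>2) =
      (LINT t:{u..u+1}|lborel. poly p (ee t) * cnj (poly p (ee t)))"
    by (simp only: set_integral_complex_of_real[symmetric] complex_norm_square)
  also have "\<dots> = complex_of_real (\<Sum>k\<le>N. (cmod (coeff p k))\<^sup>2)"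
    unfolding integral_poly_mult_cnj[OF assms assms] by (simp add: complex_norm_square del: of_real_power)
  finally show ?thesis using of_real_eq_iff by blast
qed

lemma integral_cmod_poly_sum_sq:
  assumes fin: "finite S"
    and disj: "\<And>i j k. i \<in> S \<Longrightarrow> j \<in> S \<Longrightarrow> i \<noteq> j \<Longrightarrow> coeff (q i) k = 0 \<or> coeff (q j) k = 0"
  shows "(LINT t:{u..u+1}|lborel. (cmod (\<Sum>i\<in>S. poly (q i) (ee t)))\<^sup>2) =
    (\<Sum>i\<in>S. LINT t:{u..u+1}|lborel. (cmod (poly (q i) (ee t)))\<^sup>2)"
proof -
  define N where "N = (\<Sum>i\<in>S. degree (q i))"
  have N: "degree (q i) \<le> N" if "i \<in> S" for i
    unfolding N_def using that fin by (intro member_le_sum) auto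
  have N': "degree (\<Sum>i\<in>S. q i) \<le> N"
    using N by (intro degree_sum_le) (auto simp: fin)
  \<comment> \<open>At each frequency at most one summand is nonzero, so the cross terms vanish
    already coefficientwise.\<close>
  have sq: "(cmod (\<Sum>i\<in>S. coeff (q i) k))\<^sup>2 = (\<Sum>i\<in>S. (cmod (coeff (q i) k))\<^sup>2)" for k
  proof (cases "\<exists>i\<in>S. coeff (q i) k \<noteq> 0")
    case True
    then obtain i where i: "i \<in> S" "coeff (q i) k \<noteq> 0" by blast
    hence "coeff (q j) k = 0" if "j \<in> S - {i}" for j using disj[of i j k] that by auto
    thus ?thesis using i fin by (simp add: sum.remove)
  qed simp
  have "(LINT t:{u..u+1}|lborel. (cmod (\<Sum>i\<in>S. poly (q i) (ee t)))\<^sup>2) =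
      (\<Sum>k\<le>N. (cmod (coeff (\<Sum>i\<in>S. q i) k))\<^sup>2)"
    using integral_cmod_poly_sq[OF N'] by (simp add: poly_sum)
  also have "\<dots> = (\<Sum>i\<in>S. \<Sum>k\<le>N. (cmod (coeff (q i) k))\<^sup>2)"
    by (subst sum.swap) (simp add: coeff_sum sq)
  also have "\<dots> = (\<Sum>i\<in>S. LINT t:{u..u+1}|lborel. (cmod (poly (q i) (ee t)))\<^sup>2)"
    by (intro sum.cong refl integral_cmod_poly_sq[OF N, symmetric])
  finally show ?thesis .
qed

text \<open>The Dirichlet kernel with frequencies 0, ..., N-1, translated so that it peaks at e(a).
  Its squared modulus is N times the translated Fejer kernel of order N-1. It is kept one-sided so
  that its product with an analytic polynomial is again a polynomial.\<close>

definition dirichlet :: "nat \<Rightarrow> real \<Rightarrow> complex poly" where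
  "dirichlet N a = (\<Sum>j<N. monom (ee (- (real j * a))) j)"

lemma coeff_dirichlet: "coeff (dirichlet N a) k = (if k < N then ee (- (real k * a)) else 0)"
  by (simp add: dirichlet_def coeff_sum sum.delta if_distrib cong: if_cong)

lemma poly_dirichlet: "poly (dirichlet N a) (ee t) = (\<Sum>j<N. ee (real j * (t - a)))"
  by (auto simp: dirichlet_def poly_sum poly_monom ee_power right_diff_distrib
      ee_diff ee_minus mult_ac intro!: sum.cong)

lemma degree_dirichlet: "degree (dirichlet N a) \<le> N"
  by (rule degree_le) (simp add: coeff_dirichlet)

lemma integral_dirichlet_sq:
  "(LINT t:{u..u+1}|lborel. (cmod (poly (dirichlet N a) (ee t)))\<^sup>2) = real N"
proof -
  have "(LINT t:{u..u+1}|lborel. (cmod (poly (dirichlet N a) (ee t)))\<^sup>2) =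
      (\<Sum>k\<le>N. if k < N then 1 else 0)"
    unfolding integral_cmod_poly_sq[OF degree_dirichlet]
    by (intro sum.cong) (auto simp: coeff_dirichlet)
  also have "\<dots> = real N"
    by (subst sum.mono_neutral_right[of "{..N}" "{..<N}"]) auto
  finally show ?thesis .
qed

text \<open>Riesz's observation behind Bernstein's inequality: on frequencies
  $0, \dots, N$, multiplication by $k$ is convolution with $|D_N|^2$ shifted by $N$, whose
  $L^1$ norm is $N$.\<close>

lemma riesz_interpolation:
  assumes "degree p \<le> N"
  shows "(\<Sum>k\<le>N. of_nat k * coeff p k * ee (real k * t)) =
    (LINT v:{0..0+1}|lborel. of_real ((cmod (poly (dirichlet N 0) (ee v)))\<^sup>2) * ee (- (real N * v)) * poly p (ee (t + v)))"
proof -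
  \<comment> \<open>The Fourier coefficient of |D_N|^2 at N - k is the number of pairs i, j < N with
    i - j = N - k, which is N - (N - k) = k. This is where the factor k on the left comes
    from.\<close>
  have count: "(\<Sum>i<N. \<Sum>j<N. if int i - int j - int N + int k = 0 then 1 else 0) = (of_nat k :: complex)"
    if "k \<le> N" for k
  proof -
    have "(\<Sum>i<N. \<Sum>j<N. if int i - int j - int N + int k = 0 then 1 else 0) =
        (\<Sum>i<N. if N - k \<le> i then 1 else (0::complex))"
    proof (intro sum.cong refl)
      fix i assume i: "i \<in> {..<N}"
      show "(\<Sum>j<N. if int i - int j - int N + int k = 0 then 1 else 0) = (if N - k \<le> i then 1 else (0::complex))"
      proof (cases "N - k \<le> i")
        case True
        hence "(int i - int j - int N + int k = 0) \<longleftrightarrow> j = i - (N - k)" for j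
          using that i by auto
        thus ?thesis using True i that by (auto simp: sum.delta)
      next
        case False
        hence "int i - int j - int N + int k \<noteq> 0" for j using that i by auto
        thus ?thesis using False by simp
      qed
    qed
    also have "\<dots> = (\<Sum>i\<in>{N-k..<N}. 1)"
      by (intro sum.mono_neutral_cong_right) auto
    also have "\<dots> = of_nat k" using that by simp
    finally show ?thesis .
  qed
  have *: "of_real ((cmod (poly (dirichlet N 0) (ee v)))\<^sup>2) * ee (- (real N * v)) * poly p (ee (t + v)) =
      (\<Sum>k\<le>N. \<Sum>i<N. \<Sum>j<N. (coeff p k * ee (real k * t)) * ee (of_int (int i - int j - int N + int k) * v))" for v
  proof -
    have "of_real ((cmod (poly (dirichlet N 0) (ee v)))\<^sup>2) * ee (- (real N * v)) * poly p (ee (t + v)) =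
      (\<Sum>k\<le>N. coeff p k * ee (real k * (t + v)) * ee (- (real N * v)) * (\<Sum>i<N. \<Sum>j<N. ee (real i * v) * cnj (ee (real j * v))))"
    proof -
      define D where "D = (\<Sum>i<N. \<Sum>j<N. ee (real i * v) * cnj (ee (real j * v)))"
      have "of_real ((cmod (poly (dirichlet N 0) (ee v)))\<^sup>2) = D"
        unfolding complex_norm_square poly_dirichlet cnj_sum sum_product D_def by simp
      thus ?thesis unfolding poly_ee[OF assms] D_def[symmetric]
        by (simp add: sum_distrib_left mult_ac)
    qed
    also have "\<dots> = (\<Sum>k\<le>N. \<Sum>i<N. \<Sum>j<N. (coeff p k * ee (real k * t)) * ee (of_int (int i - int j - int N + int k) * v))"
      unfolding sum_distrib_left
      by (intro sum.cong refl)
         (simp add: algebra_simps ee_add ee_diff ee_minus)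
    finally show ?thesis .
  qed
  show ?thesis
    unfolding *
    apply (subst set_integrable_sum(2) set_integral_mult_right,
        (intro set_integral_continuous_integrable continuous_intros)?)+
    apply (intro sum.cong refl)
    subgoal for k
      unfolding integral_ee sum_distrib_left[symmetric] using count[of k] by simp
    done
qed

lemma set_lborel_integral_norm_bound:
  fixes f :: "real \<Rightarrow> 'a :: {banach, second_countable_topology}"
  assumes "set_integrable lborel A f" "set_integrable lborel A g" "\<And>x. x \<in> A \<Longrightarrow> norm (f x) \<le> g x"
  shows "norm (LINT x:A|lborel. f x) \<le> (LINT x:A|lborel. g x)"
proof -
  have "norm (LINT x:A|lborel. f x) \<le> (LINT x:A|lborel. norm (f x))"
    by (rule set_integral_norm_bound) fact
  also have "\<dots> \<le> (LINT x:A|lborel. g x)"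
    using assms by (intro set_integral_mono set_integrable_norm) auto
  finally show ?thesis .
qed

text \<open>The kernel in \<open>riesz_interpolation\<close> is a nonnegative function of integral N
  times a unimodular factor, so the derivative of p(e(t)) is at most 2 pi N \<open>\<rho>\<close>.
  The mean value inequality turns this into a Lipschitz bound, which is the form needed for
  oscillations.\<close>

lemma bernstein_poly:
  assumes deg: "degree p \<le> N" and bd: "\<And>t. cmod (poly p (ee t)) \<le> \<rho>"
  shows "cmod (poly p (ee s) - poly p (ee t)) \<le> 2 * pi * real N * \<rho> * \<bar>s - t\<bar>"
proof -
  define d where "d t = (\<Sum>k\<le>N. coeff p k * ((2 * of_real pi * \<i> * of_real (real k)) * ee (real k * t)))" for t
  have der: "((\<lambda>t. poly p (ee t)) has_vector_derivative d t) (at t within UNIV)" for t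
    unfolding poly_ee[OF deg] d_def
    by (intro has_vector_derivative_sum has_vector_derivative_mult_right has_vector_derivative_ee)
  have "d t = 2 * of_real pi * \<i> * (\<Sum>k\<le>N. of_nat k * coeff p k * ee (real k * t))" for t
    by (simp add: d_def sum_distrib_left mult_ac)
  hence eq: "cmod (d t) = 2 * pi * cmod (\<Sum>k\<le>N. of_nat k * coeff p k * ee (real k * t))" for t
    by (simp add: norm_mult)
  have "cmod (\<Sum>k\<le>N. of_nat k * coeff p k * ee (real k * t)) \<le>
      (LINT v:{0..0+1}|lborel. (cmod (poly (dirichlet N 0) (ee v)))\<^sup>2 * \<rho>)" for t
    unfolding riesz_interpolation[OF deg]
    by (intro set_lborel_integral_norm_bound set_integral_continuous_integrable continuous_intros)
       (simp only: norm_mult norm_of_real norm_ee abs_power2 abs_norm_cancel mult_1_right,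
        intro mult_left_mono bd zero_le_power2)
  also have "(LINT v:{0..0+1}|lborel. (cmod (poly (dirichlet N 0) (ee v)))\<^sup>2 * \<rho>) = real N * \<rho>"
    by (simp only: set_integral_mult_left integral_dirichlet_sq)
  finally have d: "cmod (d t) \<le> 2 * pi * real N * \<rho>" for t
    by (simp add: eq mult_ac)
  have "onorm (\<lambda>x. x *\<^sub>R d t) \<le> 2 * pi * real N * \<rho>" for t
    using d[of t] by (intro onorm_le) (auto simp: mult.commute[of _ "\<bar>_\<bar>"] intro!: mult_left_mono)
  hence "norm (poly p (ee s) - poly p (ee t)) \<le> (2 * pi * real N * \<rho>) * norm (s - t)"
    using der unfolding has_vector_derivative_def by (intro differentiable_bound[where S=UNIV]) auto
  thus ?thesis by simp
qed

section \<open>Radial limits\<close>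

text \<open>Summation by parts expresses the error as (1 - r) times the series of remainders
  \<open>R (Suc n)\<close> r^n. Finitely many remainders are crushed by the factor 1 - r; the others
  are below e/2, and their geometric sum cancels that factor.\<close>

lemma abel_limit:
  fixes b :: "nat \<Rightarrow> complex"
  assumes "summable b"
  shows "((\<lambda>r. \<Sum>n. b n * of_real r ^ n) \<longlongrightarrow> (\<Sum>n. b n)) (at_left 1)"
proof -
  define S where "S = (\<Sum>n. b n)"
  define R where "R n = (\<Sum>k<n. b k) - S" for n
  have R: "R \<longlonglongrightarrow> 0"
    using summable_LIMSEQ[OF assms] unfolding R_def S_def[symmetric] by (simp add: LIM_zero)
  then obtain B where B: "\<And>n. norm (R n) \<le> B" and B0: "B > 0"
    using convergent_imp_Bseq[OF convergentI[OF R]] by (auto simp: Bseq_def)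
  have eq: "(\<Sum>n. b n * of_real r ^ n) - S = of_real (1 - r) * (\<Sum>n. R (Suc n) * of_real r ^ n)"
    and summ: "summable (\<lambda>n. norm (R (Suc n)) * r ^ n)" if r: "0 < r" "r < 1" for r
  proof -
    have R0: "R 0 = - S" by (simp add: R_def)
    show s: "summable (\<lambda>n. norm (R (Suc n)) * r ^ n)"
      using r B by (intro summable_comparison_test'[OF summable_mult[OF summable_geometric[of r], of B], of 0])
        (auto intro!: mult_right_mono)
    have s': "summable (\<lambda>n. R (Suc n) * of_real r ^ n)"
      using s r by (intro summable_norm_cancel[of "\<lambda>n. R (Suc n) * of_real r ^ n"]) (simp add: norm_mult norm_power)
    have "summable (\<lambda>n. R n * of_real r ^ n)"
      using s' by (subst summable_Suc_iff[symmetric]) (simp add: mult.left_commute summable_mult)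
    hence "(\<lambda>n. R n * of_real r ^ n) sums (\<Sum>n. R n * of_real r ^ n)" by (rule summable_sums)
    hence a: "(\<lambda>n. R (Suc n) * of_real r ^ Suc n) sums ((\<Sum>n. R n * of_real r ^ n) - R 0)"
      by (subst sums_Suc_iff[of "\<lambda>n. R n * of_real r ^ n"]) simp
    have c: "(\<lambda>n. of_real r * (R (Suc n) * of_real r ^ n)) sums (of_real r * (\<Sum>n. R (Suc n) * of_real r ^ n))"
      by (intro sums_mult summable_sums s')
    have e1: "(\<Sum>n. R n * of_real r ^ n) - R 0 = of_real r * (\<Sum>n. R (Suc n) * of_real r ^ n)"
      using sums_unique2[OF a] c by (simp add: mult_ac)
    have "(\<lambda>n. R (Suc n) * of_real r ^ n - R n * of_real r ^ n) sums
        ((\<Sum>n. R (Suc n) * of_real r ^ n) - (\<Sum>n. R n * of_real r ^ n))"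
      by (intro sums_diff summable_sums s' \<open>summable (\<lambda>n. R n * of_real r ^ n)\<close>)
    moreover have "R (Suc n) * of_real r ^ n - R n * of_real r ^ n = b n * of_real r ^ n" for n
      by (simp add: R_def algebra_simps)
    ultimately have "(\<Sum>n. b n * of_real r ^ n) = (\<Sum>n. R (Suc n) * of_real r ^ n) - (\<Sum>n. R n * of_real r ^ n)"
      by (simp add: sums_iff)
    thus "(\<Sum>n. b n * of_real r ^ n) - S = of_real (1 - r) * (\<Sum>n. R (Suc n) * of_real r ^ n)"
    proof -
      have e2: "of_real r * (\<Sum>n. R (Suc n) * of_real r ^ n) = (\<Sum>n. R n * of_real r ^ n) + S"
        using e1 R0 by simp
      show ?thesis
        unfolding of_real_diff left_diff_distrib e2 using \<open>(\<Sum>n. b n * of_real r ^ n) = _\<close> by simp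
    qed
  qed
  have "((\<lambda>r. (\<Sum>n. b n * of_real r ^ n) - S) \<longlongrightarrow> 0) (at_left 1)"
  proof (rule tendstoI)
    fix e :: real assume e: "e > 0"
    obtain N where N: "\<And>n. n \<ge> N \<Longrightarrow> norm (R n) < e / 2"
      using LIMSEQ_D[OF R, of "e / 2"] e by auto
    \<comment> \<open>This threshold makes (1 - r) (N + 1) B < e/2, which covers the first N
      remainders; N + 1 keeps the denominator positive when N = 0.\<close>
    have "eventually (\<lambda>r. r \<in> {max 0 (1 - e / (2 * B * (real N + 1)))<..<1}) (at_left (1::real))"
      using e B0 by (intro eventually_at_left_real) auto
    thus "\<forall>\<^sub>F r in at_left 1. dist ((\<Sum>n. b n * of_real r ^ n) - S) 0 < e"
    proof eventually_elim
      case (elim r)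
      have pos: "0 < 2 * B * (real N + 1)" using B0 by simp
      from elim have r: "0 < r" "r < 1" "1 - r < e / (2 * B * (real N + 1))" by auto
      from r(3) have r3: "(1 - r) * (2 * B * (real N + 1)) < e"
        unfolding pos_less_divide_eq[OF pos] .
      have "norm (R (Suc n)) * r ^ n \<le> (if n < N then B else 0) + e / 2 * r ^ n" for n
      proof (cases "n < N")
        case True
        have "norm (R (Suc n)) * r ^ n \<le> B * 1"
          using r B0 by (intro mult_mono B power_le_one) auto
        moreover have "0 \<le> e / 2 * r ^ n" using r e by simp
        ultimately show ?thesis using True by simp
      next
        case False
        have "norm (R (Suc n)) * r ^ n \<le> e / 2 * r ^ n"
          using r N[of "Suc n"] False by (intro mult_right_mono) auto
        thus ?thesis using False by simp
      qed
      moreover have fin: "(\<lambda>n. if n < N then B else 0) sums (N * B)"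
        using sums_If_finite[of "\<lambda>n. n < N" "\<lambda>_. B"] by (simp flip: lessThan_def)
      ultimately have "(\<Sum>n. norm (R (Suc n)) * r ^ n) \<le> (\<Sum>n. (if n < N then B else 0) + e / 2 * r ^ n)"
        using r summ[of r] fin by (intro suminf_le summable_add summable_mult summable_geometric) (auto simp: sums_iff)
      also have "\<dots> = N * B + e / 2 * (1 / (1 - r))"
        using sums_unique[OF sums_add[OF fin sums_mult[OF geometric_sums[of r], of "e / 2"]]] r by simp
      finally have 1: "(\<Sum>n. norm (R (Suc n)) * r ^ n) \<le> N * B + e / 2 * (1 / (1 - r))" .
      have "norm (\<Sum>n. R (Suc n) * of_real r ^ n) \<le> (\<Sum>n. norm (R (Suc n)) * r ^ n)"
        using summable_norm[of "\<lambda>n. R (Suc n) * of_real r ^ n"] summ[of r] r by (simp add: norm_mult norm_power)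
      hence "norm ((\<Sum>n. b n * of_real r ^ n) - S) \<le> (1 - r) * (N * B + e / 2 * (1 / (1 - r)))"
        using 1 r by (simp add: eq norm_mult del: of_real_diff)
      also have "\<dots> = (1 - r) * (N * B) + e / 2" using r by (simp add: field_simps)
      also have "(1 - r) * (N * B) \<le> (1 - r) * ((N + 1) * B)" using r B0 by (intro mult_left_mono) auto
      also have "\<dots> < e / 2" using r3 by (simp add: algebra_simps)
      finally show ?case by simp
    qed
  qed
  thus ?thesis unfolding S_def by (simp add: LIM_zero_iff)
qed

text \<open>Prepared for measurability: only the quantifiers over the naturals k and n become
  countable operations. The conditions indexed by the uncountably many r and s are non-strict, hence
  cut out closed sets whose intersection is closed again.\<close>

lemma convergent_at_left_iff_Cauchy:
  fixes f :: "real \<Rightarrow> 'a :: complete_space"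
  shows "(\<exists>L. (f \<longlongrightarrow> L) (at_left 1)) \<longleftrightarrow>
    (\<forall>k::nat. \<exists>n::nat. \<forall>r\<in>{1 - 1/(real n+1)<..<1}. \<forall>s\<in>{1 - 1/(real n+1)<..<1}. dist (f r) (f s) \<le> 1 / (real k+1))"
proof
  assume "\<exists>L. (f \<longlongrightarrow> L) (at_left 1)"
  then obtain L where L: "(f \<longlongrightarrow> L) (at_left 1)" by blast
  show "\<forall>k::nat. \<exists>n::nat. \<forall>r\<in>{1 - 1/(real n+1)<..<1}. \<forall>s\<in>{1 - 1/(real n+1)<..<1}. dist (f r) (f s) \<le> 1 / (real k+1)"
  proof
  fix k :: nat from L
  have "eventually (\<lambda>r. dist (f r) L < 1 / (real k+1) / 2) (at_left 1)"
    by (rule tendstoD) simp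
  then obtain b where b: "b < 1" "\<And>r. b < r \<Longrightarrow> r < 1 \<Longrightarrow> dist (f r) L < 1 / (real k+1) / 2"
    unfolding eventually_at_left_field by blast
  obtain n :: nat where n: "1 / (1 - b) < real n" using reals_Archimedean2 by blast
  have "b < 1 - 1 / (real n + 1)" using n b(1) by (simp add: field_simps)
  have "dist (f r) (f s) \<le> 1 / (real k+1)" if "r\<in>{1 - 1/(real n+1)<..<1}" "s\<in>{1 - 1/(real n+1)<..<1}" for r s
  proof -
    have "b < r" "r < 1" "b < s" "s < 1"
      using that \<open>b < 1 - 1 / (real n + 1)\<close> unfolding greaterThanLessThan_iff by linarith+
    thus ?thesis using dist_triangle2[of "f r" "f s" L] b(2)[of r] b(2)[of s] by linarith
  qed
  thus "\<exists>n::nat. \<forall>r\<in>{1 - 1/(real n+1)<..<1}. \<forall>s\<in>{1 - 1/(real n+1)<..<1}. dist (f r) (f s) \<le> 1 / (real k+1)"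
    by blast
  qed
next
  assume *: "\<forall>k::nat. \<exists>n::nat. \<forall>r\<in>{1 - 1/(real n+1)<..<1}. \<forall>s\<in>{1 - 1/(real n+1)<..<1}. dist (f r) (f s) \<le> 1 / (real k+1)"
  \<comment> \<open>The sample points use n + 2 because the n-th interval is open at 1 - 1/(n +
    1).\<close>
  define g where "g n = f (1 - 1 / (real n + 2))" for n
  have mem: "1 - 1 / (real m + 2) \<in> {1 - 1/(real n+1)<..<1}" if "m \<ge> n" for m n
    using that by (auto simp: field_simps)
  have "Cauchy g"
    unfolding metric_Cauchy_iff2
  proof
    fix j :: nat
    obtain n :: nat where n: "\<And>r s. r\<in>{1 - 1/(real n+1)<..<1} \<Longrightarrow> s\<in>{1 - 1/(real n+1)<..<1} \<Longrightarrow> dist (f r) (f s) \<le> 1 / (real (Suc j)+1)"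
      using * by blast
    have "dist (g m) (g m') < inverse (real (Suc j))" if "m \<ge> n" "m' \<ge> n" for m m'
    proof -
      have "dist (g m) (g m') \<le> 1 / (real (Suc j) + 1)"
        unfolding g_def by (intro n mem that)
      also have "\<dots> < inverse (real (Suc j))" by (simp add: field_simps)
      finally show ?thesis .
    qed
    thus "\<exists>M. \<forall>m\<ge>M. \<forall>n\<ge>M. dist (g m) (g n) < inverse (real (Suc j))" by blast
  qed
  then obtain L where L: "g \<longlonglongrightarrow> L" by (auto simp: Cauchy_convergent_iff convergent_def)
  have "(f \<longlongrightarrow> L) (at_left 1)"
  proof (rule tendstoI)
    fix e :: real assume "e > 0"
    then obtain k :: nat where k: "1 / (real k + 1) < e"
      using reals_Archimedean[of e] by (auto simp: inverse_eq_divide add_ac)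
    obtain n :: nat where n: "\<And>r s. r\<in>{1 - 1/(real n+1)<..<1} \<Longrightarrow> s\<in>{1 - 1/(real n+1)<..<1} \<Longrightarrow> dist (f r) (f s) \<le> 1 / (real k+1)"
      using * by blast
    have "eventually (\<lambda>r. r \<in> {1 - 1/(real n+1)<..<1}) (at_left (1::real))"
      by (intro eventually_at_left_real) auto
    thus "eventually (\<lambda>r. dist (f r) L < e) (at_left 1)"
    proof eventually_elim
      case (elim r)
      have "dist (f r) L \<le> 1 / (real k+1)"
        by (rule tendsto_upperbound[OF tendsto_dist[OF tendsto_const L]])
           (auto simp: eventually_sequentially g_def intro!: exI[of _ n] n elim mem)
      with k show ?case by simp
    qed
  qed
  thus "\<exists>L. (f \<longlongrightarrow> L) (at_left 1)" by blast
qed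

lemma boundary_eqI:
  assumes "((\<lambda>r. F (of_real r * x)) \<longlongrightarrow> L) (at_left 1)"
  shows "boundary F x = L"
  unfolding boundary_def by (rule tendsto_Lim[OF _ assms]) simp

lemma borel_measurable_boundary:
  assumes F: "continuous_on (ball 0 1) F"
  shows "(\<lambda>t. boundary F (ee t)) \<in> borel_measurable borel"
proof -
  let ?f = "\<lambda>t r. F (of_real r * ee t)"
  define E where "E = {t. \<exists>L. (?f t \<longlongrightarrow> L) (at_left 1)}"
  have cont: "continuous_on UNIV (\<lambda>t. ?f t r)" if "r \<in> {0..<1}" for r
    by (rule continuous_on_compose2[OF F])
       (use that in \<open>auto intro!: continuous_intros simp: norm_mult\<close>)
  define C where "C k n = (\<Inter>r\<in>{1 - 1/(real n+1)<..<1}. \<Inter>s\<in>{1 - 1/(real n+1)<..<1}. {t. dist (?f t r) (?f t s) \<le> 1 / (real k+1)})" for k n :: nat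
  have "closed (C k n)" for k n
    unfolding C_def
  proof (intro closed_INT ballI)
    fix r s assume "r \<in> {1 - 1 / (real n + 1)<..<1}" "s \<in> {1 - 1 / (real n + 1)<..<1}"
    moreover have "1 - 1 / (real n + 1) \<ge> 0" by (simp add: field_simps)
    ultimately have "r \<in> {0..<1}" "s \<in> {0..<1}"
      unfolding greaterThanLessThan_iff atLeastLessThan_iff by linarith+
    thus "closed {t. dist (?f t r) (?f t s) \<le> 1 / (real k + 1)}"
      by (intro closed_Collect_le continuous_intros cont)
  qed
  hence [measurable]: "C k n \<in> sets borel" for k n by (rule borel_closed)
  have "E = (\<Inter>k. \<Union>n. C k n)"
    unfolding E_def convergent_at_left_iff_Cauchy C_def by (auto simp: add_ac)
  also have "\<dots> \<in> sets borel" by measurable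
  finally have E [measurable]: "E \<in> sets borel" .
  have lim: "(\<lambda>n. ?f t (1 - 1 / (real n + 1))) \<longlonglongrightarrow> boundary F (ee t)" if "t \<in> E" for t
  proof -
    from that obtain L where L: "(?f t \<longlongrightarrow> L) (at_left 1)" by (auto simp: E_def)
    have "filterlim (\<lambda>n. 1 - 1 / (real n + 1)) (at_left 1) sequentially"
      by (intro filterlim_at_withinI always_eventually) (real_asymp, simp)
    from filterlim_compose[OF L this] boundary_eqI[OF L] show ?thesis by simp
  qed
  \<comment> \<open>\<open>Lim\<close> is a definite description. Where no radial limit exists its
    predicate is constantly false, so the value is one and the same constant for all such t, and
    \<open>boundary F\<close> is a sequential limit on a Borel set and constant off it.\<close>
  have eq: "boundary F (ee t) = (if t \<in> E then lim (\<lambda>n. ?f t (1 - 1 / (real n + 1))) else (THE L. False))" for t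
  proof (cases "t \<in> E")
    case True thus ?thesis using lim[of t] by (simp add: limI)
  next
    case False
    hence "(\<lambda>L. (?f t \<longlongrightarrow> L) (at_left 1)) = (\<lambda>_. False)" by (auto simp: E_def)
    thus ?thesis using False by (simp add: boundary_def Topological_Spaces.Lim_def)
  qed
  have [measurable]: "(\<lambda>t. ?f t (1 - 1 / (real n + 1))) \<in> borel_measurable borel" for n :: nat
    by (intro borel_measurable_continuous_onI cont) (auto simp: field_simps)
  show ?thesis unfolding eq by measurable
qed

section \<open>L^2 bounds for limits of power series on the circle\<close>

lemma summable_cmod_diff_sq:
  assumes "summable (\<lambda>k. (cmod (c k))\<^sup>2)"
  shows "summable (\<lambda>k. (cmod (c k - coeff p k))\<^sup>2)"
proof (rule summable_comparison_test_ev[OF _ assms])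
  show "\<forall>\<^sub>F k in sequentially. norm ((cmod (c k - coeff p k))\<^sup>2) \<le> (cmod (c k))\<^sup>2"
    using eventually_gt_at_top[of "degree p"] by eventually_elim (simp add: coeff_eq_0)
qed

text \<open>Parseval for the partial sums, followed by Fatou's lemma. Only the upper bound survives
  the limit, and approximation by polynomials asks for no more.\<close>

lemma nn_integral_radial_limit_le:
  fixes c :: "nat \<Rightarrow> complex"
  assumes c: "summable (\<lambda>k. (cmod (c k))\<^sup>2)"
    and g: "AE t in lborel. (\<lambda>k. c k * ee t ^ k) sums g t"
  shows "(\<integral>\<^sup>+t\<in>{u..u+1}. ennreal ((cmod (g t - poly p (ee t)))\<^sup>2) \<partial>lborel) \<le>
    ennreal (\<Sum>k. (cmod (c k - coeff p k))\<^sup>2)"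
proof -
  define q where "q N = (\<Sum>k<N. monom (c k) k) - p" for N
  have coeff_q: "coeff (q N) k = (if k < N then c k else 0) - coeff p k" for N k
    by (simp add: q_def coeff_sum if_distrib sum.delta cong: if_cong)
  have poly_q: "poly (q N) (ee t) = (\<Sum>k<N. c k * ee t ^ k) - poly p (ee t)" for N t
    by (simp add: q_def poly_sum poly_monom)
  have deg_q: "degree (q N) \<le> max N (degree p)" for N
    by (rule degree_le) (auto simp: coeff_q coeff_eq_0)
  have summ: "summable (\<lambda>k. (cmod (c k - coeff p k))\<^sup>2)"
    by (rule summable_cmod_diff_sq[OF c])
  \<comment> \<open>Once N exceeds the degree of p, the coefficients of q N are c - p below N and 0
    from N on, so they are dominated termwise.\<close>
  have bd: "(LINT t:{u..u+1}|lborel. (cmod (poly (q N) (ee t)))\<^sup>2) \<le> (\<Sum>k. (cmod (c k - coeff p k))\<^sup>2)"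
    if "N > degree p" for N
  proof -
    have "(LINT t:{u..u+1}|lborel. (cmod (poly (q N) (ee t)))\<^sup>2) = (\<Sum>k\<le>N. (cmod (coeff (q N) k))\<^sup>2)"
      using deg_q[of N] that by (intro integral_cmod_poly_sq) auto
    also have "\<dots> \<le> (\<Sum>k\<le>N. (cmod (c k - coeff p k))\<^sup>2)"
      using that by (intro sum_mono) (auto simp: coeff_q coeff_eq_0)
    also have "\<dots> \<le> (\<Sum>k. (cmod (c k - coeff p k))\<^sup>2)"
      by (intro sum_le_suminf summ) auto
    finally show ?thesis .
  qed
  have eq: "(\<integral>\<^sup>+t. ennreal ((cmod (poly (q N) (ee t)))\<^sup>2 * indicator {u..u+1} t) \<partial>lborel) =
      ennreal (LINT t:{u..u+1}|lborel. (cmod (poly (q N) (ee t)))\<^sup>2)" for N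
  proof -
    have "set_integrable lborel {u..u+1} (\<lambda>t. (cmod (poly (q N) (ee t)))\<^sup>2)"
      by (intro set_integral_continuous_integrable continuous_intros)
    thus ?thesis unfolding set_integrable_def set_lebesgue_integral_def
      by (subst nn_integral_eq_integral[symmetric]) (auto simp: mult.commute)
  qed
  have "(\<integral>\<^sup>+t\<in>{u..u+1}. ennreal ((cmod (g t - poly p (ee t)))\<^sup>2) \<partial>lborel) =
      (\<integral>\<^sup>+t. liminf (\<lambda>N. ennreal ((cmod (poly (q N) (ee t)))\<^sup>2 * indicator {u..u+1} t)) \<partial>lborel)"
  proof (rule nn_integral_cong_AE)
    show "AE t in lborel. ennreal ((cmod (g t - poly p (ee t)))\<^sup>2) * indicator {u..u+1} t =
        liminf (\<lambda>N. ennreal ((cmod (poly (q N) (ee t)))\<^sup>2 * indicator {u..u+1} t))"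
      using g
    proof eventually_elim
      case (elim t)
      have "(\<lambda>N. ennreal ((cmod (poly (q N) (ee t)))\<^sup>2 * indicator {u..u+1} t)) \<longlonglongrightarrow>
          ennreal ((cmod (g t - poly p (ee t)))\<^sup>2 * indicator {u..u+1} t)"
        using elim unfolding poly_q sums_def by (intro tendsto_intros)
      hence "liminf (\<lambda>N. ennreal ((cmod (poly (q N) (ee t)))\<^sup>2 * indicator {u..u+1} t)) =
          ennreal ((cmod (g t - poly p (ee t)))\<^sup>2 * indicator {u..u+1} t)"
        by (intro lim_imp_Liminf) auto
      thus ?case by (simp add: ennreal_mult' ennreal_indicator indicator_def)
    qed
  qed
  also have "\<dots> \<le> liminf (\<lambda>N. \<integral>\<^sup>+t. ennreal ((cmod (poly (q N) (ee t)))\<^sup>2 * indicator {u..u+1} t) \<partial>lborel)"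
  proof (rule nn_integral_liminf)
    have "(\<lambda>t. poly (q N) (ee t)) \<in> borel_measurable borel" for N
      by (intro borel_measurable_continuous_onI continuous_intros)
    thus "(\<lambda>t. ennreal ((cmod (poly (q N) (ee t)))\<^sup>2 * indicator {u..u+1} t)) \<in> borel_measurable lborel" for N
      by measurable
  qed
  also have "\<dots> \<le> ennreal (\<Sum>k. (cmod (c k - coeff p k))\<^sup>2)"
    unfolding eq
    by (intro Liminf_le eventually_mono[OF eventually_gt_at_top[of "degree p"]] ennreal_leI bd) auto
  finally show ?thesis .
qed

section \<open>Mean oscillation of sums of blocks\<close>

text \<open>The Fourier coefficient of the Fejer kernel of order 2^j - 1 at the frequencies k and
  -k; the maximum with 0 encodes the truncation of its sum.\<close>

definition tent :: "nat \<Rightarrow> nat \<Rightarrow> real" where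
  "tent j k = max 0 (1 - real k / 2 ^ j)"

lemma tent_bounds: "0 \<le> tent j k" "tent j k \<le> 1"
  by (auto simp: tent_def)

lemma tent_eq_0: assumes "2 ^ n \<le> k" "j \<le> n" shows "tent j k = 0"
proof -
  have "(2::nat) ^ j \<le> 2 ^ n" using assms(2) by (intro power_increasing) auto
  hence "real (2 ^ j) \<le> real k" using assms(1) by (simp only: of_nat_le_iff)
  thus ?thesis by (simp add: tent_def field_simps)
qed

lemma tent_eq: assumes "k \<le> 2 ^ m" "m \<le> j" shows "tent j k = 1 - real k / 2 ^ j"
proof -
  have "(2::nat) ^ m \<le> 2 ^ j" using assms(2) by (intro power_increasing) auto
  hence "real k \<le> real (2 ^ j)" using assms(1) by (simp only: of_nat_le_iff)
  thus ?thesis by (simp add: tent_def field_simps)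
qed

text \<open>The multiplier of T_n at frequencies k >= 0. For n >= 1 its graph is a trapezoid: 0 up
  to 2^(n-1), rising linearly to 1 at 2^n, constant up to 2^(n+1), falling linearly to 0 at
  2^(n+2).\<close>

definition trapezoid :: "nat \<Rightarrow> nat \<Rightarrow> real" where
  "trapezoid n k =
     (if n = 0 then (if k = 0 then 1 else if k = 1 then 1 / 2 else 0)
      else 2 * tent (n + 2) k - tent (n + 1) k + tent (n - 1) k - 2 * tent n k)"

text \<open>A primitive of the trapezoids: \<open>trapezoid n\<close> is \<open>ramp n\<close> minus
  \<open>ramp (n - 1)\<close> for n >= 1. It equals 2 up to 2^m and falls to 0 at 2^(m+2), so a long
  sum of blocks reproduces twice the function at all but low frequencies.\<close>

definition ramp :: "nat \<Rightarrow> nat \<Rightarrow> real" where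
  "ramp m k = 2 * tent (m + 2) k + tent (m + 1) k - tent m k"

lemma trapezoid_eq_0_high:
  assumes "2 ^ (n + 2) \<le> k" shows "trapezoid n k = 0"
proof (cases "n = 0")
  case True
  thus ?thesis using assms by (auto simp: trapezoid_def)
next
  case False
  thus ?thesis using tent_eq_0[OF assms] by (simp add: trapezoid_def)
qed

lemma trapezoid_eq_0_low:
  assumes "n \<ge> 1" "2 * k \<le> 2 ^ n"
  shows "trapezoid n k = 0"
proof -
  obtain m where m: "n = Suc m" using assms(1) by (cases n) auto
  have "k \<le> 2 ^ m" using assms(2) m by simp
  thus ?thesis by (simp add: trapezoid_def m tent_eq[of k m] field_simps)
qed

lemma sum_trapezoid: "m \<le> M \<Longrightarrow> (\<Sum>n\<in>{m<..M}. trapezoid n k) = ramp M k - ramp m k"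
proof (induction M rule: dec_induct)
  case (step M)
  have "{m<..Suc M} = insert (Suc M) {m<..M}" using step by auto
  thus ?case using step by (simp add: trapezoid_def ramp_def)
qed simp

lemma ramp_eq_0: "2 ^ (m + 2) \<le> k \<Longrightarrow> ramp m k = 0"
  using tent_eq_0[of "m + 2" k] by (simp add: ramp_def)

lemma ramp_eq_2: "k \<le> 2 ^ m \<Longrightarrow> ramp m k = 2"
  by (simp add: ramp_def tent_eq[of k m] field_simps)

text \<open>Crude bounds from 0 <= \<open>tent\<close> <= 1. They keep |1 - ramp/2| below 2, which
  is all that the L^2 estimate of the remainder asks for.\<close>

lemma ramp_bounds: "-1 \<le> ramp m k" "ramp m k \<le> 3"
  using tent_bounds[of m k] tent_bounds[of "m + 1" k] tent_bounds[of "m + 2" k]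
  by (auto simp: ramp_def)

text \<open>T_n * F for F with Taylor coefficients c. Negative frequencies are absent from F, so the
  convolution is an algebraic polynomial; stopping at 2^(n+2) loses nothing because the trapezoid
  vanishes from there on.\<close>

definition block :: "(nat \<Rightarrow> complex) \<Rightarrow> nat \<Rightarrow> complex poly" where
  "block c n = (\<Sum>k<2 ^ (n + 2). monom (of_real (trapezoid n k) * c k) k)"

lemma coeff_block: "coeff (block c n) k = of_real (trapezoid n k) * c k"
  using trapezoid_eq_0_high[of n k]
  by (auto simp: block_def coeff_sum sum.delta if_distrib cong: if_cong)

lemma degree_block: "degree (block c n) \<le> 2 ^ (n + 2)"
  by (rule degree_le) (simp add: coeff_block trapezoid_eq_0_high)

section \<open>Low blocks, high blocks and localisation to an arc\<close>

lemma ex_power2_between: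
  assumes "N \<ge> 1" shows "\<exists>L. N \<le> 2 ^ L \<and> 2 ^ L < 2 * (N::nat)"
proof -
  define L where "L = (LEAST L. N \<le> 2 ^ L)"
  have "N \<le> 2 ^ N" by (simp add: less_imp_le)
  hence L: "N \<le> 2 ^ L" unfolding L_def by (rule LeastI)
  moreover have "2 ^ L < 2 * N"
  proof (cases L)
    case (Suc l)
    hence "\<not> N \<le> 2 ^ l" unfolding L_def by (metis lessI not_less_Least)
    thus ?thesis using Suc by simp
  qed (use assms in auto)
  ultimately show ?thesis by blast
qed

text \<open>With N about 1/(3 \<open>\<delta>\<close>), the phases j (v - a) stay within a sixth of
  a turn, so every term has real part at least cos(pi/3) = 1/2. For arcs longer than 1/3, N = 1
  does. The two bounds on N \<open>\<delta>\<close> serve the two halves of the estimate: the upper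
  one Bernstein for low blocks, the lower one the L^2 bound for high blocks.\<close>

lemma dirichlet_lower_bound:
  assumes \<delta>: "0 < \<delta>" "\<delta> \<le> 1"
  obtains N :: nat where "N \<ge> 1" "real N * \<delta> \<le> 1" "1 \<le> 6 * real N * \<delta>"
    "\<And>a v. \<bar>v - a\<bar> \<le> \<delta> / 2 \<Longrightarrow> real N / 2 \<le> cmod (poly (dirichlet N a) (ee v))"
proof (cases "\<delta> \<le> 1 / 3")
  case True
  define x where "x = 1 / (3 * \<delta>)"
  define N where "N = nat \<lfloor>x\<rfloor>"
  have x: "1 \<le> x" using True \<delta> by (simp add: x_def field_simps)
  have N: "real N \<le> x" "x < real N + 1" "N \<ge> 1"
    unfolding N_def using x by (auto simp: le_nat_floor)
  have N1: "real N * \<delta> \<le> 1 / 3" using N(1) \<delta> by (simp add: x_def field_simps)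
  have "x \<le> 2 * real N" using N x by linarith
  hence N2: "1 \<le> 6 * real N * \<delta>" using \<delta> by (simp add: x_def field_simps)
  have "real N / 2 \<le> cmod (poly (dirichlet N a) (ee v))" if va: "\<bar>v - a\<bar> \<le> \<delta> / 2" for a v
  proof -
    have "1 / 2 \<le> Re (ee (real j * (v - a)))" if "j < N" for j
    proof -
      have "real j * \<bar>v - a\<bar> \<le> real N * (\<delta> / 2)"
        using that va by (intro mult_mono) auto
      hence "\<bar>real j * (v - a)\<bar> \<le> 1 / 6" using N1 by (simp add: abs_mult)
      hence *: "\<bar>2 * pi * (real j * (v - a))\<bar> \<le> pi / 3"
        by (simp add: abs_mult)
      have "cos (pi / 3) \<le> cos \<bar>2 * pi * (real j * (v - a))\<bar>"
        using * by (intro cos_monotone_0_pi_le) auto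
      thus ?thesis by (simp add: ee_eq_cis cos_60)
    qed
    hence "(\<Sum>j<N. 1 / 2) \<le> (\<Sum>j<N. Re (ee (real j * (v - a))))" by (intro sum_mono) auto
    also have "\<dots> = Re (poly (dirichlet N a) (ee v))" by (simp add: poly_dirichlet)
    also have "\<dots> \<le> cmod (poly (dirichlet N a) (ee v))" by (rule complex_Re_le_cmod)
    finally show ?thesis by simp
  qed
  with N N1 N2 show ?thesis by (intro that[of N]) auto
next
  case False
  with \<delta> show ?thesis by (intro that[of 1]) (auto simp: poly_dirichlet)
qed

lemma norm_sum_sq_le:
  fixes z :: "'i \<Rightarrow> 'a :: real_normed_vector"
  shows "(norm (\<Sum>i\<in>I. z i))\<^sup>2 \<le> real (card I) * (\<Sum>i\<in>I. (norm (z i))\<^sup>2)"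
proof -
  have "(norm (\<Sum>i\<in>I. z i))\<^sup>2 \<le> (\<Sum>i\<in>I. 1 * norm (z i))\<^sup>2"
    by (intro power_mono) (auto intro: norm_sum)
  also have "\<dots> \<le> (\<Sum>i\<in>I. 1\<^sup>2) * (\<Sum>i\<in>I. (norm (z i))\<^sup>2)"
    by (rule Cauchy_Schwarz_ineq_sum)
  finally show ?thesis by simp
qed

lemma set_integral_mono_set_continuous:
  fixes f g :: "real \<Rightarrow> real"
  assumes "continuous_on UNIV f" "continuous_on UNIV g" "a \<le> s" "t \<le> b"
    "\<And>x. x \<in> {s..t} \<Longrightarrow> f x \<le> g x" "\<And>x. 0 \<le> g x"
  shows "(LINT x:{s..t}|lborel. f x) \<le> (LINT x:{a..b}|lborel. g x)"
  using set_integral_continuous_integrable[OF assms(1), of s t]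
    set_integral_continuous_integrable[OF assms(2), of a b] assms(3-)
  unfolding set_lebesgue_integral_def set_integrable_def
  by (intro integral_mono) (auto simp: indicator_def)

text \<open>The frequencies of the product lie strictly between 2^(n-1) and 2^(n+2) + N <= 2^(n+3),
  and those for n' lie above 2^(n'-1). Hence the gap of four. The hypothesis L < n excludes n = 0,
  whose block reaches down to frequency 0.\<close>

lemma dirichlet_block_disjoint:
  assumes "N \<le> 2 ^ L" "L < n" "n + 4 \<le> n'"
  shows "coeff (dirichlet N a * block c n) k = 0 \<or> coeff (dirichlet N a * block c n') k = 0"
proof (rule ccontr)
  have *: "2 ^ n < 2 * k \<and> k < 2 ^ (n + 2) + N"
    if nz: "coeff (dirichlet N a * block c n) k \<noteq> 0" and n: "n \<ge> 1" for n
  proof -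
    from nz obtain i where i: "i \<le> k" "coeff (dirichlet N a) i * coeff (block c n) (k - i) \<noteq> 0"
      unfolding coeff_mult by (meson atMost_iff sum.neutral)
    hence "i < N" "trapezoid n (k - i) \<noteq> 0"
      by (auto simp: coeff_dirichlet coeff_block split: if_splits)
    from this(2) trapezoid_eq_0_low[OF n, of "k - i"] trapezoid_eq_0_high[of n "k - i"]
    have "2 ^ n < 2 * (k - i)" "k - i < 2 ^ (n + 2)" by (meson not_le)+
    thus ?thesis using i(1) \<open>i < N\<close> by linarith
  qed
  assume "\<not> ?thesis"
  hence "k < 2 ^ (n + 2) + N" "2 ^ n' < 2 * k"
    using *[of n] *[of n'] assms by auto
  moreover have "(2::nat) ^ (n + 4) \<le> 2 ^ n'" "(2::nat) ^ L \<le> 2 ^ (n + 2)"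
    using assms by (intro power_increasing; simp)+
  ultimately show False using assms(1) by (simp add: power_add)
qed

text \<open>Multiplying by the Dirichlet polynomial localises to an arc of length $1/N$, and moves
  frequencies by less than $N$ only, so that blocks at distance four remain orthogonal.\<close>

lemma integral_dirichlet_blocks:
  assumes S: "finite S" "\<And>n. n \<in> S \<Longrightarrow> L < n" and N: "N \<le> 2 ^ L"
    and \<rho>: "\<And>x. (\<Sum>n\<in>S. (cmod (poly (block c n) (ee x)))\<^sup>2) \<le> \<rho>\<^sup>2"
  shows "(LINT x:{u..u+1}|lborel. (cmod (poly (dirichlet N a) (ee x) * (\<Sum>n\<in>S. poly (block c n) (ee x))))\<^sup>2) \<le> 4 * \<rho>\<^sup>2 * real N"
proof -
  define q where "q n = dirichlet N a * block c n" for n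
  \<comment> \<open>Distinct indices in the same residue class modulo 4 differ by at least 4, so
    each class is orthogonal. Recombining the four classes by Cauchy-Schwarz costs the factor
    4.\<close>
  define T where "T r = {n \<in> S. n mod 4 = r}" for r :: nat
  have finT: "finite (T r)" for r using S by (simp add: T_def)
  have split: "(\<Sum>n\<in>S. f n) = (\<Sum>r<4. \<Sum>n\<in>T r. f n)" for f :: "nat \<Rightarrow> 'b :: comm_monoid_add"
    unfolding T_def by (rule sum.group[symmetric]) (use S in auto)
  have disj: "coeff (q i) k = 0 \<or> coeff (q j) k = 0" if ij: "i \<in> T r" "j \<in> T r" "i \<noteq> j" for i j k r
  proof -
    have main: "coeff (q i) k = 0 \<or> coeff (q j) k = 0" if "i \<in> T r" "j \<in> T r" "i < j" for i j
    proof -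
      have "i mod 4 = j mod 4" using that by (simp add: T_def)
      hence "4 dvd j - i" using that by (metis mod_eq_dvd_iff_nat less_imp_le)
      hence "i + 4 \<le> j" using that by (auto dest!: dvd_imp_le)
      thus ?thesis unfolding q_def using S(2)[of i] that N by (intro dirichlet_block_disjoint) (auto simp: T_def)
    qed
    show ?thesis using main[of i j] main[of j i] ij by (cases "i < j") auto
  qed
  have "(LINT x:{u..u+1}|lborel. (cmod (poly (dirichlet N a) (ee x) * (\<Sum>n\<in>S. poly (block c n) (ee x))))\<^sup>2)
      \<le> (LINT x:{u..u+1}|lborel. 4 * (\<Sum>r<4. (cmod (\<Sum>n\<in>T r. poly (q n) (ee x)))\<^sup>2))"
  proof (intro set_integral_mono set_integral_continuous_integrable continuous_intros)
    fix x
    have "poly (dirichlet N a) (ee x) * (\<Sum>n\<in>S. poly (block c n) (ee x)) = (\<Sum>r<4. \<Sum>n\<in>T r. poly (q n) (ee x))"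
      by (simp add: split q_def sum_distrib_left)
    thus "(cmod (poly (dirichlet N a) (ee x) * (\<Sum>n\<in>S. poly (block c n) (ee x))))\<^sup>2 \<le>
        4 * (\<Sum>r<4. (cmod (\<Sum>n\<in>T r. poly (q n) (ee x)))\<^sup>2)"
      using norm_sum_sq_le[of "\<lambda>r. \<Sum>n\<in>T r. poly (q n) (ee x)" "{..<4::nat}"] by simp
  qed
  also have "\<dots> = 4 * (\<Sum>r<4. LINT x:{u..u+1}|lborel. (cmod (\<Sum>n\<in>T r. poly (q n) (ee x)))\<^sup>2)"
    by (subst set_integral_mult_right, subst set_integrable_sum(2))
       (auto intro!: set_integral_continuous_integrable continuous_intros)
  also have "\<dots> = 4 * (\<Sum>r<4. \<Sum>n\<in>T r. LINT x:{u..u+1}|lborel. (cmod (poly (q n) (ee x)))\<^sup>2)"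
    by (subst integral_cmod_poly_sum_sq[OF finT]) (use disj in auto)
  also have "\<dots> = 4 * (\<Sum>n\<in>S. LINT x:{u..u+1}|lborel. (cmod (poly (q n) (ee x)))\<^sup>2)"
    by (simp only: split)
  also have "(\<Sum>n\<in>S. LINT x:{u..u+1}|lborel. (cmod (poly (q n) (ee x)))\<^sup>2) =
      (LINT x:{u..u+1}|lborel. (\<Sum>n\<in>S. (cmod (poly (q n) (ee x)))\<^sup>2))"
    by (intro set_integrable_sum(2)[symmetric] set_integral_continuous_integrable continuous_intros)
  \<comment> \<open>Orthogonality has moved the squares inside the sum, so the bound on the square
    function applies at each point, and only the mass N of |D|^2 is left.\<close>
  also have "\<dots> \<le> (LINT x:{u..u+1}|lborel. (cmod (poly (dirichlet N a) (ee x)))\<^sup>2 * \<rho>\<^sup>2)"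
    by (intro set_integral_mono set_integral_continuous_integrable continuous_intros)
       (auto simp: q_def norm_mult power_mult_distrib simp flip: sum_distrib_left
         intro!: mult_left_mono \<rho>)
  also have "\<dots> = real N * \<rho>\<^sup>2"
    by (simp only: set_integral_mult_left integral_dirichlet_sq)
  finally show ?thesis by (simp add: mult_ac)
qed

text \<open>The Bernstein bounds grow like 2^n, so their sum is governed by the top index, where 2^L
  < 2N. The constant is 8 (for 2 pi) times 4 (for the degree 2^(n+2)) times 4 (for the sum of 2^n,
  at most 4N).\<close>

lemma low_blocks_osc:
  assumes S: "finite S" "\<And>n. n \<in> S \<Longrightarrow> n \<le> L" and "N \<ge> 1" "2 ^ L < 2 * N" "\<rho> \<ge> 0"
    and \<rho>: "\<And>n x. n \<in> S \<Longrightarrow> cmod (poly (block c n) (ee x)) \<le> \<rho>"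
  shows "cmod ((\<Sum>n\<in>S. poly (block c n) (ee x)) - (\<Sum>n\<in>S. poly (block c n) (ee y))) \<le> 128 * real N * \<rho> * \<bar>x - y\<bar>"
proof -
  have "cmod ((\<Sum>n\<in>S. poly (block c n) (ee x)) - (\<Sum>n\<in>S. poly (block c n) (ee y))) \<le>
      (\<Sum>n\<in>S. cmod (poly (block c n) (ee x) - poly (block c n) (ee y)))"
    by (simp add: norm_sum flip: sum_subtractf)
  also have "\<dots> \<le> (\<Sum>n\<in>S. 2 * pi * real (2 ^ (n + 2)) * \<rho> * \<bar>x - y\<bar>)"
    by (intro sum_mono bernstein_poly degree_block \<rho>)
  also have "\<dots> \<le> (\<Sum>n\<in>S. 8 * real (2 ^ (n + 2)) * \<rho> * \<bar>x - y\<bar>)"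
    using pi_less_4 assms(5) by (intro sum_mono mult_right_mono) auto
  also have "\<dots> = (\<Sum>n\<in>S. 2 ^ n) * (32 * \<rho> * \<bar>x - y\<bar>)"
    by (simp add: sum_distrib_left sum_distrib_right mult_ac)
  also have "(\<Sum>n\<in>S. 2 ^ n) \<le> (\<Sum>n<Suc L. (2::real) ^ n)"
    using S by (intro sum_mono2) (auto simp: less_Suc_eq_le)
  also have "\<dots> \<le> 2 ^ Suc L"
    using geometric_sum[of "2::real" "Suc L"] by simp
  also have "(2::real) ^ Suc L \<le> 4 * real N"
  proof -
    have "2 ^ L \<le> 2 * N" using assms by simp
    hence "real (2 ^ L) \<le> real (2 * N)" by (simp only: of_nat_le_iff)
    thus ?thesis by simp
  qed
  finally show ?thesis using assms(5) by (simp add: mult_ac mult_right_mono)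
qed

text \<open>The blocks are cut at 2^L comparable to N, the inverse arc length. The low part is
  within 128 \<open>\<rho>\<close> of its value at s, which serves as the constant c0; the high part
  is small in L^2 on the arc. The total is 128 + 1/2 + 48 < 200 times \<open>\<rho>\<close>, with no
  dependence on the arc or on S.\<close>

lemma blocks_mean_osc:
  assumes st: "s < t" "t \<le> s + 1" and "\<rho> > 0" and S: "finite S"
    and \<rho>: "\<And>x. (\<Sum>n\<in>S. (cmod (poly (block c n) (ee x)))\<^sup>2) \<le> \<rho>\<^sup>2"
  shows "\<exists>c0. (LINT x:{s..t}|lborel. cmod ((\<Sum>n\<in>S. poly (block c n) (ee x)) - c0)) \<le> 200 * \<rho> * (t - s)"
proof -
  define \<delta> where "\<delta> = t - s"
  define a where "a = (s + t) / 2"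
  have \<delta>: "0 < \<delta>" "\<delta> \<le> 1" using st by (auto simp: \<delta>_def)
  obtain N where N: "N \<ge> 1" "real N * \<delta> \<le> 1" "1 \<le> 6 * real N * \<delta>"
    "\<And>a v. \<bar>v - a\<bar> \<le> \<delta> / 2 \<Longrightarrow> real N / 2 \<le> cmod (poly (dirichlet N a) (ee v))"
    using dirichlet_lower_bound[OF \<delta>] by blast
  obtain L where L: "N \<le> 2 ^ L" "2 ^ L < 2 * N" using ex_power2_between[OF N(1)] by blast
  define X where "X n x = poly (block c n) (ee x)" for n x
  have contX [continuous_intros]: "continuous_on A (X n)" for A n
    unfolding X_def by (intro continuous_intros)
  define lo where "lo x = (\<Sum>n\<in>{n\<in>S. n \<le> L}. X n x)" for x
  define hi where "hi x = (\<Sum>n\<in>{n\<in>S. L < n}. X n x)" for x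
  have cont [continuous_intros]: "continuous_on A lo" "continuous_on A hi" for A
    unfolding lo_def hi_def by (intro continuous_intros)+
  have split: "(\<Sum>n\<in>S. X n x) = lo x + hi x" for x
  proof -
    have "S = {n\<in>S. n \<le> L} \<union> {n\<in>S. L < n}" by auto
    thus ?thesis unfolding lo_def hi_def using S
      by (subst sum.union_disjoint[symmetric]) auto
  qed
  have X\<rho>: "cmod (X n x) \<le> \<rho>" if "n \<in> S" for n x
  proof -
    have "(cmod (X n x))\<^sup>2 \<le> \<rho>\<^sup>2"
      using member_le_sum[of n S "\<lambda>n. (cmod (X n x))\<^sup>2"] \<rho>[of x] that S unfolding X_def by auto
    thus ?thesis using \<open>\<rho> > 0\<close> by (simp add: power2_le_iff_abs_le)
  qed
  have lo: "cmod (lo x - lo s) \<le> 128 * \<rho>" if "x \<in> {s..t}" for x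
  proof -
    have "cmod (lo x - lo s) \<le> 128 * real N * \<rho> * \<bar>x - s\<bar>"
      unfolding lo_def X_def
      by (rule low_blocks_osc[of _ L]) (use S N L X\<rho> \<open>\<rho> > 0\<close> in \<open>auto simp: X_def\<close>)
    also have "\<dots> \<le> 128 * real N * \<rho> * \<delta>"
      using that \<open>\<rho> > 0\<close> by (intro mult_left_mono) (auto simp: \<delta>_def)
    also have "\<dots> = 128 * \<rho> * (real N * \<delta>)" by simp
    also have "\<dots> \<le> 128 * \<rho> * 1" using N \<open>\<rho> > 0\<close> by (intro mult_left_mono) auto
    finally show ?thesis by simp
  qed
  \<comment> \<open>On the arc |D| >= N/2, so the weight 4 |D|^2 / N^2 is at least 1 there.
    Inserting it allows the integral to be extended to a whole period, where orthogonality is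
    available.\<close>
  have "(LINT x:{s..t}|lborel. (cmod (hi x))\<^sup>2) \<le>
      (LINT x:{s..s+1}|lborel. (4 / (real N)\<^sup>2) * (cmod (poly (dirichlet N a) (ee x) * hi x))\<^sup>2)"
  proof (intro set_integral_mono_set_continuous continuous_intros)
    fix x assume x: "x \<in> {s..t}"
    hence "\<bar>x - a\<bar> \<le> \<delta> / 2" by (simp add: a_def \<delta>_def abs_if field_simps)
    hence "(real N / 2)\<^sup>2 \<le> (cmod (poly (dirichlet N a) (ee x)))\<^sup>2"
      by (intro power_mono N(4)) auto
    hence "1 \<le> (4 / (real N)\<^sup>2) * (cmod (poly (dirichlet N a) (ee x)))\<^sup>2"
      using N(1) by (simp add: field_simps power2_eq_square)
    from mult_right_mono[OF this, of "(cmod (hi x))\<^sup>2"]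
    show "(cmod (hi x))\<^sup>2 \<le> (4 / (real N)\<^sup>2) * (cmod (poly (dirichlet N a) (ee x) * hi x))\<^sup>2"
      by (simp add: norm_mult power_mult_distrib mult_ac)
  qed (use st in auto)
  also have "\<dots> \<le> (4 / (real N)\<^sup>2) * (4 * \<rho>\<^sup>2 * real N)"
    unfolding set_integral_mult_right hi_def X_def
  proof (intro mult_left_mono integral_dirichlet_blocks)
    show "(\<Sum>n\<in>{n \<in> S. L < n}. (cmod (poly (block c n) (ee x)))\<^sup>2) \<le> \<rho>\<^sup>2" for x
      by (rule order.trans[OF sum_mono2 \<rho>[of x]]) (use S in auto)
  qed (use S L in auto)
  also have "\<dots> = 16 * \<rho>\<^sup>2 * (1 / real N)" using N(1) by (simp add: field_simps power2_eq_square)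
  also have "\<dots> \<le> 16 * \<rho>\<^sup>2 * (6 * \<delta>)"
    using N by (intro mult_left_mono) (auto simp: field_simps)
  finally have hi: "(LINT x:{s..t}|lborel. (cmod (hi x))\<^sup>2) \<le> 96 * \<rho>\<^sup>2 * \<delta>" by simp
  have "(LINT x:{s..t}|lborel. cmod ((\<Sum>n\<in>S. X n x) - lo s)) \<le>
      (LINT x:{s..t}|lborel. (1 / (2 * \<rho>)) * (cmod (hi x))\<^sup>2 + (129 * \<rho>))"
  proof (intro set_integral_mono set_integral_continuous_integrable continuous_intros)
    fix x assume x: "x \<in> {s..t}"
    have "cmod ((\<Sum>n\<in>S. X n x) - lo s) \<le> cmod (lo x - lo s) + cmod (hi x)"
      unfolding split by (metis add_diff_eq add.commute diff_add_eq norm_triangle_ineq)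
    \<comment> \<open>The arithmetic-geometric inequality with weight \<open>\<rho>\<close> stands
      in for Cauchy-Schwarz: it bounds the L^1 norm by the L^2 integral just obtained, linearly in
      the arc length.\<close>
    also have "2 * \<rho> * cmod (hi x) \<le> (cmod (hi x))\<^sup>2 + \<rho>\<^sup>2"
      using sum_squares_bound[of \<rho> "cmod (hi x)"] by simp
    hence "cmod (hi x) \<le> (1 / (2 * \<rho>)) * (cmod (hi x))\<^sup>2 + \<rho> / 2"
      using \<open>\<rho> > 0\<close> by (simp add: field_simps power2_eq_square)
    finally show "cmod ((\<Sum>n\<in>S. X n x) - lo s) \<le> (1 / (2 * \<rho>)) * (cmod (hi x))\<^sup>2 + (129 * \<rho>)"
      using lo[OF x] \<open>\<rho> > 0\<close> by simp
  qed
  also have "\<dots> = (1 / (2 * \<rho>)) * (LINT x:{s..t}|lborel. (cmod (hi x))\<^sup>2) + 129 * \<rho> * \<delta>"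
  proof -
    have "(LINT x:{s..t}|lborel. (1 / (2 * \<rho>)) * (cmod (hi x))\<^sup>2 + (129 * \<rho>)) =
      (LINT x:{s..t}|lborel. (1 / (2 * \<rho>)) * (cmod (hi x))\<^sup>2) + (LINT x:{s..t}|lborel. 129 * \<rho>)"
      by (intro set_integral_add set_integral_continuous_integrable continuous_intros)
    thus ?thesis using st by (simp add: set_integral_const \<delta>_def)
  qed
  also have "\<dots> \<le> (1 / (2 * \<rho>)) * (96 * \<rho>\<^sup>2 * \<delta>) + 129 * \<rho> * \<delta>"
    using hi \<open>\<rho> > 0\<close> by (intro add_right_mono mult_left_mono) auto
  also have "\<dots> \<le> 200 * \<rho> * \<delta>"
    using \<open>\<rho> > 0\<close> \<delta> by (simp add: power2_eq_square)
  finally show ?thesis unfolding X_def \<delta>_def by blast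
qed

section \<open>From square functions to mean oscillation\<close>

text \<open>The interface between the random and the deterministic half. Convergence almost
  everywhere on the circle is a condition of its own, supplied by independence of the coefficients
  rather than derived from square summability. Continuity in the disk is what makes the radial
  limits measurable.\<close>

definition radial_l2 :: "(complex \<Rightarrow> complex) \<Rightarrow> (nat \<Rightarrow> complex) \<Rightarrow> bool" where
  "radial_l2 F c \<longleftrightarrow> continuous_on (ball 0 1) F \<and> (\<forall>z\<in>ball 0 1. (\<lambda>k. c k * z ^ k) sums F z) \<and>
     summable (\<lambda>k. (cmod (c k))\<^sup>2) \<and> (AE t in lborel. summable (\<lambda>k. c k * ee t ^ k))"

lemma radial_l2_boundary:
  assumes "radial_l2 F c"
  shows "AE t in lborel. (\<lambda>k. c k * ee t ^ k) sums boundary F (ee t)"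
proof -
  have "AE t in lborel. summable (\<lambda>k. c k * ee t ^ k)" using assms by (simp add: radial_l2_def)
  thus ?thesis
  proof eventually_elim
    case (elim t)
    have "((\<lambda>r. \<Sum>n. (c n * ee t ^ n) * of_real r ^ n) \<longlongrightarrow> (\<Sum>n. c n * ee t ^ n)) (at_left 1)"
      by (rule abel_limit[OF elim])
    moreover have "\<forall>\<^sub>F r in at_left 1. (\<Sum>n. (c n * ee t ^ n) * of_real r ^ n) = F (of_real r * ee t)"
    proof -
      have "\<forall>\<^sub>F r in at_left 1. r \<in> {0<..<1::real}" by (intro eventually_at_left_real) auto
      thus ?thesis
      proof eventually_elim
        case (elim r)
        hence "of_real r * ee t \<in> ball 0 1" by (simp add: norm_mult)
        hence "(\<lambda>k. c k * (of_real r * ee t) ^ k) sums F (of_real r * ee t)"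
          using assms by (simp add: radial_l2_def)
        thus ?case by (simp add: sums_iff power_mult_distrib mult_ac)
      qed
    qed
    ultimately have "((\<lambda>r. F (of_real r * ee t)) \<longlongrightarrow> (\<Sum>n. c n * ee t ^ n)) (at_left 1)"
      by (rule Lim_transform_eventually)
    hence "boundary F (ee t) = (\<Sum>n. c n * ee t ^ n)" by (rule boundary_eqI)
    with elim show ?case by (simp add: summable_sums)
  qed
qed

lemma poly_sums: "(\<lambda>k. coeff p k * z ^ k) sums poly p (z :: complex)"
  unfolding poly_altdef by (rule sums_finite) (auto simp: coeff_eq_0)

lemma radial_l2_diff_poly:
  assumes "radial_l2 F c"
  shows "radial_l2 (\<lambda>z. F z - poly p z) (\<lambda>k. c k - coeff p k)"
  unfolding radial_l2_def
proof (intro conjI)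
  show "continuous_on (ball 0 1) (\<lambda>z. F z - poly p z)"
    using assms by (auto simp: radial_l2_def intro!: continuous_intros)
  show "\<forall>z\<in>ball 0 1. (\<lambda>k. (c k - coeff p k) * z ^ k) sums (F z - poly p z)"
    using assms by (auto simp: radial_l2_def left_diff_distrib intro!: sums_diff poly_sums)
  show "summable (\<lambda>k. (cmod (c k - coeff p k))\<^sup>2)"
    using assms by (auto simp: radial_l2_def intro!: summable_cmod_diff_sq)
  have "AE t in lborel. summable (\<lambda>k. c k * ee t ^ k)" using assms by (simp add: radial_l2_def)
  thus "AE t in lborel. summable (\<lambda>k. (c k - coeff p k) * ee t ^ k)"
    by eventually_elim (auto simp: left_diff_distrib intro!: summable_diff sums_summable[OF poly_sums])
qed

lemma radial_l2_measurable: "radial_l2 F c \<Longrightarrow> (\<lambda>t. boundary F (ee t)) \<in> borel_measurable borel"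
  by (intro borel_measurable_boundary) (simp add: radial_l2_def)

lemma borel_measurable_poly_ee [measurable]: "(\<lambda>t. poly p (ee t)) \<in> borel_measurable borel"
  by (intro borel_measurable_continuous_onI continuous_intros)

lemma radial_l2_integrable_sq:
  assumes "radial_l2 F c"
  shows "set_integrable lborel {u..u+1} (\<lambda>t. (cmod (boundary F (ee t) - poly p (ee t)))\<^sup>2)"
    and "(LINT t:{u..u+1}|lborel. (cmod (boundary F (ee t) - poly p (ee t)))\<^sup>2) \<le> (\<Sum>k. (cmod (c k - coeff p k))\<^sup>2)"
proof -
  note [measurable] = radial_l2_measurable[OF assms]
  let ?f = "\<lambda>t. (cmod (boundary F (ee t) - poly p (ee t)))\<^sup>2 * indicator {u..u+1} t"
  have le: "(\<integral>\<^sup>+t\<in>{u..u+1}. ennreal ((cmod (boundary F (ee t) - poly p (ee t)))\<^sup>2) \<partial>lborel) \<le>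
      ennreal (\<Sum>k. (cmod (c k - coeff p k))\<^sup>2)"
    using assms by (intro nn_integral_radial_limit_le radial_l2_boundary) (simp_all add: radial_l2_def)
  have eq: "(\<integral>\<^sup>+t\<in>{u..u+1}. ennreal ((cmod (boundary F (ee t) - poly p (ee t)))\<^sup>2) \<partial>lborel) = (\<integral>\<^sup>+t. ennreal (?f t) \<partial>lborel)"
    by (intro nn_integral_cong) (auto simp: indicator_def)
  have nonneg: "0 \<le> (\<Sum>k. (cmod (c k - coeff p k))\<^sup>2)"
    using assms by (intro suminf_nonneg summable_cmod_diff_sq) (auto simp: radial_l2_def)
  have int: "integrable lborel ?f"
  proof (rule integrableI_nonneg)
    show "?f \<in> borel_measurable lborel" by measurable
    show "(\<integral>\<^sup>+t. ennreal (?f t) \<partial>lborel) < \<infinity>"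
      using le unfolding eq by (rule order.strict_trans1) simp
  qed auto
  thus "set_integrable lborel {u..u+1} (\<lambda>t. (cmod (boundary F (ee t) - poly p (ee t)))\<^sup>2)"
    by (simp add: set_integrable_def mult.commute)
  have "ennreal (integral\<^sup>L lborel ?f) \<le> ennreal (\<Sum>k. (cmod (c k - coeff p k))\<^sup>2)"
    using le unfolding eq by (subst (asm) nn_integral_eq_integral[OF int]) auto
  hence "integral\<^sup>L lborel ?f \<le> (\<Sum>k. (cmod (c k - coeff p k))\<^sup>2)"
    using nonneg by (simp add: ennreal_le_iff)
  thus "(LINT t:{u..u+1}|lborel. (cmod (boundary F (ee t) - poly p (ee t)))\<^sup>2) \<le> (\<Sum>k. (cmod (c k - coeff p k))\<^sup>2)"
    by (simp add: set_lebesgue_integral_def mult.commute)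
qed

lemma radial_l2_integrable:
  assumes F: "radial_l2 F c" and "t \<le> u + 1"
  shows "set_integrable lborel {u..t} (\<lambda>x. boundary F (ee x) - poly p (ee x))"
proof -
  note [measurable] = radial_l2_measurable[OF F]
  have "set_integrable lborel {u..u+1} (\<lambda>x. 1 + (cmod (boundary F (ee x) - poly p (ee x)))\<^sup>2)"
    by (intro set_integral_add radial_l2_integrable_sq[OF F] set_integral_continuous_integrable continuous_intros)
  hence "set_integrable lborel {u..u+1} (\<lambda>x. boundary F (ee x) - poly p (ee x))"
  proof (rule set_integrable_bound)
    show "set_borel_measurable lborel {u..u+1} (\<lambda>x. boundary F (ee x) - poly p (ee x))"
      unfolding set_borel_measurable_def by measurable
    have "z \<le> 1 + z\<^sup>2" for z :: real using sum_squares_bound[of 1 z] by (simp add: power2_eq_square) (smt (verit) mult_nonneg_nonneg zero_le_square)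
    thus "AE x in lborel. x \<in> {u..u+1} \<longrightarrow>
        norm (boundary F (ee x) - poly p (ee x)) \<le> norm (1 + (cmod (boundary F (ee x) - poly p (ee x)))\<^sup>2)"
      by (intro AE_I2 impI) (simp add: add_nonneg_nonneg)
  qed
  thus ?thesis by (rule set_integrable_subset) (use assms in auto)
qed

text \<open>L^1 against L^2 on a period, again by the arithmetic-geometric inequality, whose two
  halves contribute \<open>\<eta>\<close>/2 each. The bound does not shrink with the arc, so it is
  applied to a fixed arc with \<open>\<eta>\<close> tending to 0.\<close>

lemma radial_l2_L1_le:
  assumes F: "radial_l2 F c" and t: "t \<le> u + 1" and "\<eta> > 0" "(\<Sum>k. (cmod (c k - coeff p k))\<^sup>2) \<le> \<eta>\<^sup>2"
  shows "(LINT x:{u..t}|lborel. cmod (boundary F (ee x) - poly p (ee x))) \<le> \<eta>"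
proof -
  let ?f = "\<lambda>x. boundary F (ee x) - poly p (ee x)"
  have i1: "set_integrable lborel {u..u+1} (\<lambda>x. cmod (?f x))"
    by (intro set_integrable_norm radial_l2_integrable[OF F]) simp
  have "(LINT x:{u..t}|lborel. cmod (?f x)) \<le> (LINT x:{u..u+1}|lborel. cmod (?f x))"
    using i1 set_integrable_norm[OF radial_l2_integrable[OF F t]] t
    unfolding set_lebesgue_integral_def set_integrable_def
    by (intro integral_mono) (auto simp: indicator_def)
  also have "\<dots> \<le> (LINT x:{u..u+1}|lborel. (1 / (2 * \<eta>)) * (cmod (?f x))\<^sup>2 + \<eta> / 2)"
  proof (intro set_integral_mono i1 set_integral_add set_integrable_mult_right radial_l2_integrable_sq[OF F]
      set_integral_continuous_integrable continuous_intros impI)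
    fix x
    have "2 * \<eta> * cmod (?f x) \<le> (cmod (?f x))\<^sup>2 + \<eta>\<^sup>2"
      using sum_squares_bound[of \<eta> "cmod (?f x)"] by simp
    thus "cmod (?f x) \<le> (1 / (2 * \<eta>)) * (cmod (?f x))\<^sup>2 + \<eta> / 2"
      using \<open>\<eta> > 0\<close> by (simp add: field_simps power2_eq_square)
  qed
  also have "\<dots> = (1 / (2 * \<eta>)) * (LINT x:{u..u+1}|lborel. (cmod (?f x))\<^sup>2) + \<eta> / 2"
  proof -
    have "(LINT x:{u..u+1}|lborel. (1 / (2 * \<eta>)) * (cmod (?f x))\<^sup>2 + \<eta> / 2) =
        (LINT x:{u..u+1}|lborel. (1 / (2 * \<eta>)) * (cmod (?f x))\<^sup>2) + (LINT x:{u..u+1}|lborel. \<eta> / 2)"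
      by (intro set_integral_add set_integrable_mult_right radial_l2_integrable_sq[OF F]
          set_integral_continuous_integrable continuous_intros impI)
    thus ?thesis by (simp add: set_integral_const)
  qed
  also have "\<dots> \<le> (1 / (2 * \<eta>)) * \<eta>\<^sup>2 + \<eta> / 2"
    using radial_l2_integrable_sq(2)[OF F, of u p] assms(3,4) by (intro add_right_mono mult_left_mono) auto
  also have "\<dots> = \<eta>" using \<open>\<eta> > 0\<close> by (simp add: power2_eq_square)
  finally show ?thesis .
qed

lemma cmod_sq_tail_small:
  assumes "summable (\<lambda>k. (cmod (c k))\<^sup>2)" "\<eta> > 0"
  obtains N where "\<And>n. n \<ge> N \<Longrightarrow> (\<Sum>k. (cmod (c (k + n)))\<^sup>2) < \<eta>"
proof -
  from suminf_exist_split[OF assms(2,1)] obtain N where N: "\<And>n. n \<ge> N \<Longrightarrow> norm (\<Sum>i. (cmod (c (i + n)))\<^sup>2) < \<eta>"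
    by blast
  show ?thesis by (rule that[of N]) (use N in \<open>auto simp: abs_less_iff\<close>)
qed

section \<open>Fourier coefficients of boundary values and convolution with the Sledd
  kernels\<close>

lemma fourier_coeff_poly:
  "fourier_coeff (poly p) k = (if k \<ge> 0 then coeff p (nat k) else 0)"
proof (cases "k \<ge> 0")
  case True
  have "fourier_coeff (poly p) k =
      (LINT t:{0..0+1}|lborel. poly p (ee t) * cnj (poly (monom 1 (nat k)) (ee t)))"
    unfolding fourier_coeff_def using True by (simp add: poly_monom ee_power flip: ee_minus)
  also have "\<dots> = (\<Sum>j\<le>max (degree p) (nat k). coeff p j * cnj (coeff (monom 1 (nat k)) j))"
    by (intro integral_poly_mult_cnj) (auto simp: degree_monom_eq)
  also have "\<dots> = (\<Sum>j\<le>max (degree p) (nat k). if j = nat k then coeff p j else 0)"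
    by (intro sum.cong) auto
  also have "\<dots> = coeff p (nat k)" by simp
  finally show ?thesis using True by simp
next
  case False
  \<comment> \<open>A negative frequency is shifted to 0 by multiplying with z^n; the product has no
    constant term.\<close>
  define n where "n = nat (- k)"
  have n: "n > 0" "of_int k = - real n" using False by (auto simp: n_def)
  have "fourier_coeff (poly p) k = (LINT t:{0..0+1}|lborel. poly (monom 1 n * p) (ee t) * cnj (poly 1 (ee t)))"
    unfolding fourier_coeff_def by (simp add: poly_monom ee_power n mult_ac)
  also have "\<dots> = (\<Sum>j\<le>degree (monom 1 n * p). coeff (monom 1 n * p) j * cnj (coeff 1 j))"
    by (intro integral_poly_mult_cnj) auto
  also have "\<dots> = 0" using n(1) by (intro sum.neutral) (auto simp: coeff_monom_mult)
  finally show ?thesis using False by simp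
qed

text \<open>Fourier coefficients are continuous in L^1, and Taylor sections approximate the radial
  limit in L^1, so the known coefficients of polynomials pass to the limit.\<close>

lemma fourier_coeff_boundary:
  assumes F: "radial_l2 F c"
  shows "fourier_coeff (boundary F) k = (if k \<ge> 0 then c (nat k) else 0)"
proof -
  note [measurable] = radial_l2_measurable[OF F]
  let ?R = "if k \<ge> 0 then c (nat k) else 0"
  have "cmod (fourier_coeff (boundary F) k - ?R) \<le> \<eta>" if "\<eta> > 0" for \<eta>
  proof -
    have summ: "summable (\<lambda>k. (cmod (c k))\<^sup>2)" using F by (simp add: radial_l2_def)
    obtain N0 where N0: "\<And>n. n \<ge> N0 \<Longrightarrow> (\<Sum>k. (cmod (c (k + n)))\<^sup>2) < \<eta>\<^sup>2"
      using cmod_sq_tail_small[OF summ, of "\<eta>\<^sup>2"] \<open>\<eta> > 0\<close> by auto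
    \<comment> \<open>The section must already contain the frequency k, so that its k-th coefficient
      equals c k exactly.\<close>
    define N where "N = max N0 (Suc (nat k))"
    define p where "p = (\<Sum>j<N. monom (c j) j)"
    have p: "coeff p j = (if j < N then c j else 0)" for j
      by (simp add: p_def coeff_sum if_distrib sum.delta cong: if_cong)
    have "(\<Sum>j. (cmod (c j - coeff p j))\<^sup>2) = (\<Sum>j. (cmod (c (j + N) - coeff p (j + N)))\<^sup>2)"
      by (subst suminf_split_initial_segment[OF summable_cmod_diff_sq[OF summ, of p], where k=N])
         (simp add: p)
    also have "\<dots> \<le> \<eta>\<^sup>2" using N0[of N] by (simp add: p N_def)
    finally have L1: "(LINT x:{0..1}|lborel. cmod (boundary F (ee x) - poly p (ee x))) \<le> \<eta>"
      by (intro radial_l2_L1_le[OF F _ \<open>\<eta> > 0\<close>]) auto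
    have i: "set_integrable lborel {0..1} (\<lambda>x. poly q (ee x))" for q
      by (intro set_integral_continuous_integrable continuous_intros)
    have i1: "set_integrable lborel {0..1} (\<lambda>x. boundary F (ee x) - poly q (ee x))" for q
      by (intro radial_l2_integrable[OF F]) simp
    have twist: "set_integrable lborel {0..1} (\<lambda>x. f x * ee (- of_int k * x))"
      if "set_integrable lborel {0..1} f" for f :: "real \<Rightarrow> complex"
    proof (rule set_integrable_bound[OF that])
      have [measurable]: "(\<lambda>x. indicator {0..1} x *\<^sub>R f x) \<in> borel_measurable lborel"
        using that unfolding set_integrable_def by (rule borel_measurable_integrable)
      have "(\<lambda>x. (indicator {0..1} x *\<^sub>R f x) * ee (- of_int k * x)) \<in> borel_measurable lborel"
        by measurable
      thus "set_borel_measurable lborel {0..1} (\<lambda>x. f x * ee (- of_int k * x))"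
        unfolding set_borel_measurable_def by simp
    qed (simp add: norm_mult)
    have "?R = fourier_coeff (poly p) k"
      unfolding fourier_coeff_poly by (auto simp: p N_def)
    moreover have "fourier_coeff (boundary F) k - fourier_coeff (poly p) k =
        (LINT x:{0..1}|lborel. boundary F (ee x) * ee (- of_int k * x) - poly p (ee x) * ee (- of_int k * x))"
      unfolding fourier_coeff_def
      by (rule set_integral_diff(2)[symmetric]) (use twist[OF i1[of 0]] twist[OF i[of p]] in \<open>simp_all only: poly_0 diff_zero\<close>)
    ultimately have "fourier_coeff (boundary F) k - ?R =
        (LINT x:{0..1}|lborel. boundary F (ee x) * ee (- of_int k * x) - poly p (ee x) * ee (- of_int k * x))"
      by simp
    also have "cmod \<dots> \<le> (LINT x:{0..1}|lborel. cmod (boundary F (ee x) - poly p (ee x)))"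
    proof (intro set_lborel_integral_norm_bound set_integrable_norm i1)
      show "set_integrable lborel {0..1} (\<lambda>x. boundary F (ee x) * ee (- of_int k * x) - poly p (ee x) * ee (- of_int k * x))"
        using twist[OF i1[of p]] by (simp only: left_diff_distrib)
      show "cmod (boundary F (ee x) * ee (- of_int k * x) - poly p (ee x) * ee (- of_int k * x)) \<le>
          cmod (boundary F (ee x) - poly p (ee x))" for x
        by (simp add: norm_mult flip: left_diff_distrib)
    qed
    finally show ?thesis using L1 by simp
  qed
  hence "cmod (fourier_coeff (boundary F) k - ?R) \<le> 0" by (rule field_le_epsilon) simp
  thus ?thesis by simp
qed

lemma fourier_coeff_trig_sum:
  assumes "finite A"
  shows "fourier_coeff (\<lambda>z. \<Sum>j\<in>A. w j * z powi j) k = (if k \<in> A then w k else 0)"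
proof -
  have "fourier_coeff (\<lambda>z. \<Sum>j\<in>A. w j * z powi j) k =
      (LINT t:{0..0+1}|lborel. \<Sum>j\<in>A. w j * ee (of_int (j - k) * t))"
  proof -
    have "(\<Sum>j\<in>A. w j * ee t powi j) * ee (- of_int k * t) = (\<Sum>j\<in>A. w j * ee (of_int (j - k) * t))" for t
      unfolding sum_distrib_right
      by (intro sum.cong refl) (simp add: ee_powi left_diff_distrib ee_diff ee_minus)
    thus ?thesis by (simp add: fourier_coeff_def)
  qed
  also have "\<dots> = (\<Sum>j\<in>A. w j * (LINT t:{0..0+1}|lborel. ee (of_int (j - k) * t)))"
    by (subst set_integrable_sum(2) set_integral_mult_right,
        (intro set_integral_continuous_integrable continuous_intros)?)+ simp
  also have "\<dots> = (\<Sum>j\<in>A. if j = k then w j else 0)"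
    unfolding integral_ee by (intro sum.cong) auto
  finally show ?thesis using assms by simp
qed

lemma fourier_coeff_sledd_kernel:
  "fourier_coeff (sledd_kernel n) (int k) = of_real (trapezoid n k)"
proof (cases "n = 0")
  case True
  define w where "w j = (if j = (0::int) then 1 else (1 / 2 :: complex))" for j
  have "sledd_kernel n = (\<lambda>z. \<Sum>j\<in>{-1,0,1}. w j * z powi j)"
    using True by (auto simp: sledd_kernel_def w_def fun_eq_iff power_int_minus)
  hence "fourier_coeff (sledd_kernel n) (int k) = (if int k \<in> {-1,0,1} then w (int k) else 0)"
    by (simp only: fourier_coeff_trig_sum[OF finite.intros(2)[OF finite.intros(2)[OF finite.intros(2)[OF finite.intros(1)]]]])
  thus ?thesis using True by (auto simp: trapezoid_def w_def)
next
  case False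
  \<comment> \<open>Extending the Fejer weights by 0 puts all four kernels on the common index set
    A, so that they combine coefficientwise. The orders 2^j - 1 make the denominators N + 1 equal to
    2^j, which turns the weights into tents.\<close>
  define W where "W N j = (if \<bar>j\<bar> \<le> int N then of_real (1 - \<bar>of_int j\<bar> / (real N + 1)) else (0::complex))" for N :: nat and j :: int
  define Q :: nat where "Q = 2 ^ (n + 2)"
  define A where "A = {- int Q..int Q}"
  have fejer': "fejer K z = (\<Sum>i\<in>A. W K i * z powi i)" if "K \<le> Q" for K z
  proof -
    have "(\<Sum>i\<in>A. W K i * z powi i) = (\<Sum>i\<in>{- int K..int K}. W K i * z powi i)"
      unfolding A_def using that by (intro sum.mono_neutral_right) (auto simp: W_def)
    thus ?thesis unfolding fejer_def by (auto simp: W_def intro!: sum.cong)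
  qed
  have fejer: "fejer (2 ^ j - 1) z = (\<Sum>i\<in>A. W (2 ^ j - 1) i * z powi i)" if "j \<le> n + 2" for j z
  proof -
    have "(2::nat) ^ j \<le> 2 ^ (n + 2)" using that by (intro power_increasing) auto
    thus ?thesis by (intro fejer') (simp add: Q_def)
  qed
  have W: "W (2 ^ j - 1) (int k) = of_real (tent j k)" for j
  proof -
    have "real (2 ^ j - 1) + 1 = 2 ^ j" by (simp add: of_nat_diff)
    moreover have "int k \<le> int (2 ^ j - 1) \<longleftrightarrow> \<not> 2 ^ j \<le> k"
    proof -
      have "(0::nat) < 2 ^ j" by simp
      thus ?thesis by linarith
    qed
    ultimately show ?thesis
      using tent_eq_0[of j k j] tent_eq[of k j j] by (auto simp: W_def)
  qed
  define w where "w i = 2 * W (2 ^ (n + 2) - 1) i - W (2 ^ (n + 1) - 1) i + W (2 ^ (n - 1) - 1) i - 2 * W (2 ^ n - 1) i" for i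
  have "sledd_kernel n z = (\<Sum>i\<in>A. w i * z powi i)" for z
  proof -
    have "sledd_kernel n z = 2 * (\<Sum>i\<in>A. W (2 ^ (n + 2) - 1) i * z powi i) - (\<Sum>i\<in>A. W (2 ^ (n + 1) - 1) i * z powi i)
        + (\<Sum>i\<in>A. W (2 ^ (n - 1) - 1) i * z powi i) - 2 * (\<Sum>i\<in>A. W (2 ^ n - 1) i * z powi i)"
      unfolding sledd_kernel_def if_not_P[OF False] by (subst (1 2 3 4) fejer) auto
    also have "\<dots> = (\<Sum>i\<in>A. w i * z powi i)"
      unfolding w_def left_diff_distrib distrib_right sum_subtractf sum.distrib sum_distrib_left mult.assoc ..
    finally show ?thesis .
  qed
  hence "sledd_kernel n = (\<lambda>z. \<Sum>i\<in>A. w i * z powi i)" by blast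
  hence "fourier_coeff (sledd_kernel n) (int k) = (if int k \<in> A then w (int k) else 0)"
    by (simp add: fourier_coeff_trig_sum A_def)
  also have "w (int k) = of_real (trapezoid n k)"
    unfolding w_def W trapezoid_def if_not_P[OF False] by simp
  finally show ?thesis
    using trapezoid_eq_0_high[of n k] unfolding A_def Q_def[symmetric]
    by (cases "Q \<le> k") auto
qed

text \<open>The sum over all integers collapses from both sides: negative frequencies vanish because
  of F, and those beyond 2^(n+2) because of the kernel.\<close>

lemma circle_conv_sledd_kernel:
  assumes F: "radial_l2 F c"
  shows "circle_conv (sledd_kernel n) (boundary F) (ee x) = poly (block c n) (ee x)"
proof -
  have "circle_conv (sledd_kernel n) (boundary F) (ee x) =
      (\<Sum>\<^sub>\<infinity>k\<in>int ` {..2 ^ (n + 2)}. fourier_coeff (sledd_kernel n) k * fourier_coeff (boundary F) k * ee x powi k)"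
    unfolding circle_conv_def
  proof (rule infsum_cong_neutral)
    fix k :: int assume k: "k \<in> UNIV - int ` {..2 ^ (n + 2)}"
    show "fourier_coeff (sledd_kernel n) k * fourier_coeff (boundary F) k * ee x powi k = 0"
    proof (cases "k \<ge> 0")
      case True
      then obtain m where m: "k = int m" using nonneg_int_cases by blast
      hence "2 ^ (n + 2) \<le> m" using k by (auto simp: not_le)
      thus ?thesis unfolding m fourier_coeff_sledd_kernel by (simp add: trapezoid_eq_0_high)
    qed (simp add: fourier_coeff_boundary[OF F])
  qed auto
  also have "\<dots> = (\<Sum>k\<le>2 ^ (n + 2). of_real (trapezoid n k) * c k * ee x ^ k)"
    by (simp add: infsum_finite sum.reindex fourier_coeff_sledd_kernel fourier_coeff_boundary[OF F])
  also have "\<dots> = poly (block c n) (ee x)"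
    by (simp add: poly_ee[OF degree_block] coeff_block ee_power)
  finally show ?thesis .
qed

lemma SL_blocks_bounded:
  assumes F: "radial_l2 F c" and SL: "F \<in> SL"
  obtains B where "\<And>M x. (\<Sum>n<M. (cmod (poly (block c n) (ee x)))\<^sup>2) \<le> B"
proof -
  define B where "B = sledd_norm_sq F"
  have "B < \<infinity>" using SL by (simp add: SL_def B_def)
  have "ennreal (\<Sum>n<M. (cmod (poly (block c n) (ee x)))\<^sup>2) \<le> B" for M x
  proof -
    have "ennreal (\<Sum>n<M. (cmod (poly (block c n) (ee x)))\<^sup>2) =
        (\<Sum>n<M. ennreal ((cmod (circle_conv (sledd_kernel n) (boundary F) (ee x)))\<^sup>2))"
      by (simp add: circle_conv_sledd_kernel[OF F] sum_ennreal)
    also have "\<dots> \<le> (\<Sum>n. ennreal ((cmod (circle_conv (sledd_kernel n) (boundary F) (ee x)))\<^sup>2))"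
      by (intro sum_le_suminf) auto
    also have "\<dots> \<le> B" unfolding B_def sledd_norm_sq_def by (rule SUP_upper) simp
    finally show ?thesis .
  qed
  hence "(\<Sum>n<M. (cmod (poly (block c n) (ee x)))\<^sup>2) \<le> enn2real B" for M x
    using \<open>B < \<infinity>\<close> by (cases B) (auto simp: ennreal_le_iff sum_nonneg)
  thus ?thesis by (rule that)
qed

text \<open>The arc mean is itself within the mean deviation from c0, so comparing with any constant
  instead of the mean costs a factor 2.\<close>

lemma mean_osc_le:
  assumes st: "s < t" and int: "set_integrable lborel {s..t} (\<lambda>x. boundary F (ee x))"
  shows "mean_osc F s t \<le> 2 * (LINT x:{s..t}|lborel. cmod (boundary F (ee x) - c0)) / (t - s)"
proof -
  define I where "I = (LINT x:{s..t}|lborel. cmod (boundary F (ee x) - c0))"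
  have const: "set_integrable lborel {s..t} (\<lambda>x. z)" for z :: "'z :: {banach, second_countable_topology}"
    by (intro set_integral_continuous_integrable continuous_intros)
  have d: "set_integrable lborel {s..t} (\<lambda>x. boundary F (ee x) - z)" for z
    by (intro set_integral_diff int const)
  have "arc_mean F s t - c0 = (LINT x:{s..t}|lborel. boundary F (ee x) - c0) / of_real (t - s)"
  proof -
    have "(LINT x:{s..t}|lborel. boundary F (ee x) - c0) =
        (LINT x:{s..t}|lborel. boundary F (ee x)) - (LINT x:{s..t}|lborel. c0)"
      by (intro set_integral_diff int const)
    also have "(LINT x:{s..t}|lborel. c0) = of_real (t - s) * c0"
      using st by (simp add: set_integral_const scaleR_conv_of_real)
    finally show ?thesis using st by (simp add: arc_mean_def field_simps)
  qed
  hence "cmod (arc_mean F s t - c0) = cmod (LINT x:{s..t}|lborel. boundary F (ee x) - c0) / (t - s)"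
    using st by (simp add: norm_divide del: of_real_diff)
  also have "\<dots> \<le> I / (t - s)"
    unfolding I_def using st by (intro divide_right_mono set_integral_norm_bound d) auto
  finally have m: "cmod (c0 - arc_mean F s t) \<le> I / (t - s)" by (simp add: norm_minus_commute)
  have "(LINT x:{s..t}|lborel. cmod (boundary F (ee x) - arc_mean F s t)) \<le>
      (LINT x:{s..t}|lborel. cmod (boundary F (ee x) - c0) + I / (t - s))"
  proof (intro set_integral_mono set_integral_add set_integrable_norm d const)
    fix x
    have "cmod (boundary F (ee x) - arc_mean F s t) \<le> cmod (boundary F (ee x) - c0) + cmod (c0 - arc_mean F s t)"
      by (metis diff_add_cancel add_diff_eq norm_triangle_ineq)
    thus "cmod (boundary F (ee x) - arc_mean F s t) \<le> cmod (boundary F (ee x) - c0) + I / (t - s)"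
      using m by simp
  qed
  also have "\<dots> = I + (LINT x:{s..t}|lborel. I / (t - s))"
    unfolding I_def by (intro set_integral_add set_integrable_norm d const)
  also have "(LINT x:{s..t}|lborel. I / (t - s)) = I"
    using st by (simp add: set_integral_const)
  finally show ?thesis
    unfolding mean_osc_def I_def[symmetric] using st by (intro divide_right_mono) auto
qed

text \<open>The approximating polynomial. Half the ramp is 1 at low frequencies, and the function
  minus this polynomial is half the sum of the blocks beyond m.\<close>

definition ramp_poly :: "(nat \<Rightarrow> complex) \<Rightarrow> nat \<Rightarrow> complex poly" where
  "ramp_poly c m = (\<Sum>k<2 ^ (m + 2). monom (of_real (ramp m k / 2) * c k) k)"

lemma coeff_ramp_poly: "coeff (ramp_poly c m) k = of_real (ramp m k / 2) * c k"
  using ramp_eq_0[of m k]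
  by (auto simp: ramp_poly_def coeff_sum sum.delta if_distrib cong: if_cong)

text \<open>A long sum Y of blocks completes \<open>ramp_poly c m\<close> to p, whose multiplier is
  half of \<open>ramp M\<close> and hence 1 up to 2^M. What p misses lives beyond 2^M and is small
  in L^2, while Y/2 has oscillation at most half of the 200 \<open>\<rho>\<close> for blocks. The
  error \<open>\<eta>\<close> is not scaled by the arc length.\<close>

lemma boundary_minus_ramp_osc:
  assumes F: "radial_l2 F c" and st: "s < t" "t \<le> s + 1" and "\<rho> > 0" "\<eta> > 0"
    and \<rho>: "\<And>M x. (\<Sum>n\<in>{m<..M}. (cmod (poly (block c n) (ee x)))\<^sup>2) \<le> \<rho>\<^sup>2"
  shows "\<exists>c0. (LINT x:{s..t}|lborel. cmod (boundary F (ee x) - poly (ramp_poly c m) (ee x) - c0)) \<le> 100 * \<rho> * (t - s) + \<eta>"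
proof -
  have summ: "summable (\<lambda>k. (cmod (c k))\<^sup>2)" using F by (simp add: radial_l2_def)
  \<comment> \<open>The quarter absorbs the multiplier 1 - ramp/2 of the remainder, bounded by 2 and
    therefore by 4 after squaring.\<close>
  obtain N where N: "\<And>n. n \<ge> N \<Longrightarrow> (\<Sum>k. (cmod (c (k + n)))\<^sup>2) < \<eta>\<^sup>2 / 4"
    using cmod_sq_tail_small[OF summ, of "\<eta>\<^sup>2 / 4"] \<open>\<eta> > 0\<close> by auto
  define M where "M = max m N"
  define Y where "Y = (\<Sum>n\<in>{m<..M}. block c n)"
  define p where "p = ramp_poly c m + smult (1 / 2) Y"
  have p: "coeff p k = of_real (ramp M k / 2) * c k" for k
  proof -
    have "coeff Y k = of_real (\<Sum>n\<in>{m<..M}. trapezoid n k) * c k"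
      by (simp add: Y_def coeff_sum coeff_block sum_distrib_right)
    also have "\<dots> = of_real (ramp M k - ramp m k) * c k"
      by (subst sum_trapezoid) (auto simp: M_def)
    finally show ?thesis by (simp add: p_def coeff_ramp_poly field_simps)
  qed
  have pn: "(cmod (c k - coeff p k))\<^sup>2 \<le> 4 * (cmod (c k))\<^sup>2" for k
  proof -
    have "c k - coeff p k = of_real (1 - ramp M k / 2) * c k" by (simp add: p algebra_simps)
    hence "cmod (c k - coeff p k) = \<bar>1 - ramp M k / 2\<bar> * cmod (c k)"
      by (simp only: norm_mult norm_of_real)
    also have "\<dots> \<le> 2 * cmod (c k)"
      using ramp_bounds[of M k] by (intro mult_right_mono) auto
    finally have "(cmod (c k - coeff p k))\<^sup>2 \<le> (2 * cmod (c k))\<^sup>2" by (intro power_mono) auto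
    thus ?thesis by (simp add: power_mult_distrib)
  qed
  have M: "N \<le> 2 ^ M"
  proof -
    have "N \<le> M" by (simp add: M_def)
    also have "M \<le> 2 ^ M" by (simp add: less_imp_le)
    finally show ?thesis .
  qed
  have "(\<Sum>k. (cmod (c k - coeff p k))\<^sup>2) = (\<Sum>k. (cmod (c (k + 2 ^ M) - coeff p (k + 2 ^ M)))\<^sup>2)"
    by (subst suminf_split_initial_segment[OF summable_cmod_diff_sq[OF summ, of p], where k="2 ^ M"])
       (simp add: p ramp_eq_2)
  also have "\<dots> \<le> (\<Sum>k. 4 * (cmod (c (k + 2 ^ M)))\<^sup>2)"
    by (intro suminf_le pn summable_mult summable_ignore_initial_segment[OF summ]
        summable_ignore_initial_segment[OF summable_cmod_diff_sq[OF summ]])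
  also have "\<dots> = 4 * (\<Sum>k. (cmod (c (k + 2 ^ M)))\<^sup>2)"
    by (intro suminf_mult summable_ignore_initial_segment[OF summ])
  also have "\<dots> \<le> \<eta>\<^sup>2" using N[OF M] by simp
  finally have L1: "(LINT x:{s..t}|lborel. cmod (boundary F (ee x) - poly p (ee x))) \<le> \<eta>"
    by (intro radial_l2_L1_le[OF F st(2) \<open>\<eta> > 0\<close>])
  obtain c0 where c0: "(LINT x:{s..t}|lborel. cmod ((\<Sum>n\<in>{m<..M}. poly (block c n) (ee x)) - c0)) \<le> 200 * \<rho> * (t - s)"
    using blocks_mean_osc[OF st \<open>\<rho> > 0\<close> _ \<rho>, of M] by auto
  have Y: "poly Y (ee x) = (\<Sum>n\<in>{m<..M}. poly (block c n) (ee x))" for x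
    by (simp add: Y_def poly_sum)
  have i: "set_integrable lborel {s..t} (\<lambda>x. cmod (boundary F (ee x) - poly q (ee x)))" for q
    by (intro set_integrable_norm radial_l2_integrable[OF F st(2)])
  have iY: "set_integrable lborel {s..t} (\<lambda>x. (1 / 2) * cmod (poly Y (ee x) - c0))"
    by (intro set_integral_continuous_integrable continuous_intros)
  have i': "set_integrable lborel {s..t} (\<lambda>x. cmod (boundary F (ee x) - poly (ramp_poly c m) (ee x) - c0 / 2))"
    using i[of "ramp_poly c m + [:c0 / 2:]"] by (simp add: diff_diff_eq)
  have "(LINT x:{s..t}|lborel. cmod (boundary F (ee x) - poly (ramp_poly c m) (ee x) - c0 / 2)) \<le>
      (LINT x:{s..t}|lborel. cmod (boundary F (ee x) - poly p (ee x)) + (1 / 2) * cmod (poly Y (ee x) - c0))"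
  proof (intro set_integral_mono i' set_integral_add i iY)
    fix x
    have "boundary F (ee x) - poly (ramp_poly c m) (ee x) - c0 / 2 =
        (boundary F (ee x) - poly p (ee x)) + (1 / 2) * (poly Y (ee x) - c0)"
      by (simp add: p_def field_simps)
    also have "cmod \<dots> \<le> cmod (boundary F (ee x) - poly p (ee x)) + cmod ((1 / 2) * (poly Y (ee x) - c0))"
      by (rule norm_triangle_ineq)
    finally show "cmod (boundary F (ee x) - poly (ramp_poly c m) (ee x) - c0 / 2) \<le>
        cmod (boundary F (ee x) - poly p (ee x)) + (1 / 2) * cmod (poly Y (ee x) - c0)"
      by (simp only: norm_mult) (simp add: norm_divide)
  qed
  also have "\<dots> = (LINT x:{s..t}|lborel. cmod (boundary F (ee x) - poly p (ee x))) +
      (LINT x:{s..t}|lborel. (1 / 2) * cmod (poly Y (ee x) - c0))"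
    by (intro set_integral_add i iY)
  also have "\<dots> \<le> \<eta> + 100 * \<rho> * (t - s)"
    using L1 c0 by (simp add: Y)
  finally show ?thesis by (auto simp: add.commute)
qed

lemma mean_osc_le_of_osc:
  assumes F: "radial_l2 F c" and st: "s < t" "t \<le> s + 1"
    and osc: "\<And>\<eta>. \<eta> > 0 \<Longrightarrow> \<exists>c0. (LINT x:{s..t}|lborel. cmod (boundary F (ee x) - c0)) \<le> K * (t - s) + \<eta>"
  shows "mean_osc F s t \<le> 2 * K"
proof (rule field_le_epsilon)
  fix e :: real assume "e > 0"
  \<comment> \<open>The arc is fixed at this point, so the error may be taken proportional to its
    length; after division by t - s and the factor 2 it contributes e.\<close>
  define \<eta> where "\<eta> = e * (t - s) / 2"
  have "\<eta> > 0" using \<open>e > 0\<close> st by (simp add: \<eta>_def)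
  from osc[OF this] obtain c0 where c0: "(LINT x:{s..t}|lborel. cmod (boundary F (ee x) - c0)) \<le> K * (t - s) + \<eta>"
    by blast
  have "mean_osc F s t \<le> 2 * (LINT x:{s..t}|lborel. cmod (boundary F (ee x) - c0)) / (t - s)"
    using radial_l2_integrable[OF F st(2), of 0] by (intro mean_osc_le st(1)) simp
  also have "\<dots> \<le> 2 * (K * (t - s) + \<eta>) / (t - s)"
    using c0 st by (intro divide_right_mono) auto
  also have "\<dots> = 2 * K + e" using st by (simp add: \<eta>_def field_simps)
  finally show "mean_osc F s t \<le> 2 * K + e" .
qed

lemma bmo_norm_le:
  assumes "\<And>s t. s < t \<Longrightarrow> t \<le> s + 1 \<Longrightarrow> mean_osc F s t \<le> K"
  shows "bmo_norm F \<le> ennreal K"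
  unfolding bmo_norm_def by (rule SUP_least) (use assms in \<open>auto intro!: ennreal_leI\<close>)

text \<open>The approximants are \<open>ramp_poly c m\<close>, with error governed by the tail
  beyond m. Membership in \<open>BMOA\<close> is the same estimate with tail bound 1, plus the fact
  that the subtracted polynomial is bounded on the circle.\<close>

lemma VMOA_of_blocks:
  assumes F: "radial_l2 F c" and H: "F \<in> hardy1"
    and small: "\<And>\<rho>. \<rho> > 0 \<Longrightarrow> \<exists>m. \<forall>M x. (\<Sum>n\<in>{m<..M}. (cmod (poly (block c n) (ee x)))\<^sup>2) \<le> \<rho>\<^sup>2"
  shows "F \<in> VMOA"
  unfolding VMOA_def
proof (intro CollectI conjI allI impI)
  obtain m where m: "\<And>M x. (\<Sum>n\<in>{m<..M}. (cmod (poly (block c n) (ee x)))\<^sup>2) \<le> 1\<^sup>2"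
    using small[of 1] by auto
  define P where "P = ramp_poly c m"
  have "bounded ((\<lambda>x. poly P x) ` cball 0 1)"
    by (intro compact_imp_bounded compact_continuous_image continuous_intros) auto
  then obtain B where B: "\<And>x. x \<in> cball 0 1 \<Longrightarrow> cmod (poly P x) \<le> B" unfolding bounded_iff by blast
  have "mean_osc F s t \<le> 2 * (100 + B)" if st: "s < t" "t \<le> s + 1" for s t
  proof (rule mean_osc_le_of_osc[OF F st])
    fix \<eta> :: real assume "\<eta> > 0"
    from boundary_minus_ramp_osc[OF F st _ this m]
    obtain c0 where c0: "(LINT x:{s..t}|lborel. cmod (boundary F (ee x) - poly P (ee x) - c0)) \<le> 100 * 1 * (t - s) + \<eta>"
      by (auto simp: P_def)
    have i: "set_integrable lborel {s..t} (\<lambda>x. cmod (boundary F (ee x) - poly q (ee x) - c0))" for q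
      using set_integrable_norm[OF radial_l2_integrable[OF F st(2), of "q + [:c0:]"]] by (simp add: diff_diff_eq)
    have const: "set_integrable lborel {s..t} (\<lambda>x. B)"
      by (intro set_integral_continuous_integrable continuous_intros)
    have "(LINT x:{s..t}|lborel. cmod (boundary F (ee x) - c0)) \<le>
        (LINT x:{s..t}|lborel. cmod (boundary F (ee x) - poly P (ee x) - c0) + B)"
    proof (intro set_integral_mono set_integral_add i const)
      show "set_integrable lborel {s..t} (\<lambda>x. cmod (boundary F (ee x) - c0))" using i[of 0] by simp
      fix x
      have "cmod (boundary F (ee x) - c0) \<le> cmod (boundary F (ee x) - poly P (ee x) - c0) + cmod (poly P (ee x))"
        using norm_triangle_ineq[of "boundary F (ee x) - poly P (ee x) - c0" "poly P (ee x)"] by simp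
      thus "cmod (boundary F (ee x) - c0) \<le> cmod (boundary F (ee x) - poly P (ee x) - c0) + B"
        using B[of "ee x"] by simp
    qed
    also have "\<dots> = (LINT x:{s..t}|lborel. cmod (boundary F (ee x) - poly P (ee x) - c0)) + (LINT x:{s..t}|lborel. B)"
      by (intro set_integral_add i const)
    also have "(LINT x:{s..t}|lborel. B) = B * (t - s)"
      using st by (simp add: set_integral_const)
    finally show "\<exists>c0. (LINT x:{s..t}|lborel. cmod (boundary F (ee x) - c0)) \<le> (100 + B) * (t - s) + \<eta>"
      using c0 by (intro exI[of _ c0]) (simp add: algebra_simps)
  qed
  hence "bmo_norm F \<le> ennreal (2 * (100 + B))" by (rule bmo_norm_le)
  also have "\<dots> < \<infinity>" by simp
  finally show "F \<in> BMOA" using H by (simp add: BMOA_def)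
next
  fix \<epsilon> :: real assume "\<epsilon> > 0"
  \<comment> \<open>The norm of the difference is at most 2 times 100 \<open>\<rho>\<close> =
    \<open>\<epsilon>\<close>/2, leaving room for the strict inequality.\<close>
  define \<rho> where "\<rho> = \<epsilon> / 400"
  have "\<rho> > 0" using \<open>\<epsilon> > 0\<close> by (simp add: \<rho>_def)
  from small[OF this] obtain m where m: "\<And>M x. (\<Sum>n\<in>{m<..M}. (cmod (poly (block c n) (ee x)))\<^sup>2) \<le> \<rho>\<^sup>2"
    by auto
  define P where "P = ramp_poly c m"
  define G where "G = (\<lambda>z. F z - poly P z)"
  have G: "radial_l2 G (\<lambda>k. c k - coeff P k)"
    unfolding G_def by (rule radial_l2_diff_poly[OF F])
  \<comment> \<open>Only almost everywhere: where a radial limit fails to exist,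
    \<open>boundary\<close> takes an unspecified value and need not be additive.\<close>
  have GF: "AE x in lborel. boundary G (ee x) = boundary F (ee x) - poly P (ee x)"
    using radial_l2_boundary[OF F] radial_l2_boundary[OF G]
  proof eventually_elim
    case (elim x)
    have "(\<lambda>k. c k * ee x ^ k - coeff P k * ee x ^ k) sums (boundary F (ee x) - poly P (ee x))"
      by (intro sums_diff elim poly_sums)
    with elim(2) show ?case by (auto simp: left_diff_distrib intro: sums_unique2)
  qed
  note [measurable] = radial_l2_measurable[OF F] radial_l2_measurable[OF G]
  have "mean_osc G s t \<le> 2 * (100 * \<rho>)" if st: "s < t" "t \<le> s + 1" for s t
  proof (rule mean_osc_le_of_osc[OF G st])
    fix \<eta> :: real assume "\<eta> > 0"
    from boundary_minus_ramp_osc[OF F st \<open>\<rho> > 0\<close> this m]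
    obtain c0 where c0: "(LINT x:{s..t}|lborel. cmod (boundary F (ee x) - poly P (ee x) - c0)) \<le> 100 * \<rho> * (t - s) + \<eta>"
      by (auto simp: P_def)
    have "(LINT x:{s..t}|lborel. cmod (boundary G (ee x) - c0)) =
        (LINT x:{s..t}|lborel. cmod (boundary F (ee x) - poly P (ee x) - c0))"
      unfolding set_lebesgue_integral_def
      by (intro integral_cong_AE) (use GF in \<open>auto elim: eventually_mono\<close>)
    with c0 show "\<exists>c0. (LINT x:{s..t}|lborel. cmod (boundary G (ee x) - c0)) \<le> 100 * \<rho> * (t - s) + \<eta>"
      by (intro exI[of _ c0]) simp
  qed
  hence "bmo_norm G \<le> ennreal (2 * (100 * \<rho>))" by (rule bmo_norm_le)
  also have "\<dots> < ennreal \<epsilon>" using \<open>\<epsilon> > 0\<close> by (intro ennreal_lessI) (auto simp: \<rho>_def)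
  finally show "\<exists>p. bmo_norm (\<lambda>z. F z - poly p z) < ennreal \<epsilon>" unfolding G_def by blast
qed

section \<open>Complex Gaussian variables\<close>

text \<open>Uniqueness of translation invariant measures: Fubini applied to
  $1_A(ux)\,1_B(y+ux)$ gives $\lambda(u^{-1}A)\,\lambda(B) = \lambda(u^{-1}B)\,\lambda(A)$,
  and the unit ball is a set $B$ that is fixed by $u$.\<close>

lemma nn_integral_lborel_rotate:
  fixes u :: complex
  assumes u: "cmod u = 1" and f [measurable]: "f \<in> borel_measurable borel"
  shows "(\<integral>\<^sup>+z. f (u * z) \<partial>lborel) = (\<integral>\<^sup>+z. f z \<partial>lborel)"
proof -
  \<comment> \<open>The two invariances that the argument starts from: translation (c = 1) and point
    reflection (c = -1), the latter for the integral over y at the end.\<close>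
  have shift: "(\<integral>\<^sup>+z. g (t + c *\<^sub>R z) \<partial>lborel) = (\<integral>\<^sup>+z. g z \<partial>lborel)"
    if [measurable]: "g \<in> borel_measurable borel" and c: "\<bar>c\<bar> = 1" for g :: "complex \<Rightarrow> ennreal" and t c
  proof -
    have "(\<integral>\<^sup>+z. g z \<partial>lborel) = (\<integral>\<^sup>+z. g z \<partial>(density (distr lborel borel (\<lambda>x. t + c *\<^sub>R x)) (\<lambda>_. ennreal (\<bar>c\<bar> ^ DIM(complex)))))"
      using c by (subst lborel_affine[of c t]) auto
    also have "\<dots> = (\<integral>\<^sup>+z. g (t + c *\<^sub>R z) \<partial>lborel)"
      using c by (simp add: nn_integral_density nn_integral_distr)
    finally show ?thesis ..
  qed
  have u0: "u \<noteq> 0" using u by auto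
  define h :: "complex \<Rightarrow> ennreal" where "h = indicator (ball 0 1)"
  have [measurable]: "h \<in> borel_measurable borel" unfolding h_def by (intro borel_measurable_indicator borel_open open_ball)
  have hu: "h (u * x) = h x" for x by (simp add: h_def indicator_def norm_mult u)
  define V where "V = (\<integral>\<^sup>+z. h z \<partial>lborel)"
  have V: "V \<noteq> 0" "V \<noteq> \<infinity>"
  proof -
    have "V = emeasure lborel (ball (0::complex) 1)" by (simp add: V_def h_def)
    thus "V \<noteq> 0" "V \<noteq> \<infinity>"
      using emeasure_lborel_ball_finite[of "0::complex" 1] content_ball_pos[of 1 "0::complex"]
      by (auto simp: measure_def)
  qed
  have "(\<integral>\<^sup>+z. f (u * z) \<partial>lborel) * V = (\<integral>\<^sup>+x. \<integral>\<^sup>+y. f (u * x) * h (y + u * x) \<partial>lborel \<partial>lborel)"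
    using shift[of h 1] unfolding V_def
    by (simp add: nn_integral_cmult nn_integral_multc add.commute[of _ "u * _"])
  also have "\<dots> = (\<integral>\<^sup>+y. \<integral>\<^sup>+x. f (u * x) * h (y + u * x) \<partial>lborel \<partial>lborel)"
    by (rule lborel_pair.Fubini') measurable
  \<comment> \<open>Translating x by -y/u moves y from the argument of h to that of f. Then h(u x) =
    h(x), because the unit ball is invariant under u.\<close>
  also have "\<dots> = (\<integral>\<^sup>+y. \<integral>\<^sup>+x. f (u * x - y) * h (u * x) \<partial>lborel \<partial>lborel)"
  proof (rule nn_integral_cong)
    fix y
    show "(\<integral>\<^sup>+x. f (u * x) * h (y + u * x) \<partial>lborel) = (\<integral>\<^sup>+x. f (u * x - y) * h (u * x) \<partial>lborel)"
      using shift[of "\<lambda>x. f (u * x) * h (y + u * x)" 1 "- y / u"] u0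
      by (simp add: algebra_simps)
  qed
  also have "\<dots> = (\<integral>\<^sup>+x. \<integral>\<^sup>+y. f (u * x - y) * h (u * x) \<partial>lborel \<partial>lborel)"
    by (rule lborel_pair.Fubini') measurable
  also have "\<dots> = (\<integral>\<^sup>+z. f z \<partial>lborel) * V"
    using shift[of f "-1"] unfolding V_def
    by (simp add: nn_integral_multc nn_integral_cmult hu)
  finally show ?thesis using V by (simp add: mult.commute[of _ V] ennreal_mult_cancel_left)
qed

lemma distributed_std_complex_gaussian:
  assumes "std_complex_gaussian M X"
  shows "distr M borel X = density lborel (\<lambda>z. ennreal (1 / pi * exp (- (cmod z)\<^sup>2)))"
    and "X \<in> borel_measurable M"
proof -
  have "distr M borel X = distr M lborel X" by (rule distr_cong) simp_all
  thus "distr M borel X = density lborel (\<lambda>z. ennreal (1 / pi * exp (- (cmod z)\<^sup>2)))"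
    using assms by (simp add: std_complex_gaussian_def distributed_def)
  show "X \<in> borel_measurable M"
    using assms by (simp add: std_complex_gaussian_def distributed_def)
qed

lemma std_complex_gaussian_rotate:
  assumes X: "std_complex_gaussian M X" and u: "cmod u = 1"
  shows "std_complex_gaussian M (\<lambda>\<omega>. u * X \<omega>)"
  unfolding std_complex_gaussian_def distributed_def
proof (intro conjI)
  note D = distributed_std_complex_gaussian[OF X]
  note [measurable] = D(2)
  let ?f = "\<lambda>z. ennreal (1 / pi * exp (- (cmod z)\<^sup>2))"
  show "distr M lborel (\<lambda>\<omega>. u * X \<omega>) = density lborel ?f"
  proof (rule measure_eqI)
    fix A assume "A \<in> sets (distr M lborel (\<lambda>\<omega>. u * X \<omega>))"
    hence [measurable]: "A \<in> sets borel" by simp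
    have "emeasure (distr M lborel (\<lambda>\<omega>. u * X \<omega>)) A = (\<integral>\<^sup>+z. indicator A z \<partial>distr M lborel (\<lambda>\<omega>. u * X \<omega>))"
      by simp
    also have "\<dots> = (\<integral>\<^sup>+\<omega>. indicator A (u * X \<omega>) \<partial>M)"
      by (rule nn_integral_distr) measurable
    also have "\<dots> = (\<integral>\<^sup>+z. indicator A (u * z) \<partial>distr M borel X)"
      by (simp add: nn_integral_distr)
    also have "\<dots> = (\<integral>\<^sup>+z. ?f (u * z) * indicator A (u * z) \<partial>lborel)"
      unfolding D(1) by (simp add: nn_integral_density norm_mult u)
    also have "\<dots> = (\<integral>\<^sup>+z. ?f z * indicator A z \<partial>lborel)"
      by (rule nn_integral_lborel_rotate[OF u, of "\<lambda>z. ?f z * indicator A z"]) measurable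
    also have "\<dots> = emeasure (density lborel ?f) A"
      by (simp add: emeasure_density)
    finally show "emeasure (distr M lborel (\<lambda>\<omega>. u * X \<omega>)) A = emeasure (density lborel ?f) A" .
  qed simp
qed (use distributed_std_complex_gaussian(2)[OF X] in \<open>measurable\<close>)

text \<open>Opens the way to Fubini in real and imaginary parts, which computes the law of the real
  part of a Gaussian.\<close>

lemma lborel_complex_eq:
  "(lborel :: complex measure) = distr (lborel \<Otimes>\<^sub>M lborel) borel (\<lambda>(x, y). Complex x y)"
proof (rule lborel_eqI)
  have [measurable]: "(\<lambda>(x, y). Complex x y) \<in> borel_measurable (lborel \<Otimes>\<^sub>M lborel)"
    unfolding Complex_eq case_prod_beta by measurable
  fix l u :: complex assume le: "\<And>b. b \<in> Basis \<Longrightarrow> l \<bullet> b \<le> u \<bullet> b"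
  have lu: "Re l \<le> Re u" "Im l \<le> Im u" using le[of 1] le[of \<i>] by (auto simp: Basis_complex_def)
  have "(\<lambda>(x, y). Complex x y) -` box l u \<inter> space (lborel \<Otimes>\<^sub>M lborel) = {Re l<..<Re u} \<times> {Im l<..<Im u}"
    by (auto simp: box_def Basis_complex_def space_pair_measure)
  thus "emeasure (distr (lborel \<Otimes>\<^sub>M lborel) borel (\<lambda>(x, y). Complex x y)) (box l u) = (\<Prod>b\<in>Basis. (u - l) \<bullet> b)"
    using lu by (simp add: emeasure_distr lborel.emeasure_pair_measure_Times Basis_complex_def ennreal_mult)
qed simp

lemma std_complex_gaussian_Re:
  assumes X: "std_complex_gaussian M X"
  shows "distributed M lborel (\<lambda>\<omega>. Re (X \<omega>)) (normal_density 0 (1 / sqrt 2))"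
  unfolding distributed_def
proof (intro conjI)
  note D = distributed_std_complex_gaussian[OF X]
  note [measurable] = D(2)
  have [measurable]: "(\<lambda>(x, y). Complex x y) \<in> borel_measurable (lborel \<Otimes>\<^sub>M lborel)"
    unfolding Complex_eq case_prod_beta by measurable
  let ?n = "normal_density 0 (1 / sqrt 2)"
  let ?f = "\<lambda>z. ennreal (1 / pi * exp (- (cmod z)\<^sup>2))"
  \<comment> \<open>The density factors into two centred normal densities of variance 1/2, and
    integrating out the imaginary part leaves one of them.\<close>
  have dens: "1 / pi * exp (- (cmod (Complex x y))\<^sup>2) = ?n x * ?n y" for x y
    by (simp add: normal_density_def cmod_def power_divide exp_add[symmetric] real_sqrt_mult[symmetric] field_simps)
  show "distr M lborel (\<lambda>\<omega>. Re (X \<omega>)) = density lborel ?n"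
  proof (rule measure_eqI)
    fix A assume "A \<in> sets (distr M lborel (\<lambda>\<omega>. Re (X \<omega>)))"
    hence [measurable]: "A \<in> sets borel" by simp
    have one: "(\<integral>\<^sup>+y. ennreal (?n y) \<partial>lborel) = 1"
      by (subst nn_integral_eq_integral) auto
    have "emeasure (distr M lborel (\<lambda>\<omega>. Re (X \<omega>))) A = (\<integral>\<^sup>+z. indicator A z \<partial>distr M lborel (\<lambda>\<omega>. Re (X \<omega>)))"
      by simp
    also have "\<dots> = (\<integral>\<^sup>+\<omega>. indicator A (Re (X \<omega>)) \<partial>M)"
      by (rule nn_integral_distr) measurable
    also have "\<dots> = (\<integral>\<^sup>+z. indicator A (Re z) \<partial>distr M borel X)"
      by (simp add: nn_integral_distr)
    also have "\<dots> = (\<integral>\<^sup>+z. ?f z * indicator A (Re z) \<partial>lborel)"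
      unfolding D(1) by (simp add: nn_integral_density)
    also have "\<dots> = (\<integral>\<^sup>+p. ?f (Complex (fst p) (snd p)) * indicator A (fst p) \<partial>(lborel \<Otimes>\<^sub>M lborel))"
      by (subst lborel_complex_eq) (simp add: nn_integral_distr case_prod_beta)
    also have "\<dots> = (\<integral>\<^sup>+x. \<integral>\<^sup>+y. ennreal (?n x) * indicator A x * ennreal (?n y) \<partial>lborel \<partial>lborel)"
      unfolding dens by (subst lborel.nn_integral_fst[symmetric]) (auto simp: ennreal_mult mult_ac)
    also have "\<dots> = emeasure (density lborel ?n) A"
      by (simp add: nn_integral_cmult one emeasure_density)
    finally show "emeasure (distr M lborel (\<lambda>\<omega>. Re (X \<omega>))) A = emeasure (density lborel ?n) A" .
  qed simp
qed (use distributed_std_complex_gaussian(2)[OF X] in \<open>measurable\<close>)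

text \<open>The right-hand side does not mention X, so any two such sequences have the same joint
  law; this is applied to a sequence and its rotation.\<close>

lemma (in prob_space) indep_gaussian_law:
  fixes X :: "'i \<Rightarrow> 'a \<Rightarrow> complex"
  assumes "\<And>n. std_complex_gaussian M (X n)" "indep_vars (\<lambda>_. borel) X UNIV"
  shows "distr M (\<Pi>\<^sub>M n\<in>UNIV. borel) (\<lambda>\<omega> n. X n \<omega>) =
    (\<Pi>\<^sub>M n\<in>UNIV. density lborel (\<lambda>z. ennreal (1 / pi * exp (- (cmod z)\<^sup>2))))"
  using indep_vars_iff_distr_eq_PiM[of UNIV X "\<lambda>_. borel"] assms distributed_std_complex_gaussian[OF assms(1)]
  by (simp add: restrict_def)

text \<open>The factors may depend on n: rotating the circle by \<open>\<alpha>\<close> multiplies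
  the n-th coefficient by e(n \<open>\<alpha>\<close>).\<close>

lemma (in prob_space) indep_gaussian_rotate:
  fixes X :: "'i \<Rightarrow> 'a \<Rightarrow> complex"
  assumes X: "\<And>n. std_complex_gaussian M (X n)" "indep_vars (\<lambda>_. borel) X UNIV"
    and u: "\<And>n. cmod (u n) = 1" and [measurable]: "Measurable.pred (\<Pi>\<^sub>M n\<in>UNIV. borel) P"
  shows "prob {\<omega>\<in>space M. P (\<lambda>n. u n * X n \<omega>)} = prob {\<omega>\<in>space M. P (\<lambda>n. X n \<omega>)}"
proof -
  have meas [measurable]: "X n \<in> borel_measurable M" for n by (rule distributed_std_complex_gaussian(2)[OF X(1)])
  have m: "(\<lambda>\<omega> n. Y n \<omega>) \<in> measurable M (\<Pi>\<^sub>M n\<in>UNIV. borel)"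
    if "\<And>n. Y n \<in> borel_measurable M" for Y :: "'i \<Rightarrow> 'a \<Rightarrow> complex"
    using that by (intro measurable_PiM_single') auto
  have "distr M (\<Pi>\<^sub>M n\<in>UNIV. borel) (\<lambda>\<omega> n. u n * X n \<omega>) = distr M (\<Pi>\<^sub>M n\<in>UNIV. borel) (\<lambda>\<omega> n. X n \<omega>)"
    unfolding indep_gaussian_law[OF X]
    by (rule indep_gaussian_law[OF std_complex_gaussian_rotate[OF X(1) u]
          indep_vars_compose2[OF X(2)]]) measurable
  moreover have "prob {\<omega>\<in>space M. P (\<lambda>n. Y n \<omega>)} = measure (distr M (\<Pi>\<^sub>M n\<in>UNIV. borel) (\<lambda>\<omega> n. Y n \<omega>)) {c \<in> space (\<Pi>\<^sub>M n\<in>UNIV. borel). P c}"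
    if "\<And>n. Y n \<in> borel_measurable M" for Y :: "'i \<Rightarrow> 'a \<Rightarrow> complex"
  proof -
    have "{c \<in> space (\<Pi>\<^sub>M n\<in>UNIV. borel). P c} \<in> sets (\<Pi>\<^sub>M n\<in>(UNIV :: 'i set). borel)" by measurable
    thus ?thesis using m[OF that]
      by (subst measure_distr) (auto simp: space_PiM intro!: arg_cong[where f=prob])
  qed
  ultimately show ?thesis by simp
qed

section \<open>Series of independent variables\<close>

text \<open>The martingale difference property in the form needed for Kolmogorov's inequality. It is
  used once with a partial sum for g (additivity of variances) and once with a stopped partial
  sum.\<close>

lemma (in prob_space) indep_past_orthogonal:
  fixes Y :: "nat \<Rightarrow> 'a \<Rightarrow> real"
  assumes Y: "indep_vars (\<lambda>_. borel) Y UNIV" and "integrable M (Y i)" "expectation (Y i) = 0"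
    and "k \<le> i" and g: "g \<in> borel_measurable (\<Pi>\<^sub>M j\<in>{..<k}. borel)"
    and "integrable M (\<lambda>\<omega>. g (\<lambda>j\<in>{..<k}. Y j \<omega>))"
  shows "integrable M (\<lambda>\<omega>. g (\<lambda>j\<in>{..<k}. Y j \<omega>) * Y i \<omega>)"
    and "expectation (\<lambda>\<omega>. g (\<lambda>j\<in>{..<k}. Y j \<omega>) * Y i \<omega>) = 0"
proof -
  have "indep_var (\<Pi>\<^sub>M j\<in>{..<k}. borel) (\<lambda>\<omega>. \<lambda>j\<in>{..<k}. Y j \<omega>) (\<Pi>\<^sub>M j\<in>{i}. borel) (\<lambda>\<omega>. \<lambda>j\<in>{i}. Y j \<omega>)"
    using \<open>k \<le> i\<close> by (intro indep_var_restrict[OF Y]) auto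
  hence "indep_var borel (g \<circ> (\<lambda>\<omega>. \<lambda>j\<in>{..<k}. Y j \<omega>)) borel ((\<lambda>f. f i) \<circ> (\<lambda>\<omega>. \<lambda>j\<in>{i}. Y j \<omega>))"
    by (rule indep_var_compose[OF _ g]) measurable
  hence ind: "indep_var borel (\<lambda>\<omega>. g (\<lambda>j\<in>{..<k}. Y j \<omega>)) borel (Y i)"
    by (simp add: comp_def)
  show "integrable M (\<lambda>\<omega>. g (\<lambda>j\<in>{..<k}. Y j \<omega>) * Y i \<omega>)"
    by (rule indep_var_integrable[OF ind]) fact+
  show "expectation (\<lambda>\<omega>. g (\<lambda>j\<in>{..<k}. Y j \<omega>) * Y i \<omega>) = 0"
    using indep_var_lebesgue_integral[OF ind] assms by simp
qed

text \<open>\<open>A k\<close> is the event that level t is first reached at time k. On it the later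
  increments are orthogonal to S_k, so the mean of S_n^2 over \<open>A k\<close> is at least that of
  S_k^2, hence at least t^2 times its probability. The events are disjoint, so these bounds add
  up.\<close>

lemma (in prob_space) kolmogorov_inequality:
  fixes Y :: "nat \<Rightarrow> 'a \<Rightarrow> real"
  assumes Y: "indep_vars (\<lambda>_. borel) Y UNIV" and int: "\<And>i. integrable M (Y i)"
    and int2: "\<And>i. integrable M (\<lambda>\<omega>. (Y i \<omega>)\<^sup>2)" and zero: "\<And>i. expectation (Y i) = 0" and t: "t > 0"
  shows "prob {\<omega>\<in>space M. \<exists>k\<le>n. t \<le> \<bar>\<Sum>i<k. Y i \<omega>\<bar>} \<le> (\<Sum>i<n. expectation (\<lambda>\<omega>. (Y i \<omega>)\<^sup>2)) / t\<^sup>2"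
proof -
  define S where "S k \<omega> = (\<Sum>i<k. Y i \<omega>)" for k \<omega>
  have meas [measurable]: "Y i \<in> borel_measurable M" for i using int by auto
  have S_meas [measurable]: "S k \<in> borel_measurable M" for k unfolding S_def by measurable
  have S_int: "integrable M (S k)" for k unfolding S_def using int by auto
  have S_sq: "integrable M (\<lambda>\<omega>. (S k \<omega>)\<^sup>2) \<and> expectation (\<lambda>\<omega>. (S k \<omega>)\<^sup>2) = (\<Sum>i<k. expectation (\<lambda>\<omega>. (Y i \<omega>)\<^sup>2))" for k
  proof (induction k)
    case 0 thus ?case by (simp add: S_def)
  next
    case (Suc k)
    have g: "(\<lambda>f. \<Sum>i<k. f i) \<in> borel_measurable (\<Pi>\<^sub>M j\<in>{..<k}. (borel :: real measure))"
      by (intro borel_measurable_sum measurable_component_singleton)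
    have S_eq: "S k \<omega> = (\<Sum>i<k. (\<lambda>j\<in>{..<k}. Y j \<omega>) i)" for \<omega> by (simp add: S_def)
    have "integrable M (\<lambda>\<omega>. S k \<omega> * Y k \<omega>)" "expectation (\<lambda>\<omega>. S k \<omega> * Y k \<omega>) = 0"
      using indep_past_orthogonal[OF Y int zero order.refl g] S_int[of k] unfolding S_eq[symmetric] by auto
    moreover have "(S (Suc k) \<omega>)\<^sup>2 = (S k \<omega>)\<^sup>2 + 2 * (S k \<omega> * Y k \<omega>) + (Y k \<omega>)\<^sup>2" for \<omega>
      by (simp add: S_def power2_sum)
    ultimately show ?case using Suc int2[of k] by simp
  qed
  define A where "A k = {\<omega>\<in>space M. t \<le> \<bar>S k \<omega>\<bar> \<and> (\<forall>j<k. \<bar>S j \<omega>\<bar> < t)}" for k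
  have A [measurable]: "A k \<in> events" for k unfolding A_def by measurable
  have disj: "disjoint_family_on A {..n}"
  proof -
    have *: "A i \<inter> A j = {}" if "i < j" for i j
    proof (rule equals0I)
      fix \<omega> assume "\<omega> \<in> A i \<inter> A j"
      hence "t \<le> \<bar>S i \<omega>\<bar>" "\<bar>S i \<omega>\<bar> < t" using that by (simp_all add: A_def)
      thus False by simp
    qed
    show ?thesis unfolding disjoint_family_on_def
    proof (intro ballI impI)
      fix i j :: nat assume "i \<noteq> j"
      thus "A i \<inter> A j = {}" using *[of i j] *[of j i] by (cases "i < j") (simp_all add: Int_commute)
    qed
  qed
  have "{\<omega>\<in>space M. \<exists>k\<le>n. t \<le> \<bar>S k \<omega>\<bar>} = (\<Union>k\<le>n. A k)"
  proof safe
    fix \<omega> k assume \<omega>: "\<omega> \<in> space M" and k: "k \<le> n" "t \<le> \<bar>S k \<omega>\<bar>"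
    define l where "l = (LEAST k. t \<le> \<bar>S k \<omega>\<bar>)"
    have "t \<le> \<bar>S l \<omega>\<bar>" "l \<le> k" unfolding l_def using k by (auto intro: LeastI Least_le)
    moreover have "\<bar>S j \<omega>\<bar> < t" if "j < l" for j using not_less_Least[OF that[unfolded l_def]] by simp
    ultimately have "\<omega> \<in> A l" "l \<le> n" using \<omega> k by (auto simp: A_def)
    thus "\<omega> \<in> (\<Union>k\<le>n. A k)" by auto
  qed (auto simp: A_def)
  hence "prob {\<omega>\<in>space M. \<exists>k\<le>n. t \<le> \<bar>S k \<omega>\<bar>} = (\<Sum>k\<le>n. prob (A k))"
    using finite_measure_finite_Union[OF _ _ disj] A by (simp add: image_subset_iff)
  moreover have "t\<^sup>2 * prob (A k) \<le> expectation (\<lambda>\<omega>. indicator (A k) \<omega> * (S n \<omega>)\<^sup>2)" if k: "k \<le> n" for k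
  proof -
    \<comment> \<open>The variable S_k restricted to the event \<open>A k\<close>, written as a
      measurable function of the coordinates below k so that \<open>indep_past_orthogonal\<close>
      applies to it.\<close>
    define g where "g f = (if t \<le> \<bar>\<Sum>i<k. f i\<bar> \<and> (\<forall>j\<in>{..<k}. \<bar>\<Sum>i<j. f i\<bar> < t) then (\<Sum>i<k. f i) else 0)" for f :: "nat \<Rightarrow> real"
    have m: "(\<lambda>f. \<Sum>i<j. f i) \<in> borel_measurable (\<Pi>\<^sub>M j\<in>{..<k}. (borel :: real measure))" if "j \<le> k" for j
      using that by (intro borel_measurable_sum measurable_component_singleton) auto
    have [measurable]: "(\<lambda>f. \<Sum>i<k. f i) \<in> borel_measurable (\<Pi>\<^sub>M j\<in>{..<k}. (borel :: real measure))" by (rule m) simp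
    have [measurable]: "Measurable.pred (\<Pi>\<^sub>M j\<in>{..<k}. (borel :: real measure)) (\<lambda>f. \<forall>j\<in>{..<k}. \<bar>\<Sum>i<j. f i\<bar> < t)"
    proof (rule pred_intros_finite)
      fix j assume "j \<in> {..<k}"
      hence [measurable]: "(\<lambda>f. \<Sum>i<j. f i) \<in> borel_measurable (\<Pi>\<^sub>M j\<in>{..<k}. (borel :: real measure))"
        by (intro m) simp
      show "Measurable.pred (\<Pi>\<^sub>M j\<in>{..<k}. (borel :: real measure)) (\<lambda>f. \<bar>\<Sum>i<j. f i\<bar> < t)" by measurable
    qed simp
    have g: "g \<in> borel_measurable (\<Pi>\<^sub>M j\<in>{..<k}. borel)"
      unfolding g_def by measurable
    have g_eq: "g (\<lambda>j\<in>{..<k}. Y j \<omega>) = indicator (A k) \<omega> * S k \<omega>" if "\<omega> \<in> space M" for \<omega>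
      using that by (auto simp: g_def A_def S_def indicator_def)
    have i1: "integrable M (\<lambda>\<omega>. indicator (A k) \<omega> * S k \<omega>)"
      using integrable_mult_indicator[OF A S_int] by simp
    hence i2: "integrable M (\<lambda>\<omega>. g (\<lambda>j\<in>{..<k}. Y j \<omega>))"
      by (subst Bochner_Integration.integrable_cong[OF refl g_eq])
    have orth: "integrable M (\<lambda>\<omega>. indicator (A k) \<omega> * S k \<omega> * Y i \<omega>) \<and> expectation (\<lambda>\<omega>. indicator (A k) \<omega> * S k \<omega> * Y i \<omega>) = 0"
      if "k \<le> i" for i
    proof -
      have "integrable M (\<lambda>\<omega>. g (\<lambda>j\<in>{..<k}. Y j \<omega>) * Y i \<omega>) = integrable M (\<lambda>\<omega>. indicator (A k) \<omega> * S k \<omega> * Y i \<omega>)"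
        by (intro Bochner_Integration.integrable_cong) (auto simp: g_eq)
      moreover have "expectation (\<lambda>\<omega>. g (\<lambda>j\<in>{..<k}. Y j \<omega>) * Y i \<omega>) = expectation (\<lambda>\<omega>. indicator (A k) \<omega> * S k \<omega> * Y i \<omega>)"
        by (intro Bochner_Integration.integral_cong) (auto simp: g_eq)
      ultimately show ?thesis
        using indep_past_orthogonal[OF Y int zero that g i2] by simp
    qed
    define Z where "Z \<omega> = (\<Sum>i\<in>{k..<n}. indicator (A k) \<omega> * S k \<omega> * Y i \<omega>)" for \<omega>
    have Z: "integrable M Z" "expectation Z = 0"
      unfolding Z_def using orth by (auto intro!: Bochner_Integration.integrable_sum simp: Bochner_Integration.integral_sum)
    have SZ: "Z \<omega> = indicator (A k) \<omega> * (S k \<omega> * (S n \<omega> - S k \<omega>))" for \<omega>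
    proof -
      have "S n \<omega> - S k \<omega> = (\<Sum>i\<in>{k..<n}. Y i \<omega>)"
        unfolding S_def using k sum_diff_nat_ivl[of 0 k n "\<lambda>i. Y i \<omega>"] by (simp add: atLeast0LessThan)
      thus ?thesis by (simp add: Z_def sum_distrib_left mult_ac)
    qed
    have i3: "integrable M (\<lambda>\<omega>. t\<^sup>2 * indicator (A k) \<omega> :: real)"
      by (intro integrable_mult_right integrable_real_indicator A) (simp add: emeasure_eq_measure)
    have "t\<^sup>2 * prob (A k) = expectation (\<lambda>\<omega>. t\<^sup>2 * indicator (A k) \<omega> + 2 * Z \<omega>)"
      using Z(1) by (subst Bochner_Integration.integral_add[OF i3]) (simp_all add: Z(2))
    also have "\<dots> \<le> expectation (\<lambda>\<omega>. indicator (A k) \<omega> * (S n \<omega>)\<^sup>2)"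
    proof (rule integral_mono)
      show "integrable M (\<lambda>\<omega>. t\<^sup>2 * indicator (A k) \<omega> + 2 * Z \<omega>)"
        using Z(1) i3 by (intro Bochner_Integration.integrable_add) simp_all
      show "integrable M (\<lambda>\<omega>. indicator (A k) \<omega> * (S n \<omega>)\<^sup>2)"
        using integrable_mult_indicator[OF A, of "\<lambda>\<omega>. (S n \<omega>)\<^sup>2"] S_sq by simp
      fix \<omega>
      show "t\<^sup>2 * indicator (A k) \<omega> + 2 * Z \<omega> \<le> indicator (A k) \<omega> * (S n \<omega>)\<^sup>2"
      proof (cases "\<omega> \<in> A k")
        case True
        hence "t\<^sup>2 \<le> \<bar>S k \<omega>\<bar>\<^sup>2" using t by (intro power_mono) (auto simp: A_def)
        \<comment> \<open>The last square is dropped; the mixed term is Z on \<open>A k\<close> and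
          has mean 0.\<close>
        moreover have "(S n \<omega>)\<^sup>2 = (S k \<omega>)\<^sup>2 + 2 * (S k \<omega> * (S n \<omega> - S k \<omega>)) + (S n \<omega> - S k \<omega>)\<^sup>2"
          by (simp add: power2_eq_square algebra_simps)
        moreover have "0 \<le> (S n \<omega> - S k \<omega>)\<^sup>2" by simp
        ultimately have "t\<^sup>2 + 2 * (S k \<omega> * (S n \<omega> - S k \<omega>)) \<le> (S n \<omega>)\<^sup>2"
          unfolding power2_abs by linarith
        thus ?thesis using True by (simp add: SZ)
      qed (simp add: SZ)
    qed
    finally show ?thesis .
  qed
  ultimately have "t\<^sup>2 * prob {\<omega>\<in>space M. \<exists>k\<le>n. t \<le> \<bar>S k \<omega>\<bar>} \<le> (\<Sum>k\<le>n. expectation (\<lambda>\<omega>. indicator (A k) \<omega> * (S n \<omega>)\<^sup>2))"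
    by (simp only: sum_distrib_left) (intro sum_mono, simp)
  also have "\<dots> = expectation (\<lambda>\<omega>. \<Sum>k\<le>n. indicator (A k) \<omega> * (S n \<omega>)\<^sup>2)"
    using integrable_mult_indicator[OF A, of "\<lambda>\<omega>. (S n \<omega>)\<^sup>2"] S_sq
    by (subst Bochner_Integration.integral_sum) auto
  also have "\<dots> \<le> expectation (\<lambda>\<omega>. (S n \<omega>)\<^sup>2)"
  proof (rule integral_mono)
    show "integrable M (\<lambda>\<omega>. \<Sum>k\<le>n. indicator (A k) \<omega> * (S n \<omega>)\<^sup>2)"
      using integrable_mult_indicator[OF A, of "\<lambda>\<omega>. (S n \<omega>)\<^sup>2"] S_sq
      by (intro Bochner_Integration.integrable_sum) simp
    fix \<omega>
    have "(\<Sum>k\<le>n. indicator (A k) \<omega>) = (indicator (\<Union>k\<le>n. A k) \<omega> :: real)"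
      by (rule indicator_UN_disjoint[OF _ disj, symmetric]) simp
    also have "\<dots> \<le> 1" by (simp add: indicator_def)
    finally have "(\<Sum>k\<le>n. indicator (A k) \<omega>) * (S n \<omega>)\<^sup>2 \<le> 1 * (S n \<omega>)\<^sup>2"
      by (rule mult_right_mono) simp
    thus "(\<Sum>k\<le>n. indicator (A k) \<omega> * (S n \<omega>)\<^sup>2) \<le> (S n \<omega>)\<^sup>2"
      by (simp only: sum_distrib_right mult_1)
  qed (use S_sq in auto)
  also have "\<dots> = (\<Sum>i<n. expectation (\<lambda>\<omega>. (Y i \<omega>)\<^sup>2))" using S_sq by simp
  finally show ?thesis unfolding S_def using t by (simp add: field_simps)
qed

text \<open>Kolmogorov's inequality for the series started at m bounds the probability that some
  later partial sum ever exceeds t by the tail variance divided by t^2. As m grows this tends to 0,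
  so almost surely the Cauchy criterion holds for every t = 1/(j + 1).\<close>

lemma (in prob_space) indep_series_converges:
  fixes Y :: "nat \<Rightarrow> 'a \<Rightarrow> real"
  assumes Y: "indep_vars (\<lambda>_. borel) Y UNIV" and int: "\<And>i. integrable M (Y i)"
    and int2: "\<And>i. integrable M (\<lambda>\<omega>. (Y i \<omega>)\<^sup>2)" and zero: "\<And>i. expectation (Y i) = 0"
    and summ: "summable (\<lambda>i. expectation (\<lambda>\<omega>. (Y i \<omega>)\<^sup>2))"
  shows "AE \<omega> in M. summable (\<lambda>i. Y i \<omega>)"
proof -
  have meas [measurable]: "Y i \<in> borel_measurable M" for i using int by auto
  define T where "T m = (\<Sum>i. expectation (\<lambda>\<omega>. (Y (i + m) \<omega>)\<^sup>2))" for m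
  have T: "T \<longlonglongrightarrow> 0"
  proof (rule LIMSEQ_I)
    fix r :: real assume "r > 0"
    from suminf_exist_split[OF this summ] show "\<exists>N. \<forall>n\<ge>N. norm (T n - 0) < r" by (simp add: T_def)
  qed
  define B where "B t m = {\<omega>\<in>space M. \<exists>k. t \<le> \<bar>\<Sum>i<k. Y (i + m) \<omega>\<bar>}" for t m
  have [measurable]: "B t m \<in> events" for t m unfolding B_def by measurable
  have B: "prob (B t m) \<le> T m / t\<^sup>2" if t: "t > 0" for t m
  proof -
    define C where "C n = {\<omega>\<in>space M. \<exists>k\<le>n. t \<le> \<bar>\<Sum>i<k. Y (i + m) \<omega>\<bar>}" for n
    have [measurable]: "C n \<in> events" for n unfolding C_def by measurable
    have "incseq C" by (intro incseq_SucI) (auto simp: C_def intro: le_SucI)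
    hence "(\<lambda>n. prob (C n)) \<longlonglongrightarrow> prob (\<Union>n. C n)"
      by (intro finite_Lim_measure_incseq) auto
    moreover have "(\<Union>n. C n) = B t m" by (auto simp: C_def B_def)
    moreover have "prob (C n) \<le> T m / t\<^sup>2" for n
    proof -
      have ind: "indep_vars (\<lambda>_. borel) (\<lambda>i. Y (i + m)) UNIV"
      proof -
        have "indep_vars (\<lambda>j. \<Pi>\<^sub>M i\<in>{j + m}. borel) (\<lambda>j \<omega>. \<lambda>i\<in>{j + m}. Y i \<omega>) UNIV"
          by (rule indep_vars_restrict[OF Y]) (auto simp: disjoint_family_on_def)
        hence "indep_vars (\<lambda>_. borel) (\<lambda>j \<omega>. (\<lambda>f. f (j + m)) (\<lambda>i\<in>{j + m}. Y i \<omega>)) UNIV"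
          by (rule indep_vars_compose2) measurable
        thus ?thesis by simp
      qed
      have "prob (C n) \<le> (\<Sum>i<n. expectation (\<lambda>\<omega>. (Y (i + m) \<omega>)\<^sup>2)) / t\<^sup>2"
        unfolding C_def by (rule kolmogorov_inequality[OF ind int int2 zero t])
      also have "\<dots> \<le> T m / t\<^sup>2"
        unfolding T_def using summ
        by (intro divide_right_mono sum_le_suminf summable_ignore_initial_segment) auto
      finally show ?thesis .
    qed
    ultimately show ?thesis by (intro LIMSEQ_le_const2) auto
  qed
  have "AE \<omega> in M. \<exists>m. \<omega> \<notin> B t m" if t: "t > 0" for t
  proof -
    have "prob (\<Inter>m. B t m) \<le> T m / t\<^sup>2" for m
      by (rule order.trans[OF finite_measure_mono B[OF t, of m]]) auto
    hence "prob (\<Inter>m. B t m) \<le> 0 / t\<^sup>2"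
      by (intro LIMSEQ_le_const[OF tendsto_divide[OF T tendsto_const]]) (use t in auto)
    hence "prob (\<Inter>m. B t m) = 0" using measure_nonneg[of M "\<Inter>m. B t m"] by (intro order.antisym) simp_all
    hence "(\<Inter>m. B t m) \<in> null_sets M" by (intro null_setsI) (auto simp: emeasure_eq_measure)
    thus ?thesis by (rule AE_I') auto
  qed
  hence "AE \<omega> in M. \<forall>j. \<exists>m. \<omega> \<notin> B (1 / real (Suc j)) m"
    by (simp add: AE_all_countable)
  moreover have "AE \<omega> in M. \<omega> \<in> space M" by simp
  ultimately show ?thesis
  proof eventually_elim
    case (elim \<omega>)
    show ?case unfolding summable_Cauchy
    proof (intro allI impI)
      fix e :: real assume "e > 0"
      then obtain j where j: "inverse (real (Suc j)) < e / 2" using reals_Archimedean[of "e / 2"] by auto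
      obtain m where m: "\<omega> \<notin> B (1 / real (Suc j)) m" using elim by blast
      have small: "\<bar>\<Sum>i\<in>{m..<n}. Y i \<omega>\<bar> < e / 2" if "n \<ge> m" for n
      proof -
        have "(\<Sum>i\<in>{m..<n}. Y i \<omega>) = (\<Sum>i<n - m. Y (i + m) \<omega>)"
          using that sum.shift_bounds_nat_ivl[of "\<lambda>i. Y i \<omega>" 0 m "n - m"] by (simp add: atLeast0LessThan)
        moreover have "\<bar>\<Sum>i<n - m. Y (i + m) \<omega>\<bar> < 1 / real (Suc j)"
          using m elim(2) unfolding B_def by (auto simp: not_le simp del: of_nat_Suc)
        ultimately show ?thesis using j by (simp add: inverse_eq_divide)
      qed
      have "norm (\<Sum>i\<in>{m'..<n}. Y i \<omega>) < e" if "m' \<ge> m" for m' n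
      proof (cases "n \<ge> m'")
        case True
        have "(\<Sum>i\<in>{m'..<n}. Y i \<omega>) = (\<Sum>i\<in>{m..<n}. Y i \<omega>) - (\<Sum>i\<in>{m..<m'}. Y i \<omega>)"
          using sum_diff_nat_ivl[of m m' n "\<lambda>i. Y i \<omega>"] that True by simp
        thus ?thesis using small[of n] small[of m'] that True by simp
      qed (use \<open>e > 0\<close> in simp)
      thus "\<exists>N. \<forall>m\<ge>N. \<forall>n. norm (\<Sum>i\<in>{m..<n}. Y i \<omega>) < e" by blast
    qed
  qed
qed

section \<open>Gaussian power series\<close>

lemma (in prob_space) std_complex_gaussian_Re_moments:
  assumes X: "std_complex_gaussian M X"
  shows "integrable M (\<lambda>\<omega>. Re (X \<omega>))" "integrable M (\<lambda>\<omega>. (Re (X \<omega>))\<^sup>2)"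
    and "expectation (\<lambda>\<omega>. Re (X \<omega>)) = 0" "expectation (\<lambda>\<omega>. (Re (X \<omega>))\<^sup>2) = 1 / 2"
proof -
  note D = std_complex_gaussian_Re[OF X]
  have \<sigma>: "0 < 1 / sqrt (2::real)" by simp
  have "integrable M (\<lambda>\<omega>. (Re (X \<omega>)) ^ k)" for k
    using distributed_integrable[OF D, of "\<lambda>x. x ^ k"] integrable_normal_moment[OF \<sigma>, of 0 k] by simp
  from this[of 1] this[of 2] show "integrable M (\<lambda>\<omega>. Re (X \<omega>))" "integrable M (\<lambda>\<omega>. (Re (X \<omega>))\<^sup>2)"
    by simp_all
  show E: "expectation (\<lambda>\<omega>. Re (X \<omega>)) = 0"
    by (rule normal_distributed_expectation[OF \<sigma> D])
  show "expectation (\<lambda>\<omega>. (Re (X \<omega>))\<^sup>2) = 1 / 2"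
    using normal_distributed_variance[OF \<sigma> D] by (simp add: E power_divide)
qed

lemma (in prob_space) gaussian_series_converges:
  assumes X: "\<And>n. std_complex_gaussian M (X n)" "indep_vars (\<lambda>_. borel) X UNIV"
    and a: "summable (\<lambda>n. (a n :: real)\<^sup>2)"
  shows "AE \<omega> in M. summable (\<lambda>n. of_real (a n) * X n \<omega>)"
proof -
  have main: "AE \<omega> in M. summable (\<lambda>n. a n * Re (u * X n \<omega>))" if u: "cmod u = 1" for u
  proof (rule indep_series_converges)
    note m = std_complex_gaussian_Re_moments[OF std_complex_gaussian_rotate[OF X(1) u]]
    show "indep_vars (\<lambda>_. borel) (\<lambda>n \<omega>. a n * Re (u * X n \<omega>)) UNIV"
      by (rule indep_vars_compose2[OF X(2), of "\<lambda>n z. a n * Re (u * z)"]) measurable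
    show "integrable M (\<lambda>\<omega>. a n * Re (u * X n \<omega>))" for n
      using m(1)[of n] by (intro integrable_mult_right) simp
    show "integrable M (\<lambda>\<omega>. (a n * Re (u * X n \<omega>))\<^sup>2)" for n
      using m(2)[of n] unfolding power_mult_distrib by (intro integrable_mult_right) simp
    show "expectation (\<lambda>\<omega>. a n * Re (u * X n \<omega>)) = 0" for n
      by (subst integral_mult_right_zero) (simp only: m(3) mult_zero_right)
    show "summable (\<lambda>i. expectation (\<lambda>\<omega>. (a i * Re (u * X i \<omega>))\<^sup>2))"
      unfolding power_mult_distrib integral_mult_right_zero m(4) by (intro summable_mult2 a)
  qed
  \<comment> \<open>Re(-i z) = Im z, so rotation invariance transfers everything proved for real
    parts to imaginary parts.\<close>
  have i: "cmod (- \<i>) = 1" by simp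
  from main[OF norm_one] main[OF i] show ?thesis
  proof (eventually_elim)
    case (elim \<omega>)
    thus ?case by (simp add: summable_complex_iff)
  qed
qed

text \<open>For each fixed t the twisted coefficients are again independent standard Gaussians, so
  the series converges almost surely; Fubini exchanges the two almost-everywhere
  quantifiers.\<close>

lemma (in prob_space) gaussian_series_AE_circle:
  assumes X: "\<And>n. std_complex_gaussian M (X n)" "indep_vars (\<lambda>_. borel) X UNIV"
    and a: "summable (\<lambda>n. (a n :: real)\<^sup>2)"
  shows "AE \<omega> in M. AE t in lborel. summable (\<lambda>n. of_real (a n) * X n \<omega> * ee t ^ n)"
proof -
  note [measurable] = distributed_std_complex_gaussian(2)[OF X(1)]
  interpret pair_sigma_finite M lborel ..
  have "AE \<omega> in M. summable (\<lambda>n. of_real (a n) * X n \<omega> * ee t ^ n)" for t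
  proof -
    have "AE \<omega> in M. summable (\<lambda>n. of_real (a n) * (ee t ^ n * X n \<omega>))"
      by (intro gaussian_series_converges std_complex_gaussian_rotate X a
          indep_vars_compose2[OF X(2), of "\<lambda>n z. ee t ^ n * z"]) (auto simp: norm_power)
    thus ?thesis by (simp add: mult_ac)
  qed
  hence "AE t in lborel. AE \<omega> in M. summable (\<lambda>n. of_real (a n) * X n \<omega> * ee t ^ n)" by simp
  moreover have "{p \<in> space (M \<Otimes>\<^sub>M lborel). summable (\<lambda>n. of_real (a n) * X n (fst p) * ee (snd p) ^ n)} \<in> sets (M \<Otimes>\<^sub>M lborel)"
    unfolding summable_iff_convergent Cauchy_convergent_iff[symmetric] by measurable
  ultimately show ?thesis by (subst AE_commute) simp_all
qed

section \<open>Square summability of the coefficients: sufficiency and necessity\<close>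

lemma (in prob_space) AE_summable_of_expectation:
  fixes Y :: "nat \<Rightarrow> 'a \<Rightarrow> real"
  assumes "\<And>n. integrable M (Y n)" "\<And>n \<omega>. 0 \<le> Y n \<omega>" "summable (\<lambda>n. expectation (Y n))"
  shows "AE \<omega> in M. summable (\<lambda>n. Y n \<omega>)"
proof -
  have [measurable]: "Y n \<in> borel_measurable M" for n using assms by auto
  have "(\<integral>\<^sup>+\<omega>. (\<Sum>n. ennreal (Y n \<omega>)) \<partial>M) = (\<Sum>n. \<integral>\<^sup>+\<omega>. ennreal (Y n \<omega>) \<partial>M)"
    by (rule nn_integral_suminf) measurable
  also have "\<dots> = (\<Sum>n. ennreal (expectation (Y n)))"
    using assms by (intro suminf_cong nn_integral_eq_integral) auto
  also have "\<dots> = ennreal (\<Sum>n. expectation (Y n))"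
    using assms by (intro suminf_ennreal2) auto
  finally have "(\<integral>\<^sup>+\<omega>. (\<Sum>n. ennreal (Y n \<omega>)) \<partial>M) \<noteq> \<infinity>" by simp
  hence "AE \<omega> in M. (\<Sum>n. ennreal (Y n \<omega>)) \<noteq> \<infinity>"
    by (intro nn_integral_PInf_AE) measurable
  thus ?thesis
    by eventually_elim (auto intro!: summable_suminf_not_top assms(2))
qed

lemma (in prob_space) gaussian_coeffs_l2:
  assumes X: "\<And>n. std_complex_gaussian M (X n)" and a: "summable (\<lambda>n. (a n :: real)\<^sup>2)"
  shows "AE \<omega> in M. summable (\<lambda>n. (cmod (of_real (a n) * X n \<omega>))\<^sup>2)"
proof -
  have main: "AE \<omega> in M. summable (\<lambda>n. (a n)\<^sup>2 * (Re (u * X n \<omega>))\<^sup>2)" if u: "cmod u = 1" for u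
  proof (rule AE_summable_of_expectation)
    note m = std_complex_gaussian_Re_moments[OF std_complex_gaussian_rotate[OF X(1) u]]
    show "integrable M (\<lambda>\<omega>. (a n)\<^sup>2 * (Re (u * X n \<omega>))\<^sup>2)" for n
      using m(2)[of n] by (intro integrable_mult_right) simp
    show "summable (\<lambda>i. expectation (\<lambda>\<omega>. (a i)\<^sup>2 * (Re (u * X i \<omega>))\<^sup>2))"
      unfolding integral_mult_right_zero m(4) by (intro summable_mult2 a)
  qed simp
  have i: "cmod (- \<i>) = 1" by simp
  from main[OF norm_one] main[OF i] show ?thesis
  proof (eventually_elim)
    case (elim \<omega>)
    have "summable (\<lambda>n. (a n)\<^sup>2 * (Re (1 * X n \<omega>))\<^sup>2 + (a n)\<^sup>2 * (Re (- \<i> * X n \<omega>))\<^sup>2)"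
      by (intro summable_add elim)
    moreover have "(cmod (of_real (a n) * X n \<omega>))\<^sup>2 = (a n)\<^sup>2 * (Re (1 * X n \<omega>))\<^sup>2 + (a n)\<^sup>2 * (Re (- \<i> * X n \<omega>))\<^sup>2" for n
      by (simp add: norm_mult power_mult_distrib cmod_power2 distrib_left)
    ultimately show ?case by simp
  qed
qed

text \<open>The density is at most 1/(2 \<open>\<sigma>\<close>) because 2 pi > 4, and the interval
  has length 2K.\<close>

lemma (in prob_space) normal_small_ball:
  assumes D: "distributed M lborel Z (normal_density 0 \<sigma>)" and \<sigma>: "0 < \<sigma>" and "0 \<le> K"
  shows "emeasure M {\<omega>\<in>space M. \<bar>Z \<omega>\<bar> < K} \<le> ennreal (K / \<sigma>)"
proof -
  have "{\<omega>\<in>space M. \<bar>Z \<omega>\<bar> < K} = Z -` {-K<..<K} \<inter> space M" by auto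
  hence "emeasure M {\<omega>\<in>space M. \<bar>Z \<omega>\<bar> < K} = (\<integral>\<^sup>+x. ennreal (normal_density 0 \<sigma> x) * indicator {-K<..<K} x \<partial>lborel)"
    using distributed_emeasure[OF D, of "{-K<..<K}"] by simp
  also have "\<dots> \<le> (\<integral>\<^sup>+x. ennreal (1 / (2 * \<sigma>)) * indicator {-K<..<K} x \<partial>lborel)"
  proof (intro nn_integral_mono mult_right_mono ennreal_leI)
    fix x
    have "2 * \<sigma> = sqrt (4 * \<sigma>\<^sup>2)" using \<sigma> by (simp add: real_sqrt_mult)
    also have "\<dots> \<le> sqrt (2 * pi * \<sigma>\<^sup>2)" using pi_gt3 \<sigma> by (intro real_sqrt_le_mono mult_right_mono) auto
    finally have "1 / sqrt (2 * pi * \<sigma>\<^sup>2) \<le> 1 / (2 * \<sigma>)" using \<sigma> by (intro divide_left_mono) auto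
    moreover have "exp (-(x - 0)\<^sup>2 / (2 * \<sigma>\<^sup>2)) \<le> 1" using \<sigma> by (simp add: field_simps)
    ultimately have "1 / sqrt (2 * pi * \<sigma>\<^sup>2) * exp (-(x - 0)\<^sup>2 / (2 * \<sigma>\<^sup>2)) \<le> 1 / (2 * \<sigma>) * 1"
      using \<sigma> by (intro mult_mono) auto
    thus "normal_density 0 \<sigma> x \<le> 1 / (2 * \<sigma>)" by (simp only: normal_density_def mult_1_right)
  qed simp
  also have "\<dots> = ennreal (1 / (2 * \<sigma>)) * ennreal (2 * K)"
    using \<open>0 \<le> K\<close> by (simp add: nn_integral_cmult)
  also have "\<dots> = ennreal (K / \<sigma>)"
    using \<sigma> \<open>0 \<le> K\<close> by (simp add: ennreal_mult[symmetric])
  finally show ?thesis .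
qed

lemma (in prob_space) gaussian_sum_small_ball:
  fixes X :: "nat \<Rightarrow> 'a \<Rightarrow> complex"
  assumes X: "\<And>n. std_complex_gaussian M (X n)" "indep_vars (\<lambda>_. borel) X UNIV"
    and K: "0 \<le> K" and \<sigma>: "0 < \<sigma>" "\<sigma>\<^sup>2 \<le> (\<Sum>n<N. (b n)\<^sup>2) / 2"
  shows "emeasure M {\<omega>\<in>space M. cmod (\<Sum>n<N. of_real (b n) * X n \<omega>) < K} \<le> ennreal (K / \<sigma>)"
proof -
  note [measurable] = distributed_std_complex_gaussian(2)[OF X(1)]
  \<comment> \<open>\<open>sum_indep_normal\<close> asks for positive standard deviations and a
    nonempty index set, so indices with b n = 0 are removed. Something remains because the variance
    is at least \<open>\<sigma>\<close>^2 > 0.\<close>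
  define I where "I = {n. n < N \<and> b n \<noteq> 0}"
  define s where "s = sqrt (\<Sum>n\<in>I. (\<bar>b n\<bar> * (1 / sqrt 2))\<^sup>2)"
  have fin: "finite I" by (rule finite_subset[of _ "{..<N}"]) (auto simp: I_def)
  have s_eq: "(\<Sum>n\<in>I. (\<bar>b n\<bar> * (1 / sqrt 2))\<^sup>2) = (\<Sum>n<N. (b n)\<^sup>2) / 2"
  proof -
    have "(\<Sum>n\<in>I. (\<bar>b n\<bar> * (1 / sqrt 2))\<^sup>2) = (\<Sum>n<N. (b n)\<^sup>2 / 2)"
      by (rule sum.mono_neutral_cong_left) (auto simp: I_def power_mult_distrib power_divide)
    thus ?thesis by (simp add: sum_divide_distrib)
  qed
  have \<sigma>s: "\<sigma> \<le> s"
    using \<sigma> unfolding s_def s_eq by (intro real_le_rsqrt) auto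
  have ne: "I \<noteq> {}" using \<sigma>s \<sigma>(1) by (auto simp: s_def)
  have "distributed M lborel (\<lambda>\<omega>. \<Sum>n\<in>I. 0 + b n * Re (X n \<omega>))
      (normal_density (\<Sum>n\<in>I. 0 + b n * 0) (sqrt (\<Sum>n\<in>I. (\<bar>b n\<bar> * (1 / sqrt 2))\<^sup>2)))"
  proof (rule sum_indep_normal[OF fin ne])
    show "indep_vars (\<lambda>i. borel) (\<lambda>n \<omega>. 0 + b n * Re (X n \<omega>)) I"
      by (rule indep_vars_compose2[OF indep_vars_subset[OF X(2)], of I "\<lambda>n z. 0 + b n * Re z"]) auto
    show "0 < \<bar>b n\<bar> * (1 / sqrt 2)" if "n \<in> I" for n using that by (simp add: I_def)
    show "distributed M lborel (\<lambda>\<omega>. 0 + b n * Re (X n \<omega>)) (normal_density (0 + b n * 0) (\<bar>b n\<bar> * (1 / sqrt 2)))"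
      if "n \<in> I" for n
      using that by (intro normal_density_affine std_complex_gaussian_Re X) (auto simp: I_def)
  qed
  moreover have "(\<Sum>n\<in>I. 0 + b n * Re (X n \<omega>)) = (\<Sum>n<N. b n * Re (X n \<omega>))" for \<omega>
    by (rule sum.mono_neutral_cong_left) (auto simp: I_def)
  ultimately have "distributed M lborel (\<lambda>\<omega>. \<Sum>n<N. b n * Re (X n \<omega>)) (normal_density 0 s)"
    by (simp add: s_def)
  hence *: "emeasure M {\<omega>\<in>space M. \<bar>\<Sum>n<N. b n * Re (X n \<omega>)\<bar> < K} \<le> ennreal (K / s)"
    using \<sigma>s \<sigma>(1) K by (intro normal_small_ball) auto
  have "emeasure M {\<omega>\<in>space M. cmod (\<Sum>n<N. of_real (b n) * X n \<omega>) < K} \<le>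
      emeasure M {\<omega>\<in>space M. \<bar>\<Sum>n<N. b n * Re (X n \<omega>)\<bar> < K}"
  proof (rule emeasure_mono)
    have "\<bar>\<Sum>n<N. b n * Re (X n \<omega>)\<bar> \<le> cmod (\<Sum>n<N. of_real (b n) * X n \<omega>)" for \<omega>
      using abs_Re_le_cmod[of "\<Sum>n<N. of_real (b n) * X n \<omega>"] by simp
    thus "{\<omega>\<in>space M. cmod (\<Sum>n<N. of_real (b n) * X n \<omega>) < K} \<subseteq> {\<omega>\<in>space M. \<bar>\<Sum>n<N. b n * Re (X n \<omega>)\<bar> < K}"
      using order.strict_trans1 by blast
  qed measurable
  also note *
  also have "ennreal (K / s) \<le> ennreal (K / \<sigma>)"
    using \<sigma>s \<sigma>(1) K by (intro ennreal_leI divide_left_mono) auto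
  finally show ?thesis .
qed

text \<open>The expected length of the set of t with |G(r e(t))| < K is estimated twice. On an event
  of probability above 1/2 the L^1 means are bounded and Markov's inequality makes the length at
  least 1/2, so the expectation is at least 1/4. If the squares are not summable, some radius r
  gives variances so large that each t lies in the set with probability at most 1/8.\<close>

lemma (in prob_space) hardy1_imp_l2:
  assumes X: "\<And>n. std_complex_gaussian M (X n)" "indep_vars (\<lambda>_. borel) X UNIV"
    and H: "AE \<omega> in M. power_series_in (\<lambda>n. of_real (a n) * X n \<omega>) hardy1"
  shows "summable (\<lambda>n. (a n :: real)\<^sup>2)"
proof (rule ccontr)
  assume ns: "\<not> summable (\<lambda>n. (a n)\<^sup>2)"
  note [measurable] = distributed_std_complex_gaussian(2)[OF X(1)]
  interpret Mt: pair_sigma_finite M lborel ..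
  \<comment> \<open>Countably many radii tending to 1 keep the event \<open>E B\<close> measurable;
    the 2 makes the first radius positive.\<close>
  define r where "r j = 1 - 1 / (real j + 2)" for j :: nat
  have r: "0 < r j" "r j < 1" for j by (auto simp: r_def field_simps)
  define G where "G j \<omega> t = (\<Sum>n. of_real (a n) * X n \<omega> * (of_real (r j) * ee t) ^ n)" for j \<omega> t
  have G_meas [measurable]: "(\<lambda>p. G j (fst p) (snd p)) \<in> borel_measurable (M \<Otimes>\<^sub>M lborel)" for j
    unfolding G_def by measurable
  have G_meas1 [measurable]: "(\<lambda>\<omega>. G j \<omega> t) \<in> borel_measurable M" for j t
    unfolding G_def by measurable
  define J where "J j \<omega> = (LINT t:{0..1}|lborel. cmod (G j \<omega> t))" for j \<omega>
  have [measurable]: "J j \<in> borel_measurable M" for j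
    unfolding J_def set_lebesgue_integral_def
    by (intro lborel.borel_measurable_lebesgue_integral) (simp add: case_prod_beta)
  define E where "E B = {\<omega>\<in>space M. \<forall>j. J j \<omega> \<le> real B}" for B :: nat
  have [measurable]: "E B \<in> events" for B unfolding E_def by measurable
  have good: "AE \<omega> in M. (\<exists>B. \<omega> \<in> E B) \<and> (\<forall>j t. summable (\<lambda>n. of_real (a n) * X n \<omega> * (of_real (r j) * ee t) ^ n)) \<and>
      (\<forall>j. continuous_on UNIV (G j \<omega>))"
    using H AE_space
  proof eventually_elim
    case (elim \<omega>)
    define F where "F = (\<lambda>z. \<Sum>n. of_real (a n) * X n \<omega> * z ^ n)"
    have in_ball: "of_real (r j) * ee t \<in> ball 0 1" for j t using r[of j] by (simp add: norm_mult)
    have F: "F holomorphic_on ball 0 1"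
        "bdd_above ((\<lambda>r. LINT \<theta>:{0..1}|lborel. cmod (F (of_real r * ee \<theta>))) ` {0..<1})"
      using elim(1) by (auto simp: power_series_in_def hardy1_def F_def)
    have GF: "G j \<omega> t = F (of_real (r j) * ee t)" for j t by (simp add: G_def F_def)
    from F(2) obtain b where "\<forall>x\<in>(\<lambda>r. LINT \<theta>:{0..1}|lborel. cmod (F (of_real r * ee \<theta>))) ` {0..<1}. x \<le> b"
      unfolding bdd_above_def by blast
    hence b: "\<And>r. r \<in> {0..<1} \<Longrightarrow> (LINT \<theta>:{0..1}|lborel. cmod (F (of_real r * ee \<theta>))) \<le> b"
      by blast
    obtain B :: nat where "b \<le> real B" using real_arch_simple by blast
    moreover have "J j \<omega> \<le> b" for j unfolding J_def GF using r[of j] by (intro b) auto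
    ultimately have "\<omega> \<in> E B" using elim(2) by (auto simp: E_def intro: order.trans)
    moreover have "continuous_on UNIV (G j \<omega>)" for j
    proof -
      have "continuous_on UNIV (\<lambda>t. F (of_real (r j) * ee t))"
        by (rule continuous_on_compose2[OF holomorphic_on_imp_continuous_on[OF F(1)]])
           (use in_ball in \<open>auto intro!: continuous_intros simp del: mem_ball\<close>)
      thus ?thesis by (simp add: GF[abs_def])
    qed
    ultimately show ?case using elim(1) in_ball by (auto simp: power_series_in_def)
  qed
  have "incseq E" by (intro incseq_SucI) (auto simp: E_def intro: order.trans)
  hence "(\<lambda>B. prob (E B)) \<longlonglongrightarrow> prob (\<Union>B. E B)" by (intro finite_Lim_measure_incseq) auto
  moreover have "AE \<omega> in M. \<omega> \<in> (\<Union>B. E B)" using good by eventually_elim auto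
  hence "prob (\<Union>B. E B) = 1" by (subst prob_eq_1) auto
  ultimately have "eventually (\<lambda>B. 1 / 2 < prob (E B)) sequentially"
    by (intro order_tendstoD) auto
  then obtain B where B: "1 / 2 < prob (E B)" by (auto simp: eventually_sequentially)
  \<comment> \<open>Markov's inequality then leaves length at most B/K <= 1/2 for |G| >= K; adding 1
    keeps K positive. The choice \<open>\<sigma>\<close> = 8K below makes the small ball bound
    K/\<open>\<sigma>\<close> equal to 1/8.\<close>
  define K where "K = 2 * real B + 1"
  have K: "0 < K" "real B / K \<le> 1 / 2" by (auto simp: K_def field_simps)
  define \<sigma> where "\<sigma> = 8 * K"
  have "\<exists>N0. 2 * \<sigma>\<^sup>2 < (\<Sum>n<N0. (a n)\<^sup>2)"
  proof (rule ccontr)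
    assume "\<not> ?thesis"
    hence le: "(\<Sum>n<N. (a n)\<^sup>2) \<le> 2 * \<sigma>\<^sup>2" for N by (auto simp: not_less)
    have "summable (\<lambda>n. (a n)\<^sup>2)"
      by (rule bounded_imp_summable[of _ "2 * \<sigma>\<^sup>2"]) (simp_all only: lessThan_Suc_atMost[symmetric] le zero_le_power2)
    with ns show False by simp
  qed
  then obtain N0 where N0: "2 * \<sigma>\<^sup>2 < (\<Sum>n<N0. (a n)\<^sup>2)" by blast
  have "r \<longlonglongrightarrow> 1" unfolding r_def by real_asymp
  hence "(\<lambda>j. \<Sum>n<N0. (a n * r j ^ n)\<^sup>2) \<longlonglongrightarrow> (\<Sum>n<N0. (a n * 1 ^ n)\<^sup>2)" by (intro tendsto_intros)
  hence "eventually (\<lambda>j. 2 * \<sigma>\<^sup>2 < (\<Sum>n<N0. (a n * r j ^ n)\<^sup>2)) sequentially"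
    using N0 by (intro order_tendstoD) auto
  then obtain j where j: "2 * \<sigma>\<^sup>2 < (\<Sum>n<N0. (a n * r j ^ n)\<^sup>2)" by (auto simp: eventually_sequentially)
  have small: "emeasure M {\<omega>\<in>space M. cmod (G j \<omega> t) < K} \<le> ennreal (1 / 8)" for t
  proof -
    define S where "S N \<omega> = (\<Sum>n<N. of_real (a n) * X n \<omega> * (of_real (r j) * ee t) ^ n)" for N \<omega>
    have [measurable]: "S N \<in> borel_measurable M" for N unfolding S_def by measurable
    have SK: "emeasure M {\<omega>\<in>space M. cmod (S N \<omega>) < K} \<le> ennreal (1 / 8)" if N: "N \<ge> N0" for N
    proof -
      have "emeasure M {\<omega>\<in>space M. cmod (\<Sum>n<N. of_real (a n * r j ^ n) * (ee t ^ n * X n \<omega>)) < K} \<le> ennreal (K / \<sigma>)"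
      proof (rule gaussian_sum_small_ball)
        show "std_complex_gaussian M (\<lambda>\<omega>. ee t ^ n * X n \<omega>)" for n
          by (intro std_complex_gaussian_rotate X) (simp add: norm_power)
        show "indep_vars (\<lambda>_. borel) (\<lambda>n \<omega>. ee t ^ n * X n \<omega>) UNIV"
          by (rule indep_vars_compose2[OF X(2), of "\<lambda>n z. ee t ^ n * z"]) measurable
        have "(\<Sum>n<N0. (a n * r j ^ n)\<^sup>2) \<le> (\<Sum>n<N. (a n * r j ^ n)\<^sup>2)"
          using N by (intro sum_mono2) auto
        thus "\<sigma>\<^sup>2 \<le> (\<Sum>n<N. (a n * r j ^ n)\<^sup>2) / 2" using j by simp
      qed (use K in \<open>auto simp: \<sigma>_def\<close>)
      also have "K / \<sigma> = 1 / 8" using K by (simp add: \<sigma>_def)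
      also have "(\<lambda>\<omega>. \<Sum>n<N. of_real (a n * r j ^ n) * (ee t ^ n * X n \<omega>)) = S N"
        by (simp add: S_def fun_eq_iff power_mult_distrib mult_ac)
      hence "{\<omega>\<in>space M. cmod (\<Sum>n<N. of_real (a n * r j ^ n) * (ee t ^ n * X n \<omega>)) < K} = {\<omega>\<in>space M. cmod (S N \<omega>) < K}"
        by (simp add: fun_eq_iff)
      finally show ?thesis .
    qed
    have "emeasure M {\<omega>\<in>space M. cmod (G j \<omega> t) < K} = (\<integral>\<^sup>+\<omega>. indicator {\<omega>\<in>space M. cmod (G j \<omega> t) < K} \<omega> \<partial>M)"
      by (subst nn_integral_indicator) auto
    \<comment> \<open>The condition |G| < K is open, so the partial sums satisfy it eventually, and
      Fatou's lemma carries the bound for the partial sums over to G.\<close>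
    also have "\<dots> \<le> (\<integral>\<^sup>+\<omega>. liminf (\<lambda>N. indicator {\<omega>\<in>space M. cmod (S N \<omega>) < K} \<omega>) \<partial>M)"
    proof (rule nn_integral_mono_AE)
      show "AE \<omega> in M. (indicator {\<omega>\<in>space M. cmod (G j \<omega> t) < K} \<omega> :: ennreal) \<le>
          liminf (\<lambda>N. indicator {\<omega>\<in>space M. cmod (S N \<omega>) < K} \<omega>)"
        using good
      proof eventually_elim
        case (elim \<omega>)
        show ?case
        proof (cases "\<omega> \<in> space M \<and> cmod (G j \<omega> t) < K")
          case True
          have "(\<lambda>N. cmod (S N \<omega>)) \<longlonglongrightarrow> cmod (G j \<omega> t)"
            unfolding S_def G_def using elim by (intro tendsto_norm summable_LIMSEQ) blast
          hence "eventually (\<lambda>N. cmod (S N \<omega>) < K) sequentially"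
            using True by (intro order_tendstoD) auto
          hence "1 \<le> liminf (\<lambda>N. indicator {\<omega>\<in>space M. cmod (S N \<omega>) < K} \<omega> :: ennreal)"
            using True by (intro Liminf_bounded) (auto elim!: eventually_mono)
          thus ?thesis using True by simp
        next
          case False
          hence "\<omega> \<notin> {\<omega>\<in>space M. cmod (G j \<omega> t) < K}" by simp
          hence z: "indicator {\<omega>\<in>space M. cmod (G j \<omega> t) < K} \<omega> = (0::ennreal)" by (rule indicator_simps(2))
          show ?thesis unfolding z by (rule zero_le)
        qed
      qed
    qed
    also have "\<dots> \<le> liminf (\<lambda>N. \<integral>\<^sup>+\<omega>. indicator {\<omega>\<in>space M. cmod (S N \<omega>) < K} \<omega> \<partial>M)"
      by (rule nn_integral_liminf) measurable
    also have "\<dots> = liminf (\<lambda>N. emeasure M {\<omega>\<in>space M. cmod (S N \<omega>) < K})"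
      by (subst nn_integral_indicator) auto
    also have "\<dots> \<le> ennreal (1 / 8)"
      by (intro Liminf_le eventually_mono[OF eventually_ge_at_top[of N0]] SK) auto
    finally show ?thesis .
  qed
  let ?I = "\<lambda>\<omega> t. indicator {p. cmod (G j (fst p) (snd p)) < K} (\<omega>, t) * indicator {0..1} t :: ennreal"
  have I_meas: "(\<lambda>p. ?I (fst p) (snd p)) \<in> borel_measurable (M \<Otimes>\<^sub>M lborel)"
    unfolding indicator_def by measurable
  have "(\<integral>\<^sup>+\<omega>. \<integral>\<^sup>+t. ?I \<omega> t \<partial>lborel \<partial>M) = (\<integral>\<^sup>+t. \<integral>\<^sup>+\<omega>. ?I \<omega> t \<partial>M \<partial>lborel)"
    using I_meas by (intro Mt.Fubini'[symmetric]) (simp add: case_prod_beta)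
  also have "\<dots> \<le> (\<integral>\<^sup>+t. ennreal (1 / 8) * indicator {0..1::real} t \<partial>lborel)"
  proof (rule nn_integral_mono)
    fix t
    have "(\<integral>\<^sup>+\<omega>. ?I \<omega> t \<partial>M) = (\<integral>\<^sup>+\<omega>. indicator {\<omega>\<in>space M. cmod (G j \<omega> t) < K} \<omega> * indicator {0..1} t \<partial>M)"
      by (intro nn_integral_cong) (auto simp: indicator_def)
    also have "\<dots> = emeasure M {\<omega>\<in>space M. cmod (G j \<omega> t) < K} * indicator {0..1} t"
      by (subst nn_integral_multc) (auto simp: nn_integral_indicator)
    also have "\<dots> \<le> ennreal (1 / 8) * indicator {0..1} t"
      by (intro mult_right_mono small) simp
    finally show "(\<integral>\<^sup>+\<omega>. ?I \<omega> t \<partial>M) \<le> ennreal (1 / 8) * indicator {0..1} t" .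
  qed
  also have "\<dots> = ennreal (1 / 8)" by (simp add: nn_integral_cmult)
  finally have upper: "(\<integral>\<^sup>+\<omega>. \<integral>\<^sup>+t. ?I \<omega> t \<partial>lborel \<partial>M) \<le> ennreal (1 / 8)" .
  have "ennreal (1 / 4) \<le> ennreal (1 / 2 * prob (E B))"
    using B by (intro ennreal_leI) simp
  also have "\<dots> = ennreal (1 / 2) * emeasure M (E B)"
    unfolding emeasure_eq_measure by (rule ennreal_mult) simp_all
  also have "\<dots> = (\<integral>\<^sup>+\<omega>. ennreal (1 / 2) * indicator (E B) \<omega> \<partial>M)"
    by (simp add: nn_integral_cmult)
  also have "\<dots> \<le> (\<integral>\<^sup>+\<omega>. \<integral>\<^sup>+t. ?I \<omega> t \<partial>lborel \<partial>M)"
  proof (rule nn_integral_mono_AE)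
    show "AE \<omega> in M. ennreal (1 / 2) * indicator (E B) \<omega> \<le> (\<integral>\<^sup>+t. ?I \<omega> t \<partial>lborel)"
      using good
    proof eventually_elim
      case (elim \<omega>)
      show ?case
      proof (cases "\<omega> \<in> E B")
        case True
        have cont: "continuous_on UNIV (G j \<omega>)" using elim by blast
        hence [measurable]: "G j \<omega> \<in> borel_measurable borel" by (rule borel_measurable_continuous_onI)
        have int: "set_integrable lborel {0..1} (\<lambda>t. cmod (G j \<omega> t))"
          by (intro set_integral_continuous_integrable continuous_intros cont)
        have nn: "(\<integral>\<^sup>+t. ennreal (cmod (G j \<omega> t) * indicator {0..1} t) \<partial>lborel) = ennreal (J j \<omega>)"
          using int unfolding J_def set_integrable_def set_lebesgue_integral_def
          by (subst nn_integral_eq_integral[symmetric]) (auto simp: mult.commute)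
        have "(1::ennreal) = (\<integral>\<^sup>+t. indicator {0..1::real} t \<partial>lborel)" by simp
        \<comment> \<open>Markov's inequality: at each point either |G| < K or |G|/K >= 1.\<close>
        also have "\<dots> \<le> (\<integral>\<^sup>+t. ?I \<omega> t + ennreal (1 / K) * ennreal (cmod (G j \<omega> t) * indicator {0..1} t) \<partial>lborel)"
        proof (rule nn_integral_mono)
          fix t
          show "indicator {0..1::real} t \<le> ?I \<omega> t + ennreal (1 / K) * ennreal (cmod (G j \<omega> t) * indicator {0..1} t)"
          proof (cases "t \<in> {0..1} \<and> \<not> cmod (G j \<omega> t) < K")
            case True
            hence "1 \<le> 1 / K * cmod (G j \<omega> t)" using K by (simp add: field_simps)
            hence "ennreal 1 \<le> ennreal (1 / K * cmod (G j \<omega> t))" by (rule ennreal_leI)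
            also have "\<dots> = ennreal (1 / K) * ennreal (cmod (G j \<omega> t))"
              using K by (intro ennreal_mult) auto
            finally show ?thesis using True by (simp add: indicator_def)
          qed (auto simp: indicator_def)
        qed
        also have "\<dots> = (\<integral>\<^sup>+t. ?I \<omega> t \<partial>lborel) + ennreal (1 / K) * ennreal (J j \<omega>)"
          unfolding nn[symmetric]
          by (subst nn_integral_add) (auto simp: nn_integral_cmult indicator_def)
        also have "ennreal (1 / K) * ennreal (J j \<omega>) \<le> ennreal (1 / K) * ennreal (real B)"
          using True by (intro mult_left_mono ennreal_leI) (auto simp: E_def)
        also have "\<dots> = ennreal (real B / K)" using K by (simp add: ennreal_mult[symmetric])
        also have "\<dots> \<le> ennreal (1 / 2)" using K by (intro ennreal_leI) auto
        finally have "1 \<le> (\<integral>\<^sup>+t. ?I \<omega> t \<partial>lborel) + ennreal (1 / 2)" by (simp add: add_left_mono)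
        hence "ennreal (1 / 2) + ennreal (1 / 2) \<le> ennreal (1 / 2) + (\<integral>\<^sup>+t. ?I \<omega> t \<partial>lborel)"
          by (subst ennreal_plus[symmetric]) (simp_all add: add.commute)
        hence "ennreal (1 / 2) \<le> (\<integral>\<^sup>+t. ?I \<omega> t \<partial>lborel)"
          unfolding ennreal_add_left_cancel_le infinity_ennreal_def using ennreal_neq_top by blast
        thus ?thesis using True by simp
      qed simp
    qed
  qed
  also note upper
  finally show False by (simp add: ennreal_le_iff)
qed

section \<open>Uniform smallness of the tails\<close>

text \<open>Open arc and strict inequality make the condition open in x: it persists on a smaller
  arc, and it can be tested at rational points, which gives measurability.\<close>

definition tail_exceeds :: "(nat \<Rightarrow> complex) \<Rightarrow> real \<Rightarrow> real \<Rightarrow> real \<Rightarrow> nat \<Rightarrow> bool" where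
  "tail_exceeds c s t \<epsilon> m \<longleftrightarrow> (\<exists>M. \<exists>x\<in>{s<..<t}. \<epsilon> < (\<Sum>n\<in>{m<..M}. (cmod (poly (block c n) (ee x)))\<^sup>2))"

lemma tail_exceeds_antimono: "tail_exceeds c s t \<epsilon> m' \<Longrightarrow> m \<le> m' \<Longrightarrow> tail_exceeds c s t \<epsilon> m"
  unfolding tail_exceeds_def
proof (elim exE bexE, intro exI bexI)
  fix M x assume "m \<le> m'" "\<epsilon> < (\<Sum>n\<in>{m'<..M}. (cmod (poly (block c n) (ee x)))\<^sup>2)"
  moreover have "(\<Sum>n\<in>{m'<..M}. (cmod (poly (block c n) (ee x)))\<^sup>2) \<le> (\<Sum>n\<in>{m<..M}. (cmod (poly (block c n) (ee x)))\<^sup>2)"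
    using \<open>m \<le> m'\<close> by (intro sum_mono2) auto
  ultimately show "\<epsilon> < (\<Sum>n\<in>{m<..M}. (cmod (poly (block c n) (ee x)))\<^sup>2)" by linarith
qed

lemma poly_block: "poly (block c n) (ee x) = (\<Sum>k<2 ^ (n + 2). of_real (trapezoid n k) * c k * ee x ^ k)"
  by (simp add: block_def poly_sum poly_monom)

text \<open>For n > m the block uses only frequencies above 2^(n-1) >= 2^m > m. Tails of blocks
  therefore ignore initial coefficients, which makes the events below tail events.\<close>

lemma block_cong:
  assumes "\<And>k. k \<ge> m \<Longrightarrow> c k = c' k" "m < n"
  shows "block c n = block c' n"
  unfolding block_def
proof (intro sum.cong refl)
  fix k
  have "m < 2 ^ m" by simp
  also have "(2::nat) ^ m \<le> 2 ^ (n - 1)" using assms by (intro power_increasing) auto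
  finally have "2 * m \<le> 2 ^ n" using assms by (cases n) auto
  hence "trapezoid n k = 0" if "k < m" using that assms by (intro trapezoid_eq_0_low) auto
  thus "monom (of_real (trapezoid n k) * c k) k = monom (of_real (trapezoid n k) * c' k) k"
    using assms(1)[of k] by (cases "k < m") auto
qed

lemma tail_exceeds_cong:
  assumes "\<And>k. k \<ge> m \<Longrightarrow> c k = c' k"
  shows "tail_exceeds c s t \<epsilon> m \<longleftrightarrow> tail_exceeds c' s t \<epsilon> m"
proof -
  have "(\<Sum>n\<in>{m<..M}. (cmod (poly (block c n) (ee x)))\<^sup>2) = (\<Sum>n\<in>{m<..M}. (cmod (poly (block c' n) (ee x)))\<^sup>2)" for M x
    by (intro sum.cong refl) (simp add: block_cong[OF assms])
  thus ?thesis by (simp add: tail_exceeds_def)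
qed

lemma block_rotate: "poly (block c n) (ee (x + \<alpha>)) = poly (block (\<lambda>k. ee (real k * \<alpha>) * c k) n) (ee x)"
  unfolding poly_block
  by (intro sum.cong refl) (simp add: ee_add power_mult_distrib flip: ee_power)

text \<open>Moving the arc amounts to a unimodular twist of the coefficients, which leaves the law
  of a Gaussian sequence unchanged.\<close>

lemma tail_exceeds_rotate: "tail_exceeds c (s + \<alpha>) (t + \<alpha>) \<epsilon> m \<longleftrightarrow> tail_exceeds (\<lambda>k. ee (real k * \<alpha>) * c k) s t \<epsilon> m"
  unfolding tail_exceeds_def
proof (intro iffI; elim exE bexE)
  fix M x
  assume x: "x \<in> {s + \<alpha><..<t + \<alpha>}" and large: "\<epsilon> < (\<Sum>n\<in>{m<..M}. (cmod (poly (block c n) (ee x)))\<^sup>2)"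
  have "\<epsilon> < (\<Sum>n\<in>{m<..M}. (cmod (poly (block (\<lambda>k. ee (real k * \<alpha>) * c k) n) (ee (x - \<alpha>))))\<^sup>2)"
    using large unfolding block_rotate[symmetric] diff_add_cancel .
  moreover have "x - \<alpha> \<in> {s<..<t}" using x by auto
  ultimately show "\<exists>M. \<exists>x\<in>{s<..<t}. \<epsilon> < (\<Sum>n\<in>{m<..M}. (cmod (poly (block (\<lambda>k. ee (real k * \<alpha>) * c k) n) (ee x)))\<^sup>2)"
    by (intro exI bexI)
next
  fix M x
  assume x: "x \<in> {s<..<t}"
    and large: "\<epsilon> < (\<Sum>n\<in>{m<..M}. (cmod (poly (block (\<lambda>k. ee (real k * \<alpha>) * c k) n) (ee x)))\<^sup>2)"
  have "\<epsilon> < (\<Sum>n\<in>{m<..M}. (cmod (poly (block c n) (ee (x + \<alpha>))))\<^sup>2)"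
    using large unfolding block_rotate[symmetric] .
  moreover have "x + \<alpha> \<in> {s + \<alpha><..<t + \<alpha>}" using x by auto
  ultimately show "\<exists>M. \<exists>x\<in>{s + \<alpha><..<t + \<alpha>}. \<epsilon> < (\<Sum>n\<in>{m<..M}. (cmod (poly (block c n) (ee x)))\<^sup>2)"
    by (intro exI bexI)
qed

text \<open>Rational endpoints, because an almost sure statement can be made for all arcs of a
  countable family at once.\<close>

lemma open_rat_subinterval:
  fixes f :: "real \<Rightarrow> real"
  assumes f: "continuous_on UNIV f" and x: "s < x" "x < t" "\<epsilon> < f x"
  obtains s' t' where "s' \<in> \<rat>" "t' \<in> \<rat>" "s \<le> s'" "t' \<le> t" "s' < t'" "\<And>y. s' < y \<Longrightarrow> y < t' \<Longrightarrow> \<epsilon> < f y"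
proof -
  have "open {y. \<epsilon> < f y}" by (rule open_Collect_less[OF continuous_on_const f])
  hence "open ({s<..<t} \<inter> {y. \<epsilon> < f y})" by (intro open_Int open_greaterThanLessThan)
  moreover have "x \<in> {s<..<t} \<inter> {y. \<epsilon> < f y}" using x by simp
  ultimately obtain e where "e > 0" and ball: "ball x e \<subseteq> {s<..<t} \<inter> {y. \<epsilon> < f y}"
    by (rule openE)
  have e: "s < y \<and> y < t \<and> \<epsilon> < f y" if "\<bar>y - x\<bar> < e" for y
  proof -
    have "y \<in> ball x e" using that by (simp add: dist_real_def abs_minus_commute)
    from subsetD[OF ball this] show ?thesis by simp
  qed
  have "x - e < x" "x < x + e" using \<open>e > 0\<close> by simp_all
  then obtain s' t' where s': "s' \<in> \<rat>" "x - e < s'" "s' < x" and t': "t' \<in> \<rat>" "x < t'" "t' < x + e"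
    using Rats_dense_in_real by metis
  have "\<bar>s' - x\<bar> < e" "\<bar>t' - x\<bar> < e" using s' t' by linarith+
  hence "s \<le> s'" "t' \<le> t" using e less_imp_le by blast+
  moreover have "s' < t'" using s' t' by linarith
  moreover have "\<epsilon> < f y" if "s' < y" "y < t'" for y
  proof -
    have "\<bar>y - x\<bar> < e" using that s' t' by linarith
    thus ?thesis using e by blast
  qed
  ultimately show ?thesis by (rule that[OF s'(1) t'(1)])
qed

lemma continuous_on_block_sq_sum [continuous_intros]:
  "continuous_on A (\<lambda>x. \<Sum>n\<in>S. (cmod (poly (block c n) (ee x)))\<^sup>2)"
  by (intro continuous_intros)

lemma tail_exceeds_iff_rat:
  "tail_exceeds c s t \<epsilon> m \<longleftrightarrow> (\<exists>M. \<exists>x\<in>\<rat> \<inter> {s<..<t}. \<epsilon> < (\<Sum>n\<in>{m<..M}. (cmod (poly (block c n) (ee x)))\<^sup>2))"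
proof
  assume "tail_exceeds c s t \<epsilon> m"
  then obtain M x where x: "s < x" "x < t" "\<epsilon> < (\<Sum>n\<in>{m<..M}. (cmod (poly (block c n) (ee x)))\<^sup>2)"
    by (auto simp: tail_exceeds_def)
  obtain s' t' where st: "s \<le> s'" "t' \<le> t" "s' < t'"
    and large: "\<And>y. s' < y \<Longrightarrow> y < t' \<Longrightarrow> \<epsilon> < (\<Sum>n\<in>{m<..M}. (cmod (poly (block c n) (ee y)))\<^sup>2)"
    by (rule open_rat_subinterval[OF continuous_on_block_sq_sum x]) (rule that)
  obtain y where y: "y \<in> \<rat>" "s' < y" "y < t'" using Rats_dense_in_real[OF st(3)] by blast
  show "\<exists>M. \<exists>x\<in>\<rat> \<inter> {s<..<t}. \<epsilon> < (\<Sum>n\<in>{m<..M}. (cmod (poly (block c n) (ee x)))\<^sup>2)"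
  proof (intro exI bexI)
    show "y \<in> \<rat> \<inter> {s<..<t}" using st y by simp
  qed (rule large[OF y(2,3)])
qed (auto simp: tail_exceeds_def)

lemma tail_exceeds_measurable:
  assumes [measurable]: "\<And>k. c k \<in> borel_measurable N"
  shows "Measurable.pred N (\<lambda>\<omega>. tail_exceeds (\<lambda>k. c k \<omega>) s t \<epsilon> m)"
proof -
  have rat: "(\<exists>x\<in>\<rat> \<inter> {s<..<t}. P x) \<longleftrightarrow> (\<exists>q::rat. s < of_rat q \<and> of_rat q < t \<and> P (of_rat q))" for P
    by (auto simp: Rats_def)
  have eq: "tail_exceeds (\<lambda>k. c k \<omega>) s t \<epsilon> m \<longleftrightarrow> (\<exists>M. \<exists>q::rat. s < of_rat q \<and> of_rat q < t \<and>
      \<epsilon> < (\<Sum>n\<in>{m<..M}. (cmod (\<Sum>k<2 ^ (n + 2). of_real (trapezoid n k) * c k \<omega> * ee (of_rat q) ^ k))\<^sup>2))" for \<omega>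
    unfolding tail_exceeds_iff_rat poly_block rat ..
  show ?thesis unfolding eq by measurable
qed

lemma ex_block_sum_large:
  assumes "\<epsilon> > 0" and tail_exceeds: "\<And>s t m. s \<in> \<rat> \<Longrightarrow> t \<in> \<rat> \<Longrightarrow> s < t \<Longrightarrow> tail_exceeds c s t \<epsilon> m"
  shows "\<exists>s\<in>\<rat>. \<exists>t\<in>\<rat>. s < t \<and> (\<exists>M. \<forall>x. s < x \<longrightarrow> x < t \<longrightarrow> real k * \<epsilon> \<le> (\<Sum>n\<in>{0<..M}. (cmod (poly (block c n) (ee x)))\<^sup>2))"
proof (induction k)
  case 0
  show ?case by (intro bexI[of _ 0] bexI[of _ 1]) (auto simp: sum_nonneg)
next
  case (Suc k)
  then obtain s t M where st: "s \<in> \<rat>" "t \<in> \<rat>" "s < t"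
      "\<And>x. s < x \<Longrightarrow> x < t \<Longrightarrow> real k * \<epsilon> \<le> (\<Sum>n\<in>{0<..M}. (cmod (poly (block c n) (ee x)))\<^sup>2)"
    by blast
  \<comment> \<open>Searching beyond M keeps the new blocks disjoint from those already counted, so
    each round adds another \<open>\<epsilon>\<close> on the smaller arc.\<close>
  obtain M' x where x: "s < x" "x < t" "\<epsilon> < (\<Sum>n\<in>{M<..M'}. (cmod (poly (block c n) (ee x)))\<^sup>2)"
    using tail_exceeds[OF st(1-3), of M] by (auto simp: tail_exceeds_def)
  have "M \<le> M'"
  proof (rule ccontr)
    assume "\<not> M \<le> M'"
    hence "{M<..M'} = {}" by auto
    thus False using x(3) \<open>\<epsilon> > 0\<close> by simp
  qed
  hence split: "(\<Sum>n\<in>{0<..M'}. f n) = (\<Sum>n\<in>{0<..M}. f n) + (\<Sum>n\<in>{M<..M'}. f n)" for f :: "nat \<Rightarrow> real"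
    by (subst sum.union_disjoint[symmetric]) (auto intro!: sum.cong)
  obtain s' t' where st': "s' \<in> \<rat>" "t' \<in> \<rat>" "s \<le> s'" "t' \<le> t" "s' < t'"
      "\<And>y. s' < y \<Longrightarrow> y < t' \<Longrightarrow> \<epsilon> < (\<Sum>n\<in>{M<..M'}. (cmod (poly (block c n) (ee y)))\<^sup>2)"
    by (rule open_rat_subinterval[OF continuous_on_block_sq_sum x]) (rule that)
  have "real (Suc k) * \<epsilon> \<le> (\<Sum>n\<in>{0<..M'}. (cmod (poly (block c n) (ee y)))\<^sup>2)" if "s' < y" "y < t'" for y
  proof -
    have "real k * \<epsilon> \<le> (\<Sum>n\<in>{0<..M}. (cmod (poly (block c n) (ee y)))\<^sup>2)"
      using st'(3,4) that by (intro st(4)) auto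
    moreover have "\<epsilon> < (\<Sum>n\<in>{M<..M'}. (cmod (poly (block c n) (ee y)))\<^sup>2)"
      by (rule st'(6)[OF that])
    ultimately show ?thesis unfolding split by (simp add: distrib_right)
  qed
  with st'(1,2,5) show ?case by (intro bexI[of _ s'] bexI[of _ t'] conjI exI[of _ M'] allI impI)
qed

lemma (in prob_space) tail_exceeds_tail_zero_one:
  fixes X :: "nat \<Rightarrow> 'a \<Rightarrow> complex" and a :: "nat \<Rightarrow> real" and s t \<epsilon> :: real
  assumes X: "indep_vars (\<lambda>_. borel) X UNIV"
  defines "E \<equiv> {\<omega>\<in>space M. \<forall>m. tail_exceeds (\<lambda>k. of_real (a k) * X k \<omega>) s t \<epsilon> m}"
  shows "prob E = 0 \<or> prob E = 1"
proof -
  define A where "A i = sigma_sets (space M) {X i -` B \<inter> space M |B. B \<in> sets borel}" for i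
  show ?thesis
  proof (rule kolmogorov_0_1_law[where A=A])
    show "sigma_algebra (space M) (A i)" for i
      unfolding A_def by (rule sigma_algebra_sigma_sets) auto
    show "indep_sets A UNIV" using X unfolding indep_vars_def A_def[abs_def] by simp
    show "E \<in> tail_events A"
      unfolding tail_events_def
    proof (rule INT_I)
      fix n :: nat
      define N where "N = sigma (space M) (\<Union> (A ` {n..}))"
      have "B \<subseteq> space M" if "B \<in> A i" for B i
        using that unfolding A_def by (rule sigma_sets_into_sp[rotated]) auto
      hence "\<Union> (A ` {n..}) \<subseteq> Pow (space M)" by blast
      hence N: "space N = space M" "sets N = sigma_sets (space M) (\<Union> (A ` {n..}))"
        by (simp_all add: N_def)
      have XN: "X k \<in> borel_measurable N" if "k \<ge> n" for k
      proof (rule measurableI)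
        fix B :: "complex set" assume "B \<in> sets borel"
        hence "X k -` B \<inter> space M \<in> A k" unfolding A_def by (intro sigma_sets.Basic) blast
        thus "X k -` B \<inter> space N \<in> sets N"
          unfolding N using that by (intro sigma_sets.Basic) blast
      qed simp
      \<comment> \<open>Coefficients below n are set to 0, so that everything is measurable for the
        variables from n on. The event does not notice: by \<open>tail_exceeds_cong\<close> the
        tails beyond m + n see only later coefficients, and by antitonicity in m the shift by n is
        harmless.\<close>
      define c where "c k \<omega> = (if n \<le> k then of_real (a k) * X k \<omega> else 0)" for k \<omega>
      have [measurable]: "c k \<in> borel_measurable N" for k
        unfolding c_def using XN[of k] by (cases "n \<le> k") auto
      have "Measurable.pred N (\<lambda>\<omega>. tail_exceeds (\<lambda>k. c k \<omega>) s t \<epsilon> m)" for m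
        by (rule tail_exceeds_measurable) measurable
      hence "{\<omega>\<in>space N. \<forall>m. tail_exceeds (\<lambda>k. c k \<omega>) s t \<epsilon> (m + n)} \<in> sets N"
        by measurable
      also have "{\<omega>\<in>space N. \<forall>m. tail_exceeds (\<lambda>k. c k \<omega>) s t \<epsilon> (m + n)} = E"
      proof -
        have "tail_exceeds (\<lambda>k. c k \<omega>) s t \<epsilon> (m + n) \<longleftrightarrow> tail_exceeds (\<lambda>k. of_real (a k) * X k \<omega>) s t \<epsilon> (m + n)" for m \<omega>
          by (rule tail_exceeds_cong) (simp add: c_def)
        moreover have "(\<forall>m. tail_exceeds b s t \<epsilon> (m + n)) \<longleftrightarrow> (\<forall>m. tail_exceeds b s t \<epsilon> m)" for b
          using tail_exceeds_antimono[of b s t \<epsilon>] le_add1 by blast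
        ultimately show ?thesis by (simp add: E_def N)
      qed
      finally show "E \<in> sigma_sets (space M) (\<Union> (A ` {n..}))" by (simp add: N)
    qed
  qed
qed

text \<open>Billard's argument. The limit over $m$ of the supremum over an arc of the tail sums is almost
  surely constant, and by rotation invariance the constant is the same for all arcs, however
  short. If it were positive, a large contribution found on some arc could be followed
  by another one, from later blocks, on a smaller arc inside, and so on forever.\<close>

lemma (in prob_space) blocks_uniformly_small:
  fixes X :: "nat \<Rightarrow> 'a \<Rightarrow> complex" and a :: "nat \<Rightarrow> real"
  assumes X: "\<And>n. std_complex_gaussian M (X n)" "indep_vars (\<lambda>_. borel) X UNIV"
    and bounded: "AE \<omega> in M. \<exists>B. \<forall>M x. (\<Sum>n<M. (cmod (poly (block (\<lambda>k. of_real (a k) * X k \<omega>) n) (ee x)))\<^sup>2) \<le> B"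
  shows "AE \<omega> in M. \<forall>\<rho>>0. \<exists>m. \<forall>M x. (\<Sum>n\<in>{m<..M}. (cmod (poly (block (\<lambda>k. of_real (a k) * X k \<omega>) n) (ee x)))\<^sup>2) \<le> \<rho>\<^sup>2"
proof -
  note [measurable] = distributed_std_complex_gaussian(2)[OF X(1)]
  define c where "c = (\<lambda>\<omega> k. of_real (a k) * X k \<omega>)"
  define E where "E s t \<epsilon> = {\<omega>\<in>space M. \<forall>m. tail_exceeds (c \<omega>) s t \<epsilon> m}" for s t \<epsilon>
  have tail_exceeds_meas: "Measurable.pred M (\<lambda>\<omega>. tail_exceeds (c \<omega>) s t \<epsilon> m)" for s t \<epsilon> m
    unfolding c_def by (rule tail_exceeds_measurable) measurable
  have E_meas [measurable]: "E s t \<epsilon> \<in> events" for s t \<epsilon>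
    unfolding E_def using tail_exceeds_meas by measurable
  have zero_one: "prob (E s t \<epsilon>) = 0 \<or> prob (E s t \<epsilon>) = 1" for s t \<epsilon>
    unfolding E_def c_def by (rule tail_exceeds_tail_zero_one[OF X(2)])
  have rotate: "prob (E (s + \<alpha>) (t + \<alpha>) \<epsilon>) = prob (E s t \<epsilon>)" for s t \<alpha> \<epsilon>
  proof -
    have "Measurable.pred (\<Pi>\<^sub>M n\<in>UNIV. borel) (\<lambda>b. \<forall>m. tail_exceeds (\<lambda>k. of_real (a k) * b k) s t \<epsilon> m)"
      by (intro pred_intros_countable tail_exceeds_measurable) measurable
    from indep_gaussian_rotate[OF X _ this, of "\<lambda>k. ee (real k * \<alpha>)"]
    have "prob {\<omega>\<in>space M. \<forall>m. tail_exceeds (\<lambda>k. of_real (a k) * (ee (real k * \<alpha>) * X k \<omega>)) s t \<epsilon> m} = prob (E s t \<epsilon>)"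
      by (simp add: E_def c_def)
    moreover have "tail_exceeds (c \<omega>) (s + \<alpha>) (t + \<alpha>) \<epsilon> m \<longleftrightarrow> tail_exceeds (\<lambda>k. of_real (a k) * (ee (real k * \<alpha>) * X k \<omega>)) s t \<epsilon> m" for \<omega> m
      unfolding tail_exceeds_rotate c_def by (simp add: mult_ac)
    ultimately show ?thesis by (simp add: E_def)
  qed
  have every_arc: "prob (E s t \<epsilon>) = 1" if full: "prob (E 0 2 \<epsilon>) \<noteq> 0" and "s < t" for s t \<epsilon>
  proof -
    define h where "h = (t - s) / 2"
    define J where "J = nat \<lceil>2 / h\<rceil> + 1"
    \<comment> \<open>The translated arcs run from (j-1)h to (j+1)h. Consecutive ones overlap, so a
      point with floor(x/h) = j is interior to the j-th arc, and j < J of them cover the interval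
      from 0 to 2.\<close>
    define \<alpha> where "\<alpha> j = real j * h - h - s" for j :: nat
    have h: "h > 0" using \<open>s < t\<close> by (simp add: h_def)
    have "E 0 2 \<epsilon> \<subseteq> (\<Union>j<J. E (s + \<alpha> j) (t + \<alpha> j) \<epsilon>)"
    proof
      fix \<omega> assume \<omega>: "\<omega> \<in> E 0 2 \<epsilon>"
      have some_arc: "\<exists>j<J. tail_exceeds (c \<omega>) (s + \<alpha> j) (t + \<alpha> j) \<epsilon> m" for m
      proof -
        have "tail_exceeds (c \<omega>) 0 2 \<epsilon> m" using \<omega> by (simp add: E_def)
        then obtain M x where x: "0 < x" "x < 2" "\<epsilon> < (\<Sum>n\<in>{m<..M}. (cmod (poly (block (c \<omega>) n) (ee x)))\<^sup>2)"
          by (auto simp: tail_exceeds_def)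
        define j where "j = nat \<lfloor>x / h\<rfloor>"
        have pos: "0 \<le> x / h" using x h by simp
        have j: "real j \<le> x / h" "x / h < real j + 1"
          unfolding j_def using pos by linarith+
        have "x / h \<le> 2 / h" using x h by (intro divide_right_mono) auto
        hence "real j \<le> 2 / h" using j by linarith
        hence "j < J" unfolding J_def by linarith
        have "s + \<alpha> j < x" "x < t + \<alpha> j"
          using j h x by (auto simp: \<alpha>_def h_def field_simps)
        hence "x \<in> {s + \<alpha> j<..<t + \<alpha> j}" by simp
        hence "tail_exceeds (c \<omega>) (s + \<alpha> j) (t + \<alpha> j) \<epsilon> m"
          unfolding tail_exceeds_def using x(3) by (intro exI bexI)
        with \<open>j < J\<close> show ?thesis by blast
      qed
      have "\<exists>j<J. \<forall>m. tail_exceeds (c \<omega>) (s + \<alpha> j) (t + \<alpha> j) \<epsilon> m"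
      proof (rule ccontr)
        assume "\<not> (\<exists>j<J. \<forall>m. tail_exceeds (c \<omega>) (s + \<alpha> j) (t + \<alpha> j) \<epsilon> m)"
        hence "\<forall>j. \<exists>m. j < J \<longrightarrow> \<not> tail_exceeds (c \<omega>) (s + \<alpha> j) (t + \<alpha> j) \<epsilon> m" by blast
        \<comment> \<open>Pigeonhole through monotonicity: if each arc failed from some threshold
          on, all would fail beyond the sum of these finitely many thresholds.\<close>
        from choice[OF this] obtain \<mu> where \<mu>: "\<And>j. j < J \<Longrightarrow> \<not> tail_exceeds (c \<omega>) (s + \<alpha> j) (t + \<alpha> j) \<epsilon> (\<mu> j)"
          by blast
        have "\<not> tail_exceeds (c \<omega>) (s + \<alpha> j) (t + \<alpha> j) \<epsilon> (\<Sum>j<J. \<mu> j)" if "j < J" for j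
          using \<mu>[OF that] tail_exceeds_antimono[of "c \<omega>" _ _ \<epsilon> "\<Sum>j<J. \<mu> j" "\<mu> j"] member_le_sum[of j "{..<J}" \<mu>] that by auto
        with some_arc[of "\<Sum>j<J. \<mu> j"] show False by blast
      qed
      thus "\<omega> \<in> (\<Union>j<J. E (s + \<alpha> j) (t + \<alpha> j) \<epsilon>)" using \<omega> by (auto simp: E_def)
    qed
    hence "prob (E 0 2 \<epsilon>) \<le> prob (\<Union>j<J. E (s + \<alpha> j) (t + \<alpha> j) \<epsilon>)"
      by (intro finite_measure_mono) auto
    also have "\<dots> \<le> (\<Sum>j<J. prob (E (s + \<alpha> j) (t + \<alpha> j) \<epsilon>))"
      by (intro finite_measure_subadditive_finite) auto
    also have "\<dots> = real J * prob (E s t \<epsilon>)" by (simp add: rotate)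
    finally have "prob (E s t \<epsilon>) \<noteq> 0" using full by (auto simp: measure_le_0_iff)
    thus ?thesis using zero_one by blast
  qed
  have null: "prob (E 0 2 \<epsilon>) = 0" if "\<epsilon> > 0" for \<epsilon>
  proof (rule ccontr)
    assume full: "prob (E 0 2 \<epsilon>) \<noteq> 0"
    have "AE \<omega> in M. \<forall>s\<in>\<rat>. \<forall>t\<in>\<rat>. s < t \<longrightarrow> \<omega> \<in> E s t \<epsilon>"
    proof (intro AE_ball_countable' countable_rat)
      fix s t :: real
      show "AE \<omega> in M. s < t \<longrightarrow> \<omega> \<in> E s t \<epsilon>"
        using every_arc[OF full, of s t] by (cases "s < t") (auto simp: prob_eq_1)
    qed
    with bounded have "AE \<omega> in M. False"
    proof eventually_elim
      case (elim \<omega>)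
      then obtain B where B: "\<And>M x. (\<Sum>n<M. (cmod (poly (block (c \<omega>) n) (ee x)))\<^sup>2) \<le> B"
        by (auto simp: c_def)
      obtain k :: nat where k: "B < real k * \<epsilon>" using reals_Archimedean3[OF \<open>\<epsilon> > 0\<close>] by blast
      have "tail_exceeds (c \<omega>) s t \<epsilon> m" if "s \<in> \<rat>" "t \<in> \<rat>" "s < t" for s t m
        using elim(2) that by (auto simp: E_def)
      from ex_block_sum_large[OF \<open>\<epsilon> > 0\<close> this, of k] obtain s t M where
        st: "s < t" "\<And>x. s < x \<Longrightarrow> x < t \<Longrightarrow> real k * \<epsilon> \<le> (\<Sum>n\<in>{0<..M}. (cmod (poly (block (c \<omega>) n) (ee x)))\<^sup>2)"
        by blast
      define x where "x = (s + t) / 2"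
      have "real k * \<epsilon> \<le> (\<Sum>n\<in>{0<..M}. (cmod (poly (block (c \<omega>) n) (ee x)))\<^sup>2)"
        using st by (intro st(2)) (auto simp: x_def)
      also have "\<dots> \<le> (\<Sum>n<Suc M. (cmod (poly (block (c \<omega>) n) (ee x)))\<^sup>2)"
        by (intro sum_mono2) auto
      also have "\<dots> \<le> B" by (rule B)
      finally show ?case using k by simp
    qed
    thus False by simp
  qed
  have "AE \<omega> in M. \<omega> \<notin> E 0 2 (inverse (real (Suc j)))" for j
    using null[of "inverse (real (Suc j))"] by (subst prob_eq_0[symmetric]) auto
  hence "AE \<omega> in M. \<forall>j. \<omega> \<notin> E 0 2 (inverse (real (Suc j)))" by (simp add: AE_all_countable)
  thus ?thesis using AE_space
  proof eventually_elim
    case (elim \<omega>)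
    show ?case
    proof (intro allI impI)
      fix \<rho> :: real assume "\<rho> > 0"
      then obtain j where j: "inverse (real (Suc j)) < \<rho>\<^sup>2" using reals_Archimedean[of "\<rho>\<^sup>2"] by auto
      obtain m where m: "\<not> tail_exceeds (c \<omega>) 0 2 (inverse (real (Suc j))) m"
        using elim by (auto simp: E_def)
      have "(\<Sum>n\<in>{m<..M}. (cmod (poly (block (c \<omega>) n) (ee x)))\<^sup>2) \<le> \<rho>\<^sup>2" for M x
      proof -
        \<comment> \<open>Reduction modulo 1 to the half-open interval from 0 (excluded) to 1
          (included). It lies inside the open interval from 0 to 2, which thus covers the circle
          without a seam.\<close>
        define y where "y = x - of_int \<lceil>x\<rceil> + 1"
        have "0 < y" "y < 2" unfolding y_def by linarith+
        hence "(\<Sum>n\<in>{m<..M}. (cmod (poly (block (c \<omega>) n) (ee y)))\<^sup>2) \<le> inverse (real (Suc j))"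
          using m by (auto simp: tail_exceeds_def not_less)
        moreover have "ee y = ee x" by (simp add: y_def ee_diff)
        ultimately show ?thesis using j by simp
      qed
      thus "\<exists>m. \<forall>M x. (\<Sum>n\<in>{m<..M}. (cmod (poly (block (\<lambda>k. of_real (a k) * X k \<omega>) n) (ee x)))\<^sup>2) \<le> \<rho>\<^sup>2"
        unfolding c_def by blast
    qed
  qed
qed

theorem theorem1p4:
  fixes M :: "'w measure" and a :: "nat \<Rightarrow> real" and \<xi> :: "nat \<Rightarrow> 'w \<Rightarrow> complex"
  assumes "prob_space M"
    and "\<And>n. a n \<ge> 0"
    and "\<And>n. std_complex_gaussian M (\<xi> n)"
    and "prob_space.indep_vars M (\<lambda>_. borel) \<xi> UNIV"
    and "AE \<omega> in M. power_series_in (\<lambda>n. of_real (a n) * \<xi> n \<omega>) SL"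
  shows "AE \<omega> in M. power_series_in (\<lambda>n. of_real (a n) * \<xi> n \<omega>) VMOA"
proof -
  interpret prob_space M by fact
  note \<xi> = assms(3,4)
  have "AE \<omega> in M. power_series_in (\<lambda>n. of_real (a n) * \<xi> n \<omega>) hardy1"
    using assms(5) by eventually_elim (auto simp: power_series_in_def SL_def)
  hence a: "summable (\<lambda>n. (a n)\<^sup>2)" by (rule hardy1_imp_l2[OF \<xi>])
  have radial: "AE \<omega> in M. radial_l2 (\<lambda>z. \<Sum>n. of_real (a n) * \<xi> n \<omega> * z ^ n) (\<lambda>n. of_real (a n) * \<xi> n \<omega>)"
    using assms(5) gaussian_coeffs_l2[where X=\<xi>, OF \<xi>(1) a] gaussian_series_AE_circle[OF \<xi> a]
  proof eventually_elim
    case (elim \<omega>)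
    thus ?case
      by (auto simp: radial_l2_def power_series_in_def SL_def hardy1_def
          intro!: holomorphic_on_imp_continuous_on summable_sums)
  qed
  have "AE \<omega> in M. \<exists>B. \<forall>M x. (\<Sum>n<M. (cmod (poly (block (\<lambda>k. of_real (a k) * \<xi> k \<omega>) n) (ee x)))\<^sup>2) \<le> B"
    using assms(5) radial
  proof eventually_elim
    case (elim \<omega>)
    hence "(\<lambda>z. \<Sum>n. of_real (a n) * \<xi> n \<omega> * z ^ n) \<in> SL" by (simp add: power_series_in_def)
    then obtain B where "\<And>M x. (\<Sum>n<M. (cmod (poly (block (\<lambda>k. of_real (a k) * \<xi> k \<omega>) n) (ee x)))\<^sup>2) \<le> B"
      by (rule SL_blocks_bounded[OF elim(2)]) (rule that)
    thus ?case by (intro exI[of _ B] allI)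
  qed
  hence "AE \<omega> in M. \<forall>\<rho>>0. \<exists>m. \<forall>M x. (\<Sum>n\<in>{m<..M}. (cmod (poly (block (\<lambda>k. of_real (a k) * \<xi> k \<omega>) n) (ee x)))\<^sup>2) \<le> \<rho>\<^sup>2"
    by (rule blocks_uniformly_small[OF \<xi>])
  thus ?thesis using assms(5) radial
  proof eventually_elim
    case (elim \<omega>)
    have "(\<lambda>z. \<Sum>n. of_real (a n) * \<xi> n \<omega> * z ^ n) \<in> VMOA"
      by (rule VMOA_of_blocks[OF elim(3)]) (use elim in \<open>auto simp: power_series_in_def SL_def\<close>)
    with elim(2) show ?case by (simp add: power_series_in_def)
  qed
qed

end
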